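(* Let $\mathrm{d} = q\frac{d}{dq}$ acting on $\mathbb{Q}[[q]]$, and for $r\ge 1$ and $k_1,\dots,k_r\ge 1$ let $g^{\mathrm{sh}}_{k_1,\dots,k_r}\in\mathbb{Q}[[q]]$ be the $q$-series defined in the context. (i) For every integer $k\ge 1$, $$\frac{1}{k}\,\mathrm{d}\, g^{\mathrm{sh}}_k = (k+1)\, g^{\mathrm{sh}}_{k+2} - \sum_{n=2}^{k+1} (2^n-2)\, g^{\mathrm{sh}}_{k+2-n,\,n}.$$ (ii) For all integers $k_1,k_2,k_3\ge 2$, the series $\mathrm{d}\, g^{\mathrm{sh}}_{k_1,k_2}$ and $\mathrm{d}\, g^{\mathrm{sh}}_{k_1,k_2,k_3}$ can be written as $\mathbb{Q}$-linear combinations of the series $g^{\mathrm{sh}}_{l_1,\dots,l_r}$ with $r\ge 0$ and $l_1,\dots,l_r\ge 1$ (where for $r=0$ the series is $1$).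
   Context: For integers $n_1,\dots,n_m\ge 1$ set $$H\binom{n_1,\dots,n_m}{X_1,\dots,X_m} = \sum_{0<d_1<\dots<d_m} e^{d_1X_1}\left(\frac{q^{d_1}}{1-q^{d_1}}\right)^{n_1}\cdots e^{d_mX_m}\left(\frac{q^{d_m}}{1-q^{d_m}}\right)^{n_m},$$ a formal power series in $X_1,\dots,X_m$ with coefficients in $\mathbb{Q}[[q]]$. For $k_1,\dots,k_r\ge1$ ($r\geq 1$) the $q$-series $g^{\mathrm{sh}}_{k_1,\dots,k_r}\in\mathbb{Q}[[q]]$ are defined as the coefficients of the generating function $$\sum_{k_1,\dots,k_r\ge1} g^{\mathrm{sh}}_{k_1,\dots,k_r}X_1^{k_1-1}\cdots X_r^{k_r-1} := \sum_{m=1}^{r}\ \sum_{\substack{i_1+\dots+i_m=r\\ i_1,\dots,i_m\ge1}}\frac{1}{i_1!\cdots i_m!}\,H\binom{i_1,\,i_2,\,\dots,\,i_m}{X_r-X_{r-i_1},\;X_{r-i_1}-X_{r-i_1-i_2},\;\dots,\;X_{i_m}},$$ i.e. the $j$-th lower entry is $X_{r-i_1-\dots-i_{j-1}}-X_{r-i_1-\dots-i_j}$ with the convention $X_0=0$. For $r=0$ the series is set to $1$. *)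

theory Defs
  imports "HOL-Analysis.Analysis" "HOL-Library.Poly_Mapping"
begin

text \<open>
  A power series in \<open>X\<^sub>1, \<dots>, X\<^sub>m\<close> over \<open>\<rat>[[q]]\<close> is represented by its coefficient function
  \<open>nat list \<Rightarrow> rat fps\<close>, where the list \<open>[a\<^sub>1, \<dots>, a\<^sub>m]\<close> stands for the monomial
  \<open>X\<^sub>1 ^ a\<^sub>1 \<cdots> X\<^sub>m ^ a\<^sub>m\<close>; the formal variable of \<^typ>\<open>rat fps\<close> is \<open>q\<close>.
\<close>

text \<open>
  The coefficients of \<open>H\<close>: in the product of the \<open>exp (d\<^sub>j X\<^sub>j)\<close>, which involve pairwise different
  variables, the coefficient of a monomial is the product of the coefficients of the univariate
  exponential series. The infinite sum is taken in the \<open>q\<close>-adic topology of \<^typ>\<open>rat fps\<close>.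
\<close>

definition H_term :: "nat list \<Rightarrow> nat list \<Rightarrow> nat list \<Rightarrow> rat fps" where
  "H_term ns as ds =
     (\<Prod>j<length ns. fps_const (fps_nth (fps_exp (of_nat (ds ! j))) (as ! j)) *
        (fps_X ^ (ds ! j) / (1 - fps_X ^ (ds ! j))) ^ (ns ! j))"

definition H_series :: "nat list \<Rightarrow> nat list \<Rightarrow> rat fps" where
  "H_series ns as =
     infsum (H_term ns as)
       {ds. length ds = length ns \<and> sorted_wrt (<) ds \<and> (\<forall>d\<in>set ds. 0 < d)}"

text \<open>
  Polynomials in \<open>X\<^sub>1, X\<^sub>2, \<dots>\<close> over \<open>\<rat>\<close>. The variable \<open>X\<^sub>i\<close> has index \<open>i - 1\<close>, so that
  \<^term>\<open>Poly_Mapping.nth es\<close> is the monomial with exponent list \<open>es\<close>.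
\<close>

type_synonym qpoly = "(nat \<Rightarrow>\<^sub>0 nat) \<Rightarrow>\<^sub>0 rat"

definition polyX :: "nat \<Rightarrow> qpoly" where
  "polyX i = (if i = 0 then 0 else Poly_Mapping.single (Poly_Mapping.single (i - 1) 1) 1)"

text \<open>
  The coefficient at the monomial \<open>es\<close> of \<open>F(L 0, \<dots>, L (m - 1))\<close>, where \<open>F\<close> is a power series in \<open>m\<close>
  variables and the \<open>L j\<close> are polynomials without constant term. The latter makes the sum finite.
\<close>

definition ps_subst :: "nat \<Rightarrow> (nat list \<Rightarrow> rat fps) \<Rightarrow> (nat \<Rightarrow> qpoly) \<Rightarrow> nat list \<Rightarrow> rat fps" where
  "ps_subst m F L es =
     (\<Sum>as | length as = m \<and>
             Poly_Mapping.lookup (\<Prod>j<m. L j ^ (as ! j)) (Poly_Mapping.nth es) \<noteq> 0.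
        F as * fps_const (Poly_Mapping.lookup (\<Prod>j<m. L j ^ (as ! j)) (Poly_Mapping.nth es)))"

text \<open>The lower entries of \<open>H\<close>, counted from \<open>j = 0\<close>.\<close>

definition lower_entry :: "nat \<Rightarrow> nat list \<Rightarrow> nat \<Rightarrow> qpoly" where
  "lower_entry r is j = polyX (r - sum_list (take j is)) - polyX (r - sum_list (take (Suc j) is))"

definition gsh_gen :: "nat \<Rightarrow> nat list \<Rightarrow> rat fps" where
  "gsh_gen r es =
     (\<Sum>m=1..r. \<Sum>is | length is = m \<and> sum_list is = r \<and> (\<forall>i\<in>set is. 1 \<le> i).
        fps_const (1 / (\<Prod>j<m. fact (is ! j))) * ps_subst m (H_series is) (lower_entry r is) es)"

definition gsh :: "nat list \<Rightarrow> rat fps" where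
  "gsh ks = (if ks = [] then 1 else gsh_gen (length ks) (map (\<lambda>k. k - 1) ks))"

global_interpretation rat_fps: vector_space "\<lambda>(c::rat) (f::rat fps). fps_const c * f"
  by standard (simp_all add: algebra_simps flip: fps_const_add fps_const_mult)

text \<open>The sums over infinite index sets above do converge, respectively have finite support.\<close>

lemma H_term_summable_on:
  assumes ns: "\<forall>n\<in>set ns. 1 \<le> n"
  shows "H_term ns as summable_on
    {ds. length ds = length ns \<and> sorted_wrt (<) ds \<and> (\<forall>d\<in>set ds. 0 < d)}"
    (is "_ summable_on ?A")
proof -
  have sub: "{ds\<in>?A. fps_nth (H_term ns as ds) N \<noteq> 0} \<subseteq> {ds. set ds \<subseteq> {..N} \<and> length ds = length ns}"
    for N
  proof safe
    fix ds d
    assume len: "length ds = length ns" and pos: "\<forall>d\<in>set ds. 0 < d"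
      and nz: "fps_nth (H_term ns as ds) N \<noteq> 0" and d: "d \<in> set ds"
    from d obtain j where j: "j < length ns" "ds ! j = d"
      using len by (metis in_set_conv_nth)
    have "1 \<le> ns ! j" and "0 < d"
      using ns pos j d by auto
    have "fps_X ^ d / (1 - fps_X ^ d :: rat fps) = fps_X ^ d * inverse (1 - fps_X ^ d)"
      using \<open>0 < d\<close> by (intro fps_divide_unit) simp
    hence "fps_X ^ d dvd (fps_X ^ d / (1 - fps_X ^ d :: rat fps))"
      by simp
    also have "\<dots> dvd (fps_X ^ d / (1 - fps_X ^ d :: rat fps)) ^ (ns ! j)"
      using \<open>1 \<le> ns ! j\<close> by (simp add: dvd_power)
    also have "\<dots> dvd fps_const (fps_nth (fps_exp (of_nat (ds ! j))) (as ! j)) *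
        (fps_X ^ (ds ! j) / (1 - fps_X ^ (ds ! j))) ^ (ns ! j)"
      using j by simp
    also have "\<dots> dvd H_term ns as ds"
      unfolding H_term_def using j by (intro dvd_prodI) auto
    finally obtain G where "H_term ns as ds = fps_X ^ d * G"
      by (elim dvdE)
    with nz show "d \<le> N"
      by (auto simp: fps_X_power_mult_nth split: if_splits)
  qed
  have fin: "finite {ds\<in>?A. fps_nth (H_term ns as ds) N \<noteq> 0}" for N
    by (rule finite_subset[OF sub]) (simp add: finite_lists_length_eq)
  have "(H_term ns as has_sum
      Abs_fps (\<lambda>N. \<Sum>ds | ds \<in> ?A \<and> fps_nth (H_term ns as ds) N \<noteq> 0. fps_nth (H_term ns as ds) N)) ?A"
    by (rule has_sum_fpsI) (use fin in simp_all)
  thus ?thesis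
    by (auto simp: summable_on_def)
qed

lemma finite_ps_subst_support:
  assumes L: "\<And>j. j < m \<Longrightarrow> Poly_Mapping.lookup (L j :: qpoly) 0 = 0"
  shows "finite {as. length as = m \<and>
    Poly_Mapping.lookup (\<Prod>j<m. L j ^ (as ! j)) (Poly_Mapping.nth es) \<noteq> 0}"
proof -
  define deg :: "(nat \<Rightarrow>\<^sub>0 nat) \<Rightarrow> nat" where "deg k = Sum_any (Poly_Mapping.lookup k)" for k
  define low :: "qpoly \<Rightarrow> nat \<Rightarrow> bool" where
    "low P n \<longleftrightarrow> (\<forall>k\<in>Poly_Mapping.keys P. n \<le> deg k)" for P n
  have deg_add: "deg (k + l) = deg k + deg l" for k l
    by (simp add: deg_def lookup_add Sum_any.distrib)
  have deg_pos: "1 \<le> deg k" if "k \<noteq> 0" for k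
  proof -
    from that obtain i where i: "Poly_Mapping.lookup k i \<noteq> 0"
      by (metis lookup_zero poly_mapping_eqI)
    have "Poly_Mapping.lookup k i \<le> deg k"
      unfolding deg_def Sum_any.expand_set using i by (intro member_le_sum) auto
    with i show ?thesis by simp
  qed
  have low_mult: "low (P * Q) (n + n')" if "low P n" "low Q n'" for P Q n n'
    unfolding low_def
  proof
    fix k assume "k \<in> Poly_Mapping.keys (P * Q)"
    then obtain a b where "k = a + b" "a \<in> Poly_Mapping.keys P" "b \<in> Poly_Mapping.keys Q"
      using keys_mult[of P Q] by blast
    with that show "n + n' \<le> deg k"
      by (auto simp: low_def deg_add intro: add_mono)
  qed
  have low_one: "low 1 0"
    by (simp add: low_def)
  have low_power: "low (P ^ a) a" if "low P 1" for P a
    using low_mult[OF that] by (induction a) (simp_all add: low_one)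
  have low_L: "low (L j) 1" if "j < m" for j
    unfolding low_def
  proof
    fix k assume "k \<in> Poly_Mapping.keys (L j)"
    with L[OF that] have "k \<noteq> 0"
      by (auto simp: in_keys_iff)
    thus "1 \<le> deg k" by (rule deg_pos)
  qed
  have low_prod: "low (\<Prod>j<m'. L j ^ (as ! j)) (\<Sum>j<m'. as ! j)" if "m' \<le> m" for m' as
    using that by (induction m') (auto simp: low_one intro!: low_mult low_power low_L)
  have "{as. length as = m \<and>
      Poly_Mapping.lookup (\<Prod>j<m. L j ^ (as ! j)) (Poly_Mapping.nth es) \<noteq> 0} \<subseteq>
    {as. set as \<subseteq> {..deg (Poly_Mapping.nth es)} \<and> length as = m}"
  proof safe
    fix as a
    assume nz: "Poly_Mapping.lookup (\<Prod>j<length as. L j ^ (as ! j)) (Poly_Mapping.nth es) \<noteq> 0"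
      and m: "m = length as" and a: "a \<in> set as"
    from a obtain i where i: "i < length as" "as ! i = a"
      by (metis in_set_conv_nth)
    have "a \<le> (\<Sum>j<length as. as ! j)"
      using member_le_sum[of i "{..<length as}" "\<lambda>j. as ! j"] i by simp
    also have "\<dots> \<le> deg (Poly_Mapping.nth es)"
      using low_prod[of m as] nz m unfolding low_def by (simp add: in_keys_iff)
    finally show "a \<le> deg (Poly_Mapping.nth es)" .
  qed
  thus ?thesis
    by (rule finite_subset) (simp add: finite_lists_length_eq)
qed

lemma lookup_lower_entry_0: "Poly_Mapping.lookup (lower_entry r is j) 0 = 0"
proof -
  have "Poly_Mapping.single i (1::nat) \<noteq> 0" for i :: nat
    by (metis lookup_single_eq lookup_zero zero_neq_one)
  thus ?thesis
    by (simp add: lower_entry_def polyX_def lookup_minus lookup_single when_def)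
qed

end

theory Submission
  imports Defs
begin

text \<open>
  Put \<open>f\<^sub>d = q\<^sup>d / (1 - q\<^sup>d)\<close>. For exponents \<open>n\<^sub>1, \<dots>, n\<^sub>m\<close> and a polynomial \<open>p\<close> consider the sum of
  \<open>p(d\<^sub>1, \<dots>, d\<^sub>m) \<Prod> f\<^sub>d\<^sub>j ^ n\<^sub>j\<close> over \<open>d\<^sub>1 < \<dots> < d\<^sub>m\<close>; its degree is \<open>n\<^sub>1 + \<dots> + n\<^sub>m\<close>. Up to
  factorials, the series \<open>gsh\<close> with \<open>r\<close> indices are the sums of \<open>p(d) \<Prod> f\<^sub>d\<^sub>j / \<Prod> (multiplicities)!\<close>
  over \<open>d\<^sub>1 \<le> \<dots> \<le> d\<^sub>r\<close>, where \<open>p\<close> is a monomial in the increments of \<open>d\<close>. In this form they satisfy a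
  shuffle product, so their span is closed under multiplication.

  A product of a sum of degree \<open>1\<close> with another sum can be expanded in two ways: by comparing the
  summation indices, and by the partial fraction identity \<open>f\<^sub>a f\<^sub>b = f\<^sub>a\<^sub>+\<^sub>b (1 + f\<^sub>a + f\<^sub>b)\<close>. In the case of
  two sums of degree \<open>1\<close> this gives part (i), because \<open>q d/dq f\<^sub>d = d (f\<^sub>d + f\<^sub>d\<^sup>2)\<close>. For part (ii) take
  \<open>p\<close> to be an \<open>N\<close>-th power of a linear form and apply a linear functional that vanishes on the span of
  the \<open>gsh\<close>. The two expansions become functional equations in the coefficients of the linear form, up
  to terms of lower degree. In degrees \<open>2\<close> and \<open>3\<close>, and in degree \<open>4\<close> for \<open>N \<ge> 3\<close>, they have only the
  zero solution. Hence the span contains these sums, and the derivatives in part (ii) are among them.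
\<close>

section \<open>Chain sums\<close>

text \<open>The induction runs on the degree \<open>n\<close>: \<open>words_spanned n\<close> puts
  every sum of degree at most \<open>n\<close> into \<open>gspan n\<close>. Then products of a
  degree 1 sum with a degree \<open>n\<close> sum lie in \<open>gspan (Suc n)\<close>, and the
  remainder of a partial fraction expansion lies in \<open>gspan n\<close>, so a functional
  vanishing on the span sees only words of degree \<open>n + 1\<close>. Powers of linear forms serve
  as test polynomials because they span the homogeneous polynomials and because, in the increments,
  partial fractions only insert the new coefficient among the old ones, while comparing indices adds
  it to some of them. A third family of relations says that the functional kills \<open>gsh\<close>
  itself. The induction does not simply go on to degree 4: a decisive step there divides by
  \<open>2 ^ N - 3 - (-1) ^ N\<close>, which is zero for \<open>N = 1\<close> and
  \<open>N = 2\<close>. The derivatives avoid these cases: entries at least 2 remove the terms with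
  repeated summation indices, so only the word with all exponents 1 is left, the derivative makes at
  most one exponent 2, and for three entries the polynomial has degree at least 3.\<close>

definition geo :: "nat \<Rightarrow> rat fps" where
  "geo d = fps_X ^ d / (1 - fps_X ^ d)"

lemma geo_times: "d > 0 \<Longrightarrow> geo d * (1 - fps_X ^ d) = fps_X ^ d"
  by (simp add: geo_def fps_divide_unit mult.assoc inverse_mult_eq_1)

lemma one_minus_X_power_nonzero: "d > 0 \<Longrightarrow> 1 - fps_X ^ d \<noteq> (0 :: rat fps)"
proof
  assume "d > 0" "1 - fps_X ^ d = (0 :: rat fps)"
  hence "fps_nth (1 - fps_X ^ d :: rat fps) 0 = fps_nth 0 0" by (simp only:)
  with \<open>d > 0\<close> show False by simp
qed

lemma X_power_dvd_geo: "d > 0 \<Longrightarrow> fps_X ^ d dvd geo d"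
  by (simp add: geo_def fps_divide_unit)

text \<open>With \<open>A\<close> and \<open>B\<close> for q^a and q^b, clearing denominators
  reduces this to \<open>1 - A * B = (1 - A) * (1 - B) + A * (1 - B) + B * (1 - A)\<close>,
  multiplied by \<open>A * B\<close>.\<close>

lemma geo_mult_geo:
  assumes "a > 0" "b > 0"
  shows "geo a * geo b = geo (a + b) * (1 + geo a + geo b)"
proof -
  define A B where "A = (fps_X ^ a :: rat fps)" and "B = (fps_X ^ b :: rat fps)"
  have "geo a * (1 - A) = A" "geo b * (1 - B) = B" "geo (a + b) * (1 - A * B) = A * B"
    using geo_times[of a] geo_times[of b] geo_times[of "a + b"] assms
    by (simp_all add: A_def B_def power_add)
  moreover have "(geo a * geo b - geo (a + b) * (1 + geo a + geo b)) * ((1 - A) * (1 - B) * (1 - A * B)) =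
      (geo a * (1 - A)) * (geo b * (1 - B)) * (1 - A * B) - (geo (a + b) * (1 - A * B)) *
      ((1 - A) * (1 - B) + (geo a * (1 - A)) * (1 - B) + (geo b * (1 - B)) * (1 - A))"
    by (simp add: algebra_simps)
  ultimately have "(geo a * geo b - geo (a + b) * (1 + geo a + geo b)) * ((1 - A) * (1 - B) * (1 - A * B)) = 0"
    by (simp only:) (simp add: algebra_simps)
  moreover have "(1 - A) * (1 - B) * (1 - A * B) \<noteq> 0"
    using one_minus_X_power_nonzero[of a] one_minus_X_power_nonzero[of b]
      one_minus_X_power_nonzero[of "a + b"] assms
    by (simp add: A_def B_def power_add)
  ultimately show ?thesis by simp
qed

lemma fps_XD_mult: "fps_XD (F * G) = fps_XD F * G + F * fps_XD (G :: 'a :: comm_ring_1 fps)"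
  by (simp add: fps_XD_def algebra_simps)

lemma fps_XD_sum: "fps_XD (\<Sum>i\<in>I. F i) = (\<Sum>i\<in>I. fps_XD (F i :: 'a :: comm_ring_1 fps))"
  by (simp add: fps_eq_iff fps_sum_nth sum_distrib_left)

lemma fps_XD_X_power: "fps_XD (fps_X ^ d) = fps_const (of_nat d) * (fps_X ^ d :: rat fps)"
  by (simp add: fps_eq_iff fps_X_power_nth)

text \<open>Leibniz rule applied to \<open>geo_times\<close>, which avoids a quotient rule. The
  square is what produces the exponent 2 in the derivatives at the end.\<close>

lemma fps_XD_geo:
  assumes "d > 0"
  shows "fps_XD (geo d) = fps_const (of_nat d) * (geo d + geo d ^ 2)"
proof -
  define A c where "A = (fps_X ^ d :: rat fps)" and "c = fps_const (of_nat d :: rat)"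
  have g: "geo d * (1 - A) = A"
    using geo_times[OF assms] by (simp add: A_def)
  have A: "fps_XD (1 - A) = - c * A"
    using fps_XD_X_power[of d] by (simp add: A_def c_def fps_eq_iff)
  have "fps_XD (geo d) * (1 - A) + geo d * fps_XD (1 - A) = c * A"
    using arg_cong[OF g, of fps_XD] by (simp only: fps_XD_mult A_def c_def fps_XD_X_power)
  hence "fps_XD (geo d) * (1 - A) = c * A * (1 + geo d)"
    by (simp add: A algebra_simps)
  also have "\<dots> = c * (geo d * (1 - A)) * (1 + geo d)"
    by (simp only: g)
  also have "\<dots> = c * (geo d + geo d ^ 2) * (1 - A)"
    by (simp add: algebra_simps power2_eq_square)
  finally show ?thesis
    using one_minus_X_power_nonzero[OF assms] by (simp add: A_def c_def)
qed

text \<open>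
  Words of exponents and their index lists are read from the largest summation index downwards;
  \<open>hsum ns U p\<close> is the part of the sum with all indices below \<open>U\<close>.
\<close>

primrec hsum :: "nat list \<Rightarrow> nat \<Rightarrow> (nat list \<Rightarrow> rat) \<Rightarrow> rat fps" where
  "hsum [] U p = fps_const (p [])"
| "hsum (n # ns) U p = (\<Sum>d\<in>{0<..<U}. geo d ^ n * hsum ns d (\<lambda>ds. p (d # ds)))"

definition chains :: "nat \<Rightarrow> nat list set" where
  "chains r = {ds. length ds = r \<and> sorted_wrt (>) ds \<and> 0 \<notin> set ds}"

lemma hsum_cong_below:
  assumes "\<And>ds. ds \<in> chains (length ns) \<Longrightarrow> \<forall>d\<in>set ds. d < U \<Longrightarrow> p ds = p' ds"
  shows "hsum ns U p = hsum ns U p'"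
  using assms
proof (induction ns arbitrary: U p p')
  case (Cons n ns)
  have "hsum ns d (\<lambda>ds. p (d # ds)) = hsum ns d (\<lambda>ds. p' (d # ds))" if "0 < d" "d < U" for d
    by (rule Cons.IH, rule Cons.prems) (use that in \<open>auto simp: chains_def\<close>)
  thus ?case by simp
qed (simp add: chains_def)

lemma hsum_cong:
  assumes "\<And>ds. ds \<in> chains (length ns) \<Longrightarrow> p ds = p' ds"
  shows "hsum ns U p = hsum ns U p'"
  using assms by (intro hsum_cong_below) auto

lemma hsum_add: "hsum ns U (\<lambda>ds. p ds + p' ds) = hsum ns U p + hsum ns U p'"
  by (induction ns arbitrary: U p p')
     (simp_all add: sum.distrib algebra_simps flip: fps_const_add)

lemma hsum_cmult: "hsum ns U (\<lambda>ds. c * p ds) = fps_const c * hsum ns U p"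
  by (induction ns arbitrary: U p) (simp_all add: sum_distrib_left algebra_simps flip: fps_const_mult)

lemma geo_power_mult_nth_eq_0:
  assumes "n \<ge> 1" "i < d"
  shows "fps_nth (geo d ^ n * F) i = 0"
proof -
  have "fps_X ^ d dvd geo d" "geo d dvd geo d ^ n"
    using assms by (auto intro: X_power_dvd_geo dvd_power)
  hence "fps_X ^ d dvd geo d ^ n * F"
    by (meson dvd_mult2 dvd_trans)
  then obtain G where "geo d ^ n * F = fps_X ^ d * G"
    by (elim dvdE)
  thus ?thesis
    using assms by (simp add: fps_X_power_mult_nth)
qed

section \<open>Coefficientwise limits of truncated sums\<close>

text \<open>This is q-adic convergence with a prescribed rate: the \<open>U\<close>-th term is
  already correct modulo q^U. With the rate fixed, sums, products and \<open>fps_XD\<close> pass to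
  the limit coefficient by coefficient, and identities between truncated sums yield identities of
  series.\<close>

definition has_limit :: "(nat \<Rightarrow> rat fps) \<Rightarrow> rat fps \<Rightarrow> bool" where
  "has_limit K F \<longleftrightarrow> (\<forall>U i. i < U \<longrightarrow> fps_nth (K U) i = fps_nth F i)"

lemma has_limit_unique: "has_limit K F \<Longrightarrow> has_limit K G \<Longrightarrow> F = G"
  unfolding has_limit_def fps_eq_iff by (metis lessI)

lemma has_limit_const: "has_limit (\<lambda>_. F) F"
  by (simp add: has_limit_def)

lemma has_limit_add: "has_limit K F \<Longrightarrow> has_limit L G \<Longrightarrow> has_limit (\<lambda>U. K U + L U) (F + G)"
  by (simp add: has_limit_def)

lemma has_limit_mult: "has_limit K F \<Longrightarrow> has_limit L G \<Longrightarrow> has_limit (\<lambda>U. K U * L U) (F * G)"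
  by (simp add: has_limit_def fps_mult_nth)

lemma has_limit_XD: "has_limit K F \<Longrightarrow> has_limit (\<lambda>U. fps_XD (K U)) (fps_XD F)"
  by (simp add: has_limit_def)

lemma has_limit_sum:
  "(\<And>i. i \<in> I \<Longrightarrow> has_limit (K i) (F i)) \<Longrightarrow> has_limit (\<lambda>U. \<Sum>i\<in>I. K i U) (\<Sum>i\<in>I. F i)"
  by (simp add: has_limit_def fps_sum_nth)

lemma has_limit_sum_list:
  "(\<And>i. i \<in> set I \<Longrightarrow> has_limit (K i) (F i)) \<Longrightarrow> has_limit (\<lambda>U. \<Sum>i\<leftarrow>I. K i U) (\<Sum>i\<leftarrow>I. F i)"
  by (induction I) (simp_all add: has_limit_const has_limit_add)

definition hser :: "nat list \<Rightarrow> (nat list \<Rightarrow> rat) \<Rightarrow> rat fps" where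
  "hser ns p = Abs_fps (\<lambda>i. fps_nth (hsum ns (Suc i) p) i)"

text \<open>The top index \<open>d\<close> bounds all others and carries a factor divisible by q^d,
  so terms with \<open>d > i\<close> do not reach the coefficient of q^i. Only the top exponent has
  to be positive; this later admits words with exponents 0 further down.\<close>

lemma has_limit_hser:
  assumes "ns = [] \<or> 1 \<le> hd ns"
  shows "has_limit (\<lambda>U. hsum ns U p) (hser ns p)"
proof (cases ns)
  case (Cons n ns')
  have "fps_nth (hsum ns U p) i = fps_nth (hsum ns (Suc i) p) i" if "i < U" for U i
  proof -
    have "fps_nth (geo d ^ n * hsum ns' d (\<lambda>ds. p (d # ds))) i = 0" if "d \<in> {0<..<U} - {0<..<Suc i}" for d
      using that assms Cons by (intro geo_power_mult_nth_eq_0) auto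
    thus ?thesis
      using that unfolding Cons hsum.simps fps_sum_nth
      by (intro sum.mono_neutral_right) auto
  qed
  thus ?thesis
    unfolding has_limit_def hser_def fps_nth_Abs_fps by blast
qed (simp add: has_limit_def hser_def)

lemma hser_cong:
  assumes "\<And>ds. ds \<in> chains (length ns) \<Longrightarrow> p ds = p' ds"
  shows "hser ns p = hser ns p'"
  unfolding hser_def using hsum_cong[of ns p p', OF assms] by simp

lemma hser_add: "hser ns (\<lambda>ds. p ds + p' ds) = hser ns p + hser ns p'"
  by (simp add: hser_def hsum_add fps_eq_iff)

lemma hser_cmult: "hser ns (\<lambda>ds. c * p ds) = fps_const c * hser ns p"
  by (simp add: hser_def hsum_cmult fps_eq_iff)

lemma hser_zero: "hser ns (\<lambda>ds. 0) = 0"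
  using hser_cmult[of ns 0 "\<lambda>_. 0"] by simp

lemma hser_sum: "hser ns (\<lambda>ds. \<Sum>i\<in>I. p i ds) = (\<Sum>i\<in>I. hser ns (p i))"
  by (induction I rule: infinite_finite_induct) (simp_all add: hser_zero hser_add)

section \<open>Two expansions of a product\<close>

text \<open>
  An entry \<open>(w, g)\<close> of a splitting list is a term of the product of a sum over \<open>a\<close> with a sum over
  chains \<open>ds\<close>: its word is \<open>w\<close>, and \<open>g\<close> recovers the pair \<open>(a, ds)\<close> from the chain of the term.
\<close>

type_synonym splitting = "nat list \<times> (nat list \<Rightarrow> nat \<times> nat list)"

definition tsum :: "splitting list \<Rightarrow> nat \<Rightarrow> (nat \<times> nat list \<Rightarrow> rat) \<Rightarrow> rat fps" where
  "tsum T U P = (\<Sum>(w, g)\<leftarrow>T. hsum w U (P \<circ> g))"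

definition tser :: "splitting list \<Rightarrow> (nat \<times> nat list \<Rightarrow> rat) \<Rightarrow> rat fps" where
  "tser T P = (\<Sum>(w, g)\<leftarrow>T. hser w (P \<circ> g))"

lemma has_limit_tser:
  assumes "\<And>w g. (w, g) \<in> set T \<Longrightarrow> 1 \<le> hd w"
  shows "has_limit (\<lambda>U. tsum T U P) (tser T P)"
  unfolding tsum_def tser_def
  by (intro has_limit_sum_list) (use assms in \<open>auto intro!: has_limit_hser\<close>)

text \<open>The new index lies above the top of the chain, coincides with it (raising the exponent
  there), or lies below it.\<close>

primrec stuffle :: "nat list \<Rightarrow> splitting list" where
  "stuffle [] = [([1], \<lambda>xs. (hd xs, []))]"
| "stuffle (n # ns) = (1 # n # ns, \<lambda>xs. (hd xs, tl xs)) # (Suc n # ns, \<lambda>xs. (hd xs, xs)) #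
     map (\<lambda>(w, g). (n # w, \<lambda>xs. apsnd ((#) (hd xs)) (g (tl xs)))) (stuffle ns)"

lemma tsum_map_Cons:
  "tsum (map (\<lambda>(w, g). (n # w, \<lambda>xs. k (hd xs) (g (tl xs)))) T) U P =
    (\<Sum>d\<in>{0<..<U}. geo d ^ n * tsum T d (P \<circ> k d))"
proof (induction T)
  case (Cons wg T)
  thus ?case
    by (cases wg) (simp add: tsum_def sum.distrib distrib_left comp_def)
qed (simp add: tsum_def)

lemma sum_square_split:
  fixes h :: "nat \<Rightarrow> nat \<Rightarrow> 'a :: comm_monoid_add"
  shows "(\<Sum>a\<in>{0<..<U}. \<Sum>d\<in>{0<..<U}. h a d) =
    (\<Sum>a\<in>{0<..<U}. \<Sum>d\<in>{0<..<a}. h a d) + (\<Sum>d\<in>{0<..<U}. h d d) + (\<Sum>d\<in>{0<..<U}. \<Sum>a\<in>{0<..<d}. h a d)"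
proof -
  have "(\<Sum>d\<in>{0<..<U}. h a d) = (\<Sum>d\<in>{0<..<a}. h a d) + h a a + (\<Sum>d\<in>{a<..<U}. h a d)"
    if "a \<in> {0<..<U}" for a
  proof -
    have "{0<..<U} = insert a ({0<..<a} \<union> {a<..<U})" using that by auto
    hence "(\<Sum>d\<in>{0<..<U}. h a d) = (\<Sum>d\<in>insert a ({0<..<a} \<union> {a<..<U}). h a d)" by (simp only:)
    also have "\<dots> = h a a + ((\<Sum>d\<in>{0<..<a}. h a d) + (\<Sum>d\<in>{a<..<U}. h a d))"
      by (subst sum.insert) (simp_all, subst sum.union_disjoint, auto)
    finally show ?thesis by (simp only: add_ac)
  qed
  hence "(\<Sum>a\<in>{0<..<U}. \<Sum>d\<in>{0<..<U}. h a d) =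
      (\<Sum>a\<in>{0<..<U}. \<Sum>d\<in>{0<..<a}. h a d) + (\<Sum>d\<in>{0<..<U}. h d d) + (\<Sum>a\<in>{0<..<U}. \<Sum>d\<in>{a<..<U}. h a d)"
    by (simp only: sum.distrib cong: sum.cong)
  also have "(\<Sum>a\<in>{0<..<U}. \<Sum>d\<in>{a<..<U}. h a d) = (\<Sum>d\<in>{0<..<U}. \<Sum>a\<in>{0<..<d}. h a d)"
  proof -
    have "(\<Sum>a\<in>{0<..<U}. \<Sum>d\<in>{d\<in>{0<..<U}. a < d}. h a d) = (\<Sum>d\<in>{0<..<U}. \<Sum>a\<in>{a\<in>{0<..<U}. a < d}. h a d)"
      by (intro sum.swap_restrict) auto
    moreover have "{d\<in>{0<..<U}. a < d} = {a<..<U}" if "a \<in> {0<..<U}" for a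
      using that by auto
    moreover have "{a\<in>{0<..<U}. a < d} = {0<..<d}" if "d \<in> {0<..<U}" for d
      using that by auto
    ultimately show ?thesis by simp
  qed
  finally show ?thesis .
qed

lemma hsum_stuffle:
  "(\<Sum>a\<in>{0<..<U}. geo a * hsum ns U (\<lambda>ds. P (a, ds))) = tsum (stuffle ns) U P"
proof (induction ns arbitrary: U P)
  case (Cons n ns)
  define h where "h a d = geo d ^ n * hsum ns d (\<lambda>ds. P (a, d # ds))" for a d
  have 1: "(\<Sum>a\<in>{0<..<U}. \<Sum>d\<in>{0<..<a}. geo a * h a d) = hsum (1 # n # ns) U (P \<circ> (\<lambda>xs. (hd xs, tl xs)))"
    by (simp add: h_def sum_distrib_left)
  have 2: "(\<Sum>d\<in>{0<..<U}. geo d * h d d) = hsum (Suc n # ns) U (P \<circ> (\<lambda>xs. (hd xs, xs)))"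
    by (simp add: h_def mult.assoc)
  have "(\<Sum>d\<in>{0<..<U}. \<Sum>a\<in>{0<..<d}. geo a * h a d) =
      (\<Sum>d\<in>{0<..<U}. geo d ^ n * (\<Sum>a\<in>{0<..<d}. geo a * hsum ns d (\<lambda>ds. (P \<circ> apsnd ((#) d)) (a, ds))))"
    by (simp add: h_def sum_distrib_left mult.left_commute)
  also have "\<dots> = (\<Sum>d\<in>{0<..<U}. geo d ^ n * tsum (stuffle ns) d (P \<circ> apsnd ((#) d)))"
    by (simp only: Cons.IH)
  also have "\<dots> = tsum (map (\<lambda>(w, g). (n # w, \<lambda>xs. apsnd ((#) (hd xs)) (g (tl xs)))) (stuffle ns)) U P"
    by (rule tsum_map_Cons[symmetric])
  finally have 3: "(\<Sum>d\<in>{0<..<U}. \<Sum>a\<in>{0<..<d}. geo a * h a d) = \<dots>" .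
  have "(\<Sum>a\<in>{0<..<U}. geo a * hsum (n # ns) U (\<lambda>ds. P (a, ds))) =
      (\<Sum>a\<in>{0<..<U}. \<Sum>d\<in>{0<..<U}. geo a * h a d)"
    by (simp add: sum_distrib_left h_def)
  also have "\<dots> = tsum (stuffle (n # ns)) U P"
    unfolding sum_square_split 1 2 3 by (simp only: stuffle.simps tsum_def list.map sum_list.Cons prod.case add.assoc)
  finally show ?case .
qed (simp add: tsum_def)

lemma hser_stuffle:
  assumes "ns = [] \<or> 1 \<le> hd ns"
  shows "hser [1] (\<lambda>xs. q (hd xs)) * hser ns p = tser (stuffle ns) (\<lambda>(a, ds). q a * p ds)"
proof (rule has_limit_unique)
  show "has_limit (\<lambda>U. hsum [1] U (\<lambda>xs. q (hd xs)) * hsum ns U p) (hser [1] (\<lambda>xs. q (hd xs)) * hser ns p)"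
    by (intro has_limit_mult has_limit_hser) (use assms in auto)
  have "hsum [1] U (\<lambda>xs. q (hd xs)) * hsum ns U p = tsum (stuffle ns) U (\<lambda>(a, ds). q a * p ds)" for U
    by (simp add: hsum_cmult sum_distrib_right mult.assoc flip: hsum_stuffle)
  moreover have "1 \<le> hd w" if "(w, g) \<in> set (stuffle ns)" for w g
    using that assms by (cases ns) auto
  ultimately show "has_limit (\<lambda>U. hsum [1] U (\<lambda>xs. q (hd xs)) * hsum ns U p)
      (tser (stuffle ns) (\<lambda>(a, ds). q a * p ds))"
    using has_limit_tser[of "stuffle ns"] by simp
qed

text \<open>
  \<open>pf_main\<close> and \<open>pf_lower\<close> collect the terms of top and of next lower degree which arise from repeated use
  of \<open>geo_mult_geo\<close>. The words in \<open>pf_lower\<close> may contain exponents \<open>0\<close>.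
\<close>

primrec pf_sum :: "nat list \<Rightarrow> nat \<Rightarrow> (nat \<times> nat list \<Rightarrow> rat) \<Rightarrow> rat fps" where
  "pf_sum [] U P = (\<Sum>a\<in>{0<..<U}. geo a * fps_const (P (a, [])))"
| "pf_sum (n # ns) U P = (\<Sum>F\<in>{0<..<U}. \<Sum>d\<in>{0<..<F}.
     geo (F - d) * geo d ^ n * hsum ns d (\<lambda>ds. P (F - d, d # ds)))"

primrec pf_main :: "nat list \<Rightarrow> splitting list" where
  "pf_main [] = [([1], \<lambda>xs. (hd xs, []))]"
| "pf_main (n # ns) =
     map (\<lambda>i. (Suc i # (n - i) # ns, \<lambda>xs. (xs ! 0 - xs ! 1, tl xs))) [0..<n] @
     map (\<lambda>(w, g). (n # w, \<lambda>xs. case g (tl xs) of (a, ds) \<Rightarrow> (a, (hd xs - a) # ds))) (pf_main ns)"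

primrec pf_lower :: "nat list \<Rightarrow> splitting list" where
  "pf_lower [] = []"
| "pf_lower (n # ns) =
     map (\<lambda>i. (Suc i # (n - i - 1) # ns, \<lambda>xs. (xs ! 0 - xs ! 1, tl xs))) [0..<n] @
     map (\<lambda>(w, g). (n # w, \<lambda>xs. case g (tl xs) of (a, ds) \<Rightarrow> (a, (hd xs - a) # ds))) (pf_lower ns)"

text \<open>Iteration of \<open>geo_mult_geo\<close>. At each step one branch keeps the factor
  \<open>geo (F - d)\<close> and is expanded further, having traded a factor \<open>geo d\<close>
  for \<open>geo F\<close>; the other two stop, one of degree \<open>n + 1\<close> and one of degree
  \<open>n\<close>.\<close>

lemma geo_mult_geo_power:
  assumes "d < F" "d > 0"
  shows "geo (F - d) * geo d ^ n =
    (\<Sum>i<n. geo F ^ Suc i * (geo d ^ (n - i) + geo d ^ (n - i - 1))) + geo F ^ n * geo (F - d)"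
proof (induction n)
  case (Suc n)
  have "geo (F - d) * geo d = geo F * (1 + geo (F - d) + geo d)"
    using geo_mult_geo[of "F - d" d] assms by simp
  hence "geo (F - d) * geo d ^ Suc n = geo F * (1 + geo (F - d) + geo d) * geo d ^ n"
    by (simp only: power_Suc mult.assoc[symmetric])
  also have "\<dots> = geo F * (geo d ^ Suc n + geo d ^ n) + geo F * (geo (F - d) * geo d ^ n)"
    by (simp add: algebra_simps)
  also have "geo F * (geo (F - d) * geo d ^ n) =
      (\<Sum>i<n. geo F ^ Suc (Suc i) * (geo d ^ (Suc n - Suc i) + geo d ^ (Suc n - Suc i - 1))) + geo F ^ Suc n * geo (F - d)"
    unfolding Suc.IH by (simp add: distrib_left sum_distrib_left mult.assoc)
  finally show ?case
    by (simp add: sum.lessThan_Suc_shift add.assoc del: sum.lessThan_Suc)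
qed simp

lemma tsum_append: "tsum (S @ T) U P = tsum S U P + tsum T U P"
  by (simp add: tsum_def)

lemma tsum_map_upt: "tsum (map (\<lambda>i. (w i, g)) [0..<n]) U P = (\<Sum>i<n. hsum (w i) U (P \<circ> g))"
  by (induction n) (simp_all add: tsum_def comp_def)

lemma sum_swap_third:
  "(\<Sum>x\<in>A. \<Sum>y\<in>B x. \<Sum>i\<in>I. f x y i) = (\<Sum>i\<in>I. \<Sum>x\<in>A. \<Sum>y\<in>B x. f x y i)"
proof -
  have "(\<Sum>x\<in>A. \<Sum>y\<in>B x. \<Sum>i\<in>I. f x y i) = (\<Sum>x\<in>A. \<Sum>i\<in>I. \<Sum>y\<in>B x. f x y i)"
    by (intro sum.cong refl sum.swap)
  also have "\<dots> = (\<Sum>i\<in>I. \<Sum>x\<in>A. \<Sum>y\<in>B x. f x y i)"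
    by (rule sum.swap)
  finally show ?thesis .
qed

text \<open>For a nonempty word, \<open>pf_sum\<close> bounds the sum of \<open>a\<close> and the
  top index, not the two separately. This sum is the new top index \<open>F\<close>, so the
  expansion is exact for every \<open>U\<close>. In the terms that still contain
  \<open>geo (F - d)\<close>, \<open>F\<close> has the exponent \<open>n\<close> and below it stands
  a sum of the same kind for the shorter word.\<close>

lemma pf_sum_eq: "pf_sum ns U P = tsum (pf_main ns @ pf_lower ns) U P"
proof (induction ns arbitrary: U P)
  case Nil
  show ?case
    unfolding pf_sum.simps pf_main.simps pf_lower.simps append_Nil2 tsum_def by simp
next
  case (Cons n ns)
  define h where "h F d = hsum ns d (\<lambda>ds. P (F - d, d # ds))" for F d
  define k where "k F x = (case x of (a, ds) \<Rightarrow> (a, (F - a) # ds))" for F :: nat and x :: "nat \<times> nat list"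
  have inner: "(\<Sum>d\<in>{0<..<F}. geo (F - d) * h F d) = tsum (pf_main ns @ pf_lower ns) F (P \<circ> k F)" for F
  proof (cases ns)
    case Nil
    have "(\<Sum>d\<in>{0<..<F}. geo (F - d) * h F d) = pf_sum [] F (P \<circ> k F)"
      unfolding h_def Nil pf_sum.simps
      by (rule sum.reindex_bij_witness[of _ "\<lambda>a. F - a" "\<lambda>a. F - a"]) (auto simp: k_def)
    thus ?thesis using Cons.IH[of F "P \<circ> k F"] by (simp only: Nil)
  next
    case [simp]: (Cons m ms)
    have "(\<Sum>d\<in>{0<..<F}. geo (F - d) * h F d) = (\<Sum>d\<in>{0<..<F}. \<Sum>e\<in>{0<..<d}.
        geo (F - d) * geo e ^ m * hsum ms e (\<lambda>ds. P (F - d, d # e # ds)))"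
      by (simp add: h_def sum_distrib_left mult.assoc)
    \<comment> \<open>The bijection keeps \<open>e\<close> and the difference
      \<open>a = F - d\<close>, and takes \<open>F' = a + e\<close> in place of \<open>d\<close>.
      The condition \<open>e < d\<close> becomes \<open>F' < F\<close>.\<close>
    also have "\<dots> = (\<Sum>F'\<in>{0<..<F}. \<Sum>e\<in>{0<..<F'}.
        geo (F' - e) * geo e ^ m * hsum ms e (\<lambda>ds. P (F' - e, (F - (F' - e)) # e # ds)))"
      unfolding sum.Sigma[OF finite_greaterThanLessThan ballI[OF finite_greaterThanLessThan]]
    proof (rule sum.reindex_bij_witness[of _ "\<lambda>(F', e). (F - (F' - e), e)" "\<lambda>(d, e). (F - d + e, e)"], goal_cases)
      case (1 x)
      then obtain d e where "x = (d, e)" "0 < e" "e < d" "d < F" by auto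
      thus ?case by simp
    next
      case (2 x)
      then obtain d e where "x = (d, e)" "0 < e" "e < d" "d < F" by auto
      moreover from this have "F + e - d < F" "e < F + e - d" by linarith+
      ultimately show ?case by simp
    next
      case (3 x)
      then obtain F' e where "x = (F', e)" "0 < e" "e < F'" "F' < F" by auto
      thus ?case by simp
    next
      case (4 x)
      then obtain F' e where "x = (F', e)" "0 < e" "e < F'" "F' < F" by auto
      moreover from this have "F + e - F' < F" "e < F + e - F'" by linarith+
      ultimately show ?case by simp
    next
      case (5 x)
      then obtain d e where "x = (d, e)" "0 < e" "e < d" "d < F" by auto
      thus ?case by simp
    qed
    also have "\<dots> = pf_sum ns F (P \<circ> k F)"
      by (simp add: k_def)
    finally show ?thesis by (simp only: Cons.IH)
  qed
  have expand: "geo (F - d) * geo d ^ n * h F d = (\<Sum>i<n. geo F ^ Suc i * (geo d ^ (n - i) * h F d)) +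
      (\<Sum>i<n. geo F ^ Suc i * (geo d ^ (n - i - 1) * h F d)) + geo F ^ n * (geo (F - d) * h F d)"
    if "d \<in> {0<..<F}" for F d
    using that
    by (simp only: geo_mult_geo_power greaterThanLessThan_iff distrib_left distrib_right sum.distrib
      sum_distrib_right mult.assoc)
  have head: "hsum (i # j # ns) U (P \<circ> (\<lambda>xs. (xs ! 0 - xs ! 1, tl xs))) =
      (\<Sum>F\<in>{0<..<U}. \<Sum>d\<in>{0<..<F}. geo F ^ i * (geo d ^ j * h F d))" for i j
    by (simp only: h_def hsum.simps sum_distrib_left comp_def nth_Cons_0 One_nat_def nth_Cons_Suc list.sel)
  have "pf_sum (n # ns) U P = (\<Sum>F\<in>{0<..<U}. \<Sum>d\<in>{0<..<F}. geo (F - d) * geo d ^ n * h F d)"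
    by (simp add: h_def)
  also have "\<dots> = (\<Sum>F\<in>{0<..<U}. \<Sum>d\<in>{0<..<F}. (\<Sum>i<n. geo F ^ Suc i * (geo d ^ (n - i) * h F d)) +
      (\<Sum>i<n. geo F ^ Suc i * (geo d ^ (n - i - 1) * h F d)) + geo F ^ n * (geo (F - d) * h F d))"
    by (intro sum.cong refl expand)
  also have "\<dots> = (\<Sum>F\<in>{0<..<U}. \<Sum>d\<in>{0<..<F}. \<Sum>i<n. geo F ^ Suc i * (geo d ^ (n - i) * h F d)) +
      (\<Sum>F\<in>{0<..<U}. \<Sum>d\<in>{0<..<F}. \<Sum>i<n. geo F ^ Suc i * (geo d ^ (n - i - 1) * h F d)) +
      (\<Sum>F\<in>{0<..<U}. geo F ^ n * (\<Sum>d\<in>{0<..<F}. geo (F - d) * h F d))"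
    by (simp only: sum.distrib sum_distrib_left)
  also have "(\<Sum>F\<in>{0<..<U}. \<Sum>d\<in>{0<..<F}. \<Sum>i<n. geo F ^ Suc i * (geo d ^ (n - i) * h F d)) =
      (\<Sum>i<n. hsum (Suc i # (n - i) # ns) U (P \<circ> (\<lambda>xs. (xs ! 0 - xs ! 1, tl xs))))"
    unfolding head by (rule sum_swap_third)
  also have "(\<Sum>F\<in>{0<..<U}. \<Sum>d\<in>{0<..<F}. \<Sum>i<n. geo F ^ Suc i * (geo d ^ (n - i - 1) * h F d)) =
      (\<Sum>i<n. hsum (Suc i # (n - i - 1) # ns) U (P \<circ> (\<lambda>xs. (xs ! 0 - xs ! 1, tl xs))))"
    unfolding head by (rule sum_swap_third)
  also have "(\<Sum>F\<in>{0<..<U}. geo F ^ n * (\<Sum>d\<in>{0<..<F}. geo (F - d) * h F d)) =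
      tsum (map (\<lambda>(w, g). (n # w, \<lambda>xs. k (hd xs) (g (tl xs)))) (pf_main ns @ pf_lower ns)) U P"
    by (simp only: inner tsum_map_Cons)
  also have "(\<Sum>i<n. hsum (Suc i # (n - i) # ns) U (P \<circ> (\<lambda>xs. (xs ! 0 - xs ! 1, tl xs)))) +
      (\<Sum>i<n. hsum (Suc i # (n - i - 1) # ns) U (P \<circ> (\<lambda>xs. (xs ! 0 - xs ! 1, tl xs)))) + \<dots> =
      tsum (pf_main (n # ns) @ pf_lower (n # ns)) U P"
    unfolding pf_main.simps pf_lower.simps tsum_append map_append k_def[abs_def] by (simp add: tsum_map_upt)
  finally show ?case .
qed

text \<open>The truncated product runs over a square and \<open>pf_sum\<close> over the triangle
  \<open>a + d < U\<close>. The terms in between are divisible by q^(a+d) with \<open>a + d\<close>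
  at least \<open>U\<close>, so both have the same coefficients below \<open>U\<close>.\<close>

lemma has_limit_pf_sum:
  assumes "\<forall>n\<in>set ns. 1 \<le> n"
  shows "has_limit (\<lambda>U. pf_sum ns U (\<lambda>(a, ds). q a * p ds)) (hser [1] (\<lambda>xs. q (hd xs)) * hser ns p)"
proof -
  have "ns = [] \<or> 1 \<le> hd ns"
    using assms by (cases ns) auto
  hence "has_limit (\<lambda>U. hsum [1] U (\<lambda>xs. q (hd xs)) * hsum ns U p) (hser [1] (\<lambda>xs. q (hd xs)) * hser ns p)"
    by (intro has_limit_mult has_limit_hser) auto
  moreover have "fps_nth (pf_sum ns U (\<lambda>(a, ds). q a * p ds)) i = fps_nth (hsum [1] U (\<lambda>xs. q (hd xs)) * hsum ns U p) i"
    if "i < U" for U i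
  proof (cases ns)
    case Nil
    thus ?thesis by (simp add: sum_distrib_right mult.assoc)
  next
    case [simp]: (Cons n ms)
    define h where "h a d = geo a * geo d ^ n * hsum ms d (\<lambda>ds. q a * p (d # ds))" for a d
    have "n \<ge> 1" using assms by simp
    have h0: "fps_nth (h a d) i = 0" if "a > 0" "d > 0" "a + d \<ge> U" for a d
    proof -
      have "fps_X ^ a * fps_X ^ d dvd geo a * geo d ^ n"
        using that \<open>n \<ge> 1\<close> by (intro mult_dvd_mono X_power_dvd_geo dvd_trans[OF X_power_dvd_geo dvd_power]) auto
      hence "fps_X ^ (a + d) dvd h a d"
        by (simp add: h_def power_add)
      then obtain G where "h a d = fps_X ^ (a + d) * G"
        by (elim dvdE)
      thus ?thesis using that \<open>i < U\<close> by (simp add: fps_X_power_mult_nth)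
    qed
    have "hsum [1] U (\<lambda>xs. q (hd xs)) * hsum ns U p = (\<Sum>a\<in>{0<..<U}. \<Sum>d\<in>{0<..<U}. h a d)"
      by (simp add: h_def hsum_cmult sum_product mult_ac)
    hence "fps_nth (hsum [1] U (\<lambda>xs. q (hd xs)) * hsum ns U p) i =
        (\<Sum>a\<in>{0<..<U}. \<Sum>d\<in>{0<..<U}. fps_nth (h a d) i)"
      by (simp only: fps_sum_nth)
    also have "\<dots> = (\<Sum>(a, d)\<in>{0<..<U} \<times> {0<..<U}. fps_nth (h a d) i)"
      by (rule sum.cartesian_product)
    also have "\<dots> = (\<Sum>(a, d)\<in>{(a, d). 0 < a \<and> 0 < d \<and> a + d < U}. fps_nth (h a d) i)"
    proof (rule sum.mono_neutral_right)
      show "\<forall>x\<in>{0<..<U} \<times> {0<..<U} - {(a, d). 0 < a \<and> 0 < d \<and> a + d < U}.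
          (case x of (a, d) \<Rightarrow> fps_nth (h a d) i) = 0"
      proof
        fix x assume "x \<in> {0<..<U} \<times> {0<..<U} - {(a, d). 0 < a \<and> 0 < d \<and> a + d < U}"
        moreover obtain a d where "x = (a, d)" by (cases x)
        ultimately show "(case x of (a, d) \<Rightarrow> fps_nth (h a d) i) = 0"
          using h0[of a d] by auto
      qed
    qed auto
    also have "\<dots> = (\<Sum>(F, d)\<in>Sigma {0<..<U} (\<lambda>F. {0<..<F}). fps_nth (h (F - d) d) i)"
    proof (rule sum.reindex_bij_witness[of _ "\<lambda>(F, d). (F - d, d)" "\<lambda>(a, d). (a + d, d)"], goal_cases)
      case (3 x)
      then obtain F d where "x = (F, d)" "0 < d" "d < F" "F < U" by auto
      thus ?case by simp
    next
      case (4 x)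
      then obtain F d where "x = (F, d)" "0 < d" "d < F" "F < U" by auto
      thus ?case by simp
    qed (simp_all split: prod.splits)
    also have "\<dots> = (\<Sum>F\<in>{0<..<U}. \<Sum>d\<in>{0<..<F}. fps_nth (h (F - d) d) i)"
      by (rule sum.Sigma[symmetric]) auto
    also have "\<dots> = fps_nth (pf_sum ns U (\<lambda>(a, ds). q a * p ds)) i"
      by (simp add: h_def fps_sum_nth)
    finally show ?thesis by simp
  qed
  ultimately show ?thesis
    unfolding has_limit_def by metis
qed

lemma hser_partial_fractions:
  assumes "\<forall>n\<in>set ns. 1 \<le> n"
  shows "hser [1] (\<lambda>xs. q (hd xs)) * hser ns p = tser (pf_main ns @ pf_lower ns) (\<lambda>(a, ds). q a * p ds)"
proof (rule has_limit_unique[OF has_limit_pf_sum[OF assms]])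
  have "1 \<le> hd w" if "(w, g) \<in> set (pf_main ns @ pf_lower ns)" for w g
    using that assms by (cases ns) auto
  thus "has_limit (\<lambda>U. pf_sum ns U (\<lambda>(a, ds). q a * p ds)) (tser (pf_main ns @ pf_lower ns) (\<lambda>(a, ds). q a * p ds))"
    unfolding pf_sum_eq by (rule has_limit_tser)
qed

section \<open>Sums over weakly decreasing lists\<close>

definition comps :: "nat \<Rightarrow> nat list set" where
  "comps r = {w. sum_list w = r \<and> 0 \<notin> set w}"

lemma comps_0: "comps 0 = {[]}"
  by (auto simp: comps_def) (metis list.set_intros(1) neq_Nil_conv)

lemma comps_rec: "r > 0 \<Longrightarrow> comps r = (\<Union>i\<in>{1..r}. (#) i ` comps (r - i))"
proof (intro set_eqI iffI)
  fix js assume "r > 0" "js \<in> comps r"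
  then obtain i w where "js = i # w" "i \<ge> 1" "sum_list w = r - i" "i \<le> r" "0 \<notin> set w"
    by (cases js) (auto simp: comps_def)
  thus "js \<in> (\<Union>i\<in>{1..r}. (#) i ` comps (r - i))"
    by (auto simp: comps_def)
qed (auto simp: comps_def)

lemma finite_comps: "finite (comps r)"
proof (induction r rule: less_induct)
  case (less r)
  thus ?case by (cases "r = 0") (auto simp: comps_0 comps_rec)
qed

lemma sum_comps_rec:
  assumes "r > 0"
  shows "(\<Sum>w\<in>comps r. F w) = (\<Sum>i=1..r. \<Sum>w\<in>comps (r - i). F (i # w))"
proof -
  have "(\<Sum>w\<in>comps r. F w) = (\<Sum>i=1..r. \<Sum>w\<in>(#) i ` comps (r - i). F w)"
    unfolding comps_rec[OF assms] by (intro sum.UNION_disjoint) (auto simp: finite_comps)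
  also have "\<dots> = (\<Sum>i=1..r. \<Sum>w\<in>comps (r - i). F (i # w))"
    by (intro sum.cong refl sum.reindex_cong[where l = "(#) _"]) auto
  finally show ?thesis .
qed

definition weight :: "nat list \<Rightarrow> rat" where
  "weight w = (\<Prod>i\<leftarrow>w. 1 / fact i)"

definition blocks :: "nat list \<Rightarrow> nat list \<Rightarrow> nat list" where
  "blocks w ds = concat (map2 replicate w ds)"

text \<open>
  A weakly decreasing list is given by its strictly decreasing entries \<open>ds\<close> and their multiplicities \<open>w\<close>.
\<close>

definition ssum :: "nat \<Rightarrow> nat \<Rightarrow> (nat list \<Rightarrow> rat) \<Rightarrow> rat fps" where
  "ssum r U p = (\<Sum>w\<in>comps r. fps_const (weight w) * hsum w U (p \<circ> blocks w))"

definition sser :: "nat \<Rightarrow> (nat list \<Rightarrow> rat) \<Rightarrow> rat fps" where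
  "sser r p = (\<Sum>w\<in>comps r. fps_const (weight w) * hser w (p \<circ> blocks w))"

lemma has_limit_sser: "has_limit (\<lambda>U. ssum r U p) (sser r p)"
  unfolding ssum_def sser_def
proof (intro has_limit_sum has_limit_mult has_limit_const has_limit_hser)
  fix w assume "w \<in> comps r"
  thus "w = [] \<or> 1 \<le> hd w"
    by (cases w) (auto simp: comps_def)
qed

lemma ssum_0: "ssum 0 U p = fps_const (p [])"
  by (simp add: ssum_def comps_0 weight_def blocks_def)

lemma ssum_rec:
  assumes "r > 0"
  shows "ssum r U p = (\<Sum>i=1..r. fps_const (1 / fact i) *
    (\<Sum>d\<in>{0<..<U}. geo d ^ i * ssum (r - i) d (\<lambda>ds. p (replicate i d @ ds))))"
proof -
  have "fps_const (weight (i # w)) * hsum (i # w) U (p \<circ> blocks (i # w)) =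
      fps_const (1 / fact i) * (\<Sum>d\<in>{0<..<U}. geo d ^ i *
        (fps_const (weight w) * hsum w d ((\<lambda>ds. p (replicate i d @ ds)) \<circ> blocks w)))" for i w
    by (simp add: weight_def blocks_def comp_def sum_distrib_left mult_ac flip: fps_const_mult)
  thus ?thesis
    unfolding ssum_def sum_comps_rec[OF assms]
    by (simp only: sum_distrib_left sum.swap[of _ "comps _"])
qed

definition insert_at :: "nat \<Rightarrow> (nat \<Rightarrow> nat list \<Rightarrow> rat) \<Rightarrow> nat list \<Rightarrow> rat" where
  "insert_at j P xs = P (xs ! j) (take j xs @ drop (Suc j) xs)"

lemma insert_at_block: "j < i \<Longrightarrow> insert_at j P (replicate i d @ ds) = P d (replicate (i - 1) d @ ds)"
proof -
  assume "j < i"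
  hence "take j (replicate i d) @ drop (Suc j) (replicate i d) = replicate (i - 1) d"
    by (simp add: min_def replicate_add[symmetric])
  with \<open>j < i\<close> show ?thesis
    by (simp add: insert_at_def nth_append flip: append_assoc)
qed

lemma insert_at_below:
  "insert_at (i + j) P (replicate i d @ ds) = insert_at j (\<lambda>a xs. P a (replicate i d @ xs)) ds"
  by (simp add: insert_at_def nth_append)

text \<open>The value \<open>a\<close> is inserted into a weakly decreasing list. If it meets a
  block of length \<open>i\<close>, the block gets length \<open>i + 1\<close>, and
  \<open>i + 1\<close> of the positions \<open>j\<close> fall into it; this factor turns the weight
  \<open>1 / fact (i + 1)\<close> into \<open>1 / fact i\<close>. The factorials are thus what makes
  the product rule free of separate diagonal terms.\<close>

lemma ssum_shuffle:
  "(\<Sum>a\<in>{0<..<U}. geo a * ssum r U (P a)) = (\<Sum>j\<le>r. ssum (Suc r) U (insert_at j P))"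
proof (induction r arbitrary: U P rule: less_induct)
  case (less r)
  \<comment> \<open>The three cases: \<open>a\<close> lies above all entries (\<open>A\<close>),
    equals the top value of multiplicity \<open>i\<close> (\<open>B i\<close>), or lies below that
    value (\<open>C i j\<close>).\<close>
  define A where "A = (\<Sum>a\<in>{0<..<U}. geo a * ssum r a (P a))"
  define B where "B i = (\<Sum>d\<in>{0<..<U}. geo d ^ Suc i * ssum (r - i) d (\<lambda>ds. P d (replicate i d @ ds)))" for i
  define C where "C i j = (\<Sum>d\<in>{0<..<U}. geo d ^ i * ssum (Suc (r - i)) d
    (insert_at j (\<lambda>a xs. P a (replicate i d @ xs))))" for i j
  have lhs: "(\<Sum>a\<in>{0<..<U}. geo a * ssum r U (P a)) =
      A + (\<Sum>i=1..r. fps_const (1 / fact i) * (B i + (\<Sum>j\<le>r - i. C i j)))"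
  proof (cases "r = 0")
    case True
    thus ?thesis by (simp add: A_def ssum_0)
  next
    case False
    hence r: "r > 0" by simp
    define h where "h i a d = geo d ^ i * ssum (r - i) d (\<lambda>ds. P a (replicate i d @ ds))" for i a d
    have "(\<Sum>a\<in>{0<..<U}. geo a * ssum r U (P a)) =
        (\<Sum>i=1..r. fps_const (1 / fact i) * (\<Sum>a\<in>{0<..<U}. \<Sum>d\<in>{0<..<U}. geo a * h i a d))"
      unfolding ssum_rec[OF r] h_def
      by (simp only: sum_distrib_left sum.swap[of _ "{1..r}"] mult.left_commute)
    also have "\<dots> = (\<Sum>i=1..r. fps_const (1 / fact i) * ((\<Sum>a\<in>{0<..<U}. \<Sum>d\<in>{0<..<a}. geo a * h i a d) +
        (\<Sum>d\<in>{0<..<U}. geo d * h i d d) + (\<Sum>d\<in>{0<..<U}. \<Sum>a\<in>{0<..<d}. geo a * h i a d)))"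
      by (simp only: sum_square_split[of "\<lambda>a d. geo a * h _ a d"])
    also have "\<dots> = (\<Sum>i=1..r. fps_const (1 / fact i) * ((\<Sum>a\<in>{0<..<U}. \<Sum>d\<in>{0<..<a}. geo a * h i a d) +
        (B i + (\<Sum>j\<le>r - i. C i j))))"
    proof (intro sum.cong refl arg_cong[where f = "(*) _"])
      fix i assume "i \<in> {1..r}"
      have "(\<Sum>d\<in>{0<..<U}. \<Sum>a\<in>{0<..<d}. geo a * h i a d) = (\<Sum>d\<in>{0<..<U}. geo d ^ i *
          (\<Sum>a\<in>{0<..<d}. geo a * ssum (r - i) d (\<lambda>ds. P a (replicate i d @ ds))))"
        by (simp only: h_def sum_distrib_left mult.left_commute)
      also have "\<dots> = (\<Sum>d\<in>{0<..<U}. geo d ^ i *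
          (\<Sum>j\<le>r - i. ssum (Suc (r - i)) d (insert_at j (\<lambda>a xs. P a (replicate i d @ xs)))))"
        using \<open>i \<in> {1..r}\<close> by (subst less.IH) auto
      also have "\<dots> = (\<Sum>j\<le>r - i. C i j)"
        unfolding C_def by (subst sum.swap) (simp only: sum_distrib_left)
      finally have "(\<Sum>d\<in>{0<..<U}. \<Sum>a\<in>{0<..<d}. geo a * h i a d) = (\<Sum>j\<le>r - i. C i j)" .
      moreover have "(\<Sum>d\<in>{0<..<U}. geo d * h i d d) = B i"
        by (simp add: B_def h_def mult.assoc)
      ultimately show "(\<Sum>a\<in>{0<..<U}. \<Sum>d\<in>{0<..<a}. geo a * h i a d) +
        (\<Sum>d\<in>{0<..<U}. geo d * h i d d) + (\<Sum>d\<in>{0<..<U}. \<Sum>a\<in>{0<..<d}. geo a * h i a d) =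
        (\<Sum>a\<in>{0<..<U}. \<Sum>d\<in>{0<..<a}. geo a * h i a d) + (B i + (\<Sum>j\<le>r - i. C i j))"
        by (simp only: add.assoc)
    qed
    also have "\<dots> = (\<Sum>i=1..r. fps_const (1 / fact i) * (\<Sum>a\<in>{0<..<U}. \<Sum>d\<in>{0<..<a}. geo a * h i a d)) +
        (\<Sum>i=1..r. fps_const (1 / fact i) * (B i + (\<Sum>j\<le>r - i. C i j)))"
      by (simp only: distrib_left[of _ "\<Sum>a\<in>{0<..<U}. _ a"] sum.distrib)
    also have "(\<Sum>i=1..r. fps_const (1 / fact i) * (\<Sum>a\<in>{0<..<U}. \<Sum>d\<in>{0<..<a}. geo a * h i a d)) = A"
      unfolding A_def ssum_rec[OF r] h_def
      by (simp only: sum_distrib_left sum.swap[of _ "{1..r}"] mult.left_commute)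
    finally show ?thesis .
  qed
  define D where "D i j = (\<Sum>d\<in>{0<..<U}. geo d ^ i * ssum (Suc r - i) d
    (\<lambda>ds. insert_at j P (replicate i d @ ds)))" for i j
  have "(\<Sum>j\<le>r. ssum (Suc r) U (insert_at j P)) = (\<Sum>j\<le>r. \<Sum>i=1..Suc r. fps_const (1 / fact i) * D i j)"
    unfolding D_def by (intro sum.cong refl ssum_rec) simp
  also have "\<dots> = (\<Sum>i=1..Suc r. fps_const (1 / fact i) * (\<Sum>j\<le>r. D i j))"
    by (subst sum.swap) (simp only: sum_distrib_left)
  also have "\<dots> = (\<Sum>i=0..r. fps_const (1 / fact i) * B i) +
      (\<Sum>i=1..r. fps_const (1 / fact i) * (\<Sum>j\<le>r - i. C i j))"
  proof -
    have split: "(\<Sum>j\<le>r. D i j) = of_nat i * B (i - 1) + (if i \<le> r then (\<Sum>j\<le>r - i. C i j) else 0)"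
      if i: "i \<in> {1..Suc r}" for i
    proof -
      have "(\<Sum>j\<le>r. D i j) = (\<Sum>j<i. D i j) + (\<Sum>j\<in>{i..r}. D i j)"
        using i by (subst sum.union_disjoint[symmetric]) (auto intro!: sum.cong)
      also have "(\<Sum>j<i. D i j) = (\<Sum>j<i. B (i - 1))"
        using i by (intro sum.cong refl) (auto simp: D_def B_def insert_at_block cong: sum.cong)
      also have "(\<Sum>j\<in>{i..r}. D i j) = (if i \<le> r then (\<Sum>j\<le>r - i. C i j) else 0)"
      proof (cases "i \<le> r")
        case True
        have "(\<Sum>j\<in>{i..r}. D i j) = (\<Sum>j\<le>r - i. D i (i + j))"
          using True by (intro sum.reindex_bij_witness[of _ "\<lambda>j. i + j" "\<lambda>j. j - i"]) auto
        also have "\<dots> = (\<Sum>j\<le>r - i. C i j)"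
          using True by (simp only: D_def C_def insert_at_below Suc_diff_le)
        finally show ?thesis using True by simp
      qed simp
      finally show ?thesis by simp
    qed
    have "(\<Sum>i=1..Suc r. fps_const (1 / fact i) * (\<Sum>j\<le>r. D i j)) =
        (\<Sum>i=1..Suc r. fps_const (1 / fact i) * (of_nat i * B (i - 1))) +
        (\<Sum>i=1..Suc r. fps_const (1 / fact i) * (if i \<le> r then (\<Sum>j\<le>r - i. C i j) else 0))"
      unfolding sum.distrib[symmetric] distrib_left[symmetric] by (intro sum.cong refl arg_cong[where f = "(*) _"] split)
    also have "(\<Sum>i=1..Suc r. fps_const (1 / fact i) * (of_nat i * B (i - 1))) =
        (\<Sum>i=0..r. fps_const (1 / fact (Suc i)) * (of_nat (Suc i) * B i))"
      by (simp add: sum.atLeast_Suc_atMost_Suc_shift del: sum.cl_ivl_Suc)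
    also have "\<dots> = (\<Sum>i=0..r. fps_const (1 / fact i) * B i)"
    proof (intro sum.cong refl)
      fix i :: nat
      have "fps_const (1 / fact (Suc i) :: rat) * of_nat (Suc i) = fps_const (1 / fact i)"
        by (simp add: fps_of_nat[symmetric] field_simps del: of_nat_Suc)
      thus "fps_const (1 / fact (Suc i)) * (of_nat (Suc i) * B i) = fps_const (1 / fact i) * B i"
        by (simp only: mult.assoc[symmetric])
    qed
    also have "(\<Sum>i=1..Suc r. fps_const (1 / fact i) * (if i \<le> r then (\<Sum>j\<le>r - i. C i j) else 0)) =
        (\<Sum>i=1..r. fps_const (1 / fact i) * (\<Sum>j\<le>r - i. C i j))"
      by simp
    finally show ?thesis .
  qed
  \<comment> \<open>\<open>B 0\<close> is \<open>A\<close>: a new top value forms a block of length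
    1.\<close>
  also have "(\<Sum>i=0..r. fps_const (1 / fact i) * B i) = A + (\<Sum>i=1..r. fps_const (1 / fact i) * B i)"
    by (simp add: sum.atLeast_Suc_atMost[of 0] A_def B_def)
  finally show ?case
    unfolding lhs by (simp add: distrib_left sum.distrib add.assoc)
qed

lemma ssum_cmult: "ssum r U (\<lambda>xs. c * p xs) = fps_const c * ssum r U p"
  by (simp add: ssum_def comp_def hsum_cmult sum_distrib_left mult_ac)

lemma sser_shuffle:
  "hser [1] (\<lambda>xs. q (hd xs)) * sser r p = (\<Sum>j\<le>r. sser (Suc r) (insert_at j (\<lambda>a xs. q a * p xs)))"
proof (rule has_limit_unique)
  show "has_limit (\<lambda>U. hsum [1] U (\<lambda>xs. q (hd xs)) * ssum r U p) (hser [1] (\<lambda>xs. q (hd xs)) * sser r p)"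
    by (intro has_limit_mult has_limit_hser has_limit_sser) auto
  have "hsum [1] U (\<lambda>xs. q (hd xs)) * ssum r U p = (\<Sum>j\<le>r. ssum (Suc r) U (insert_at j (\<lambda>a xs. q a * p xs)))" for U
    unfolding ssum_shuffle[symmetric] by (simp add: ssum_cmult sum_distrib_right mult.assoc)
  thus "has_limit (\<lambda>U. hsum [1] U (\<lambda>xs. q (hd xs)) * ssum r U p)
      (\<Sum>j\<le>r. sser (Suc r) (insert_at j (\<lambda>a xs. q a * p xs)))"
    by (simp only:) (intro has_limit_sum has_limit_sser)
qed

section \<open>The generating function of gsh\<close>

definition chains_below :: "nat \<Rightarrow> nat \<Rightarrow> nat list set" where
  "chains_below r U = {ds \<in> chains r. \<forall>d\<in>set ds. d < U}"

definition geo_prod :: "nat list \<Rightarrow> nat list \<Rightarrow> rat fps" where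
  "geo_prod ns ds = prod_list (map2 (\<lambda>n d. geo d ^ n) ns ds)"

lemma chains_below_Suc: "chains_below (Suc r) U = (\<Union>d\<in>{0<..<U}. (#) d ` chains_below r d)"
proof (intro set_eqI iffI)
  fix xs assume "xs \<in> chains_below (Suc r) U"
  then obtain d ds where "xs = d # ds" "d \<in> {0<..<U}" "ds \<in> chains_below r d"
    by (cases xs) (auto simp: chains_below_def chains_def)
  thus "xs \<in> (\<Union>d\<in>{0<..<U}. (#) d ` chains_below r d)" by auto
next
  fix xs assume "xs \<in> (\<Union>d\<in>{0<..<U}. (#) d ` chains_below r d)"
  thus "xs \<in> chains_below (Suc r) U"
    by (fastforce simp: chains_below_def chains_def)
qed

lemma finite_chains_below: "finite (chains_below r U)"
proof (induction r arbitrary: U)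
  case 0
  have "chains_below 0 U \<subseteq> {[]}" by (auto simp: chains_below_def chains_def)
  thus ?case by (rule finite_subset) simp
qed (simp add: chains_below_Suc)

lemma hsum_eq_sum_chains:
  "hsum ns U p = (\<Sum>ds\<in>chains_below (length ns) U. fps_const (p ds) * geo_prod ns ds)"
proof (induction ns arbitrary: U p)
  case Nil
  have "chains_below 0 U = {[]}" by (auto simp: chains_below_def chains_def)
  thus ?case by (simp add: geo_prod_def)
next
  case (Cons n ns)
  have "(\<Sum>ds\<in>chains_below (Suc (length ns)) U. fps_const (p ds) * geo_prod (n # ns) ds) =
      (\<Sum>d\<in>{0<..<U}. \<Sum>ds\<in>(#) d ` chains_below (length ns) d. fps_const (p ds) * geo_prod (n # ns) ds)"
    unfolding chains_below_Suc by (intro sum.UNION_disjoint) (auto simp: finite_chains_below)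
  also have "\<dots> = (\<Sum>d\<in>{0<..<U}. \<Sum>ds\<in>chains_below (length ns) d. fps_const (p (d # ds)) * geo_prod (n # ns) (d # ds))"
    by (intro sum.cong refl sum.reindex_cong[where l = "(#) _"]) auto
  also have "\<dots> = hsum (n # ns) U p"
    by (simp add: Cons.IH geo_prod_def sum_distrib_left mult_ac)
  finally show ?case by simp
qed

lemma fps_const_prod: "fps_const (\<Prod>i\<in>I. f i) = (\<Prod>i\<in>I. fps_const (f i :: rat))"
  by (induction I rule: infinite_finite_induct) (simp_all flip: fps_const_mult)

text \<open>\<open>H\<close> lists its indices upwards and words are read downwards, hence
  \<open>rev\<close>. At q^i both sides reduce to the finitely many chains below
  \<open>Suc i\<close>.\<close>

lemma H_series_eq_hser:
  assumes "\<forall>n\<in>set ns. 1 \<le> n"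
  shows "H_series ns as = hser (rev ns)
    (\<lambda>xs. \<Prod>j<length ns. of_nat (rev xs ! j) ^ (as ! j) / fact (as ! j))"
proof -
  define A :: "nat list set" where "A = {ds. length ds = length ns \<and> sorted_wrt (<) ds \<and> (\<forall>d\<in>set ds. 0 < d)}"
  define p :: "nat list \<Rightarrow> rat" where
    "p xs = (\<Prod>j<length ns. of_nat (rev xs ! j) ^ (as ! j) / fact (as ! j))" for xs
  have H_term: "H_term ns as ds = fps_const (p (rev ds)) * geo_prod (rev ns) (rev ds)" if "ds \<in> A" for ds
  proof -
    have len: "length ds = length ns" using that by (simp add: A_def)
    have "geo_prod (rev ns) (rev ds) = geo_prod ns ds"
      using len by (simp add: geo_prod_def zip_rev rev_map[symmetric] prod_list.rev)
    also have "\<dots> = (\<Prod>j<length ns. geo (ds ! j) ^ (ns ! j))"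
      using len by (simp add: geo_prod_def prod.list_conv_set_nth atLeast0LessThan)
    finally have g: "geo_prod (rev ns) (rev ds) = \<dots>" .
    have "fps_const (p (rev ds)) = (\<Prod>j<length ns. fps_const (fps_nth (fps_exp (of_nat (ds ! j))) (as ! j)))"
      unfolding p_def by (simp add: fps_exp_def fps_const_prod)
    thus ?thesis
      by (simp add: H_term_def g prod.distrib geo_def)
  qed
  have vanish: "fps_nth (H_term ns as ds) i = 0" if "ds \<in> A" "rev ds \<notin> chains_below (length ns) (Suc i)" for ds i
  proof -
    have "rev ds \<in> chains (length ns)"
      using that by (auto simp: A_def chains_def sorted_wrt_rev)
    moreover have "\<exists>d\<in>set (rev ds). \<not> d < Suc i"
      using that calculation by (auto simp: chains_below_def)
    ultimately obtain d xs n ns' where d: "rev ds = d # xs" "i < d" and n: "rev ns = n # ns'"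
      by (cases "rev ds"; cases "rev ns") (fastforce simp: chains_def)+
    have "n \<in> set (rev ns)" by (simp add: n)
    hence "n \<ge> 1" using assms by simp
    have "H_term ns as ds = geo d ^ n * (fps_const (p (rev ds)) * geo_prod ns' xs)"
      unfolding H_term[OF that(1)] by (simp add: d n geo_prod_def)
    thus ?thesis
      using geo_power_mult_nth_eq_0[OF \<open>n \<ge> 1\<close> \<open>i < d\<close>] by simp
  qed
  have bij: "rev ` {ds \<in> A. rev ds \<in> chains_below (length ns) U} = chains_below (length ns) U" for U
  proof (intro set_eqI iffI)
    fix xs assume "xs \<in> chains_below (length ns) U"
    hence "rev xs \<in> {ds \<in> A. rev ds \<in> chains_below (length ns) U}"
      by (auto simp: A_def chains_below_def chains_def sorted_wrt_rev intro!: gr0I)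
    thus "xs \<in> rev ` {ds \<in> A. rev ds \<in> chains_below (length ns) U}"
      by (metis imageI rev_rev_ident)
  qed auto
  have fin: "finite {ds \<in> A. rev ds \<in> chains_below (length ns) U}" for U
    by (rule finite_imageD[of rev]) (auto simp: bij finite_chains_below inj_on_def)
  have "(H_term ns as has_sum hser (rev ns) p) A"
  proof (rule has_sum_fpsI)
    fix i
    have sub: "{ds \<in> A. fps_nth (H_term ns as ds) i \<noteq> 0} \<subseteq> {ds \<in> A. rev ds \<in> chains_below (length ns) (Suc i)}"
      using vanish by auto
    thus "finite {ds \<in> A. fps_nth (H_term ns as ds) i \<noteq> 0}"
      by (rule finite_subset) (rule fin)
    have "fps_nth (hser (rev ns) p) i =
        (\<Sum>xs\<in>chains_below (length ns) (Suc i). fps_nth (fps_const (p xs) * geo_prod (rev ns) xs) i)"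
      by (simp add: hser_def hsum_eq_sum_chains fps_sum_nth)
    also have "\<dots> = (\<Sum>ds\<in>{ds \<in> A. rev ds \<in> chains_below (length ns) (Suc i)}.
        fps_nth (fps_const (p (rev ds)) * geo_prod (rev ns) (rev ds)) i)"
      by (subst bij[symmetric], subst sum.reindex) (auto simp: inj_on_def)
    also have "\<dots> = (\<Sum>ds\<in>{ds \<in> A. rev ds \<in> chains_below (length ns) (Suc i)}. fps_nth (H_term ns as ds) i)"
      by (intro sum.cong refl) (simp add: H_term)
    also have "\<dots> = (\<Sum>ds | ds \<in> A \<and> fps_nth (H_term ns as ds) i \<noteq> 0. fps_nth (H_term ns as ds) i)"
      by (rule sum.mono_neutral_right) (use fin sub in auto)
    finally show "fps_nth (hser (rev ns) p) i = \<dots>" .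
  qed
  hence "infsum (H_term ns as) A = hser (rev ns) p"
    by (rule infsumI)
  thus ?thesis
    unfolding H_series_def A_def p_def[abs_def] .
qed

section \<open>Coefficients of exponentials of linear forms\<close>

definition scalar :: "rat \<Rightarrow> qpoly" where
  "scalar c = Poly_Mapping.single 0 c"

lemma scalar_add: "scalar (a + b) = scalar a + scalar b"
  by (simp add: scalar_def single_add)

lemma scalar_mult: "scalar (a * b) = scalar a * scalar b"
  by (simp add: scalar_def mult_single)

lemma scalar_1: "scalar 1 = 1"
  by (simp add: scalar_def)

lemma scalar_0: "scalar 0 = 0"
  by (simp add: scalar_def)

lemma scalar_diff: "scalar (a - b) = scalar a - scalar b"
  by (metis add_diff_cancel_right' diff_add_cancel scalar_add)

lemma scalar_of_nat: "scalar (of_nat n) = of_nat n"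
  by (simp add: scalar_def)

lemma scalar_power: "scalar (a ^ n) = scalar a ^ n"
  by (induction n) (simp_all add: scalar_1 scalar_mult)

lemma scalar_prod: "scalar (\<Prod>i\<in>I. f i) = (\<Prod>i\<in>I. scalar (f i))"
  by (induction I rule: infinite_finite_induct) (simp_all add: scalar_1 scalar_mult)

lemma lookup_scalar_mult: "Poly_Mapping.lookup (scalar c * p) k = c * Poly_Mapping.lookup p k"
proof -
  have "scalar c * p = Poly_Mapping.map ((*) c) p"
    by (simp add: scalar_def mult_map_scale_conv_mult)
  thus ?thesis by (simp add: map.rep_eq when_def)
qed

lemma lookup_sum: "Poly_Mapping.lookup (\<Sum>i\<in>I. f i) k = (\<Sum>i\<in>I. Poly_Mapping.lookup (f i) k)"
  by (induction I rule: infinite_finite_induct) (simp_all add: lookup_add)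

definition exponents :: "nat \<Rightarrow> nat \<Rightarrow> nat list set" where
  "exponents m N = {as. length as = m \<and> sum_list as = N}"

lemma finite_exponents: "finite (exponents m N)"
proof (rule finite_subset)
  show "exponents m N \<subseteq> {as. set as \<subseteq> {..N} \<and> length as = m}"
    using member_le_sum_list by (fastforce simp: exponents_def)
qed (simp add: finite_lists_length_eq)

lemma sum_exponents_Suc:
  "(\<Sum>as\<in>exponents (Suc m) N. F as) = (\<Sum>a\<le>N. \<Sum>bs\<in>exponents m (N - a). F (bs @ [a]))"
proof -
  have "exponents (Suc m) N = (\<Union>a\<in>{..N}. (\<lambda>bs. bs @ [a]) ` exponents m (N - a))"
  proof (intro set_eqI iffI)
    fix as assume as: "as \<in> exponents (Suc m) N"
    hence "as \<noteq> []" by (auto simp: exponents_def)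
    then obtain bs a where "as = bs @ [a]" by (metis append_butlast_last_id)
    with as show "as \<in> (\<Union>a\<in>{..N}. (\<lambda>bs. bs @ [a]) ` exponents m (N - a))"
      by (intro UN_I[of a]) (auto simp: exponents_def)
  qed (auto simp: exponents_def)
  hence "(\<Sum>as\<in>exponents (Suc m) N. F as) = (\<Sum>a\<le>N. \<Sum>as\<in>(\<lambda>bs. bs @ [a]) ` exponents m (N - a). F as)"
    by (simp only:) (intro sum.UNION_disjoint, auto simp: finite_exponents)
  also have "\<dots> = (\<Sum>a\<le>N. \<Sum>bs\<in>exponents m (N - a). F (bs @ [a]))"
    by (intro sum.cong refl sum.reindex_cong[where l = "\<lambda>bs. bs @ [_]"]) (auto simp: inj_on_def)
  finally show ?thesis .
qed

lemma multinomial: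
  "(\<Sum>as\<in>exponents m N. scalar (\<Prod>j<m. 1 / fact (as ! j)) * (\<Prod>j<m. y j ^ (as ! j))) =
    scalar (1 / fact N) * (\<Sum>j<m. y j) ^ N"
proof (induction m arbitrary: N)
  case 0
  have "exponents 0 N = (if N = 0 then {[]} else {})"
    by (auto simp: exponents_def)
  thus ?case by (simp add: scalar_1)
next
  case (Suc m)
  have "(\<Sum>as\<in>exponents (Suc m) N. scalar (\<Prod>j<Suc m. 1 / fact (as ! j)) * (\<Prod>j<Suc m. y j ^ (as ! j))) =
      (\<Sum>a\<le>N. \<Sum>bs\<in>exponents m (N - a). scalar (1 / fact a) * y m ^ a *
        (scalar (\<Prod>j<m. 1 / fact (bs ! j)) * (\<Prod>j<m. y j ^ (bs ! j))))"
    unfolding sum_exponents_Suc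
  proof (intro sum.cong refl)
    fix a bs assume "bs \<in> exponents m (N - a)"
    hence [simp]: "length bs = m" by (simp add: exponents_def)
    have "(\<Prod>j<m. 1 / fact ((bs @ [a]) ! j) :: rat) = (\<Prod>j<m. 1 / fact (bs ! j))"
      "(\<Prod>j<m. y j ^ ((bs @ [a]) ! j)) = (\<Prod>j<m. y j ^ (bs ! j))"
      by (intro prod.cong; simp add: nth_append)+
    thus "scalar (\<Prod>j<Suc m. 1 / fact ((bs @ [a]) ! j)) * (\<Prod>j<Suc m. y j ^ ((bs @ [a]) ! j)) =
        scalar (1 / fact a) * y m ^ a * (scalar (\<Prod>j<m. 1 / fact (bs ! j)) * (\<Prod>j<m. y j ^ (bs ! j)))"
      by (simp only: prod.lessThan_Suc scalar_mult nth_append_length[of bs, unfolded \<open>length bs = m\<close>] mult_ac)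
  qed
  also have "\<dots> = (\<Sum>a\<le>N. scalar (1 / fact a) * y m ^ a * (scalar (1 / fact (N - a)) * (\<Sum>j<m. y j) ^ (N - a)))"
    by (simp only: Suc.IH sum_distrib_left[symmetric])
  also have "\<dots> = (\<Sum>a\<le>N. scalar (1 / fact N) * (of_nat (N choose a) * y m ^ a * (\<Sum>j<m. y j) ^ (N - a)))"
  proof (intro sum.cong refl)
    fix a assume "a \<in> {..N}"
    hence "1 / fact a * (1 / fact (N - a)) = 1 / fact N * (of_nat (N choose a) :: rat)"
      by (simp add: binomial_fact)
    hence "scalar (1 / fact a) * scalar (1 / fact (N - a)) = scalar (1 / fact N) * of_nat (N choose a)"
      by (metis scalar_mult scalar_of_nat)
    moreover have "scalar (1 / fact a) * y m ^ a * (scalar (1 / fact (N - a)) * (\<Sum>j<m. y j) ^ (N - a)) =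
        (scalar (1 / fact a) * scalar (1 / fact (N - a))) * (y m ^ a * (\<Sum>j<m. y j) ^ (N - a))"
      by (simp only: mult_ac)
    ultimately show "scalar (1 / fact a) * y m ^ a * (scalar (1 / fact (N - a)) * (\<Sum>j<m. y j) ^ (N - a)) =
      scalar (1 / fact N) * (of_nat (N choose a) * y m ^ a * (\<Sum>j<m. y j) ^ (N - a))"
      by (simp only: mult.assoc)
  qed
  also have "\<dots> = scalar (1 / fact N) * (\<Sum>j<Suc m. y j) ^ N"
    by (simp add: binomial_ring[of "y m" "\<Sum>j<m. y j"] add.commute sum_distrib_left)
  finally show ?case .
qed

lemma prod_polyX_power:
  assumes "length as = r"
  shows "(\<Prod>k<r. polyX (Suc k) ^ (as ! k)) = Poly_Mapping.single (Poly_Mapping.nth as) 1"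
proof -
  have pow: "polyX (Suc k) ^ n = Poly_Mapping.single (Poly_Mapping.single k n) 1" for k n
    by (induction n) (simp_all add: polyX_def mult_single single_add[symmetric])
  have "(\<Prod>k\<in>K. polyX (Suc k) ^ (as ! k)) = Poly_Mapping.single (\<Sum>k\<in>K. Poly_Mapping.single k (as ! k)) 1" for K
    by (induction K rule: infinite_finite_induct) (simp_all add: pow mult_single)
  moreover have "(\<Sum>k<r. Poly_Mapping.single k (as ! k)) = Poly_Mapping.nth as"
  proof (rule poly_mapping_eqI)
    fix i
    have "Poly_Mapping.lookup (\<Sum>k\<in>K. Poly_Mapping.single k (as ! k)) i = (\<Sum>k\<in>K. if k = i then as ! k else 0)" for K
      by (simp add: lookup_sum lookup_single when_def)
    thus "Poly_Mapping.lookup (\<Sum>k<r. Poly_Mapping.single k (as ! k)) i = Poly_Mapping.lookup (Poly_Mapping.nth as) i"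
      using assms by (simp add: nth.rep_eq nth_default_def)
  qed
  ultimately show ?thesis by simp
qed

lemma nth_inject_same_length:
  assumes "length as = length bs" "Poly_Mapping.nth as = Poly_Mapping.nth bs"
  shows "as = bs"
proof (rule nth_equalityI)
  fix i assume "i < length as"
  moreover have "Poly_Mapping.lookup (Poly_Mapping.nth as) i = Poly_Mapping.lookup (Poly_Mapping.nth bs) i"
    by (simp add: assms)
  ultimately show "as ! i = bs ! i"
    using assms(1) by (simp add: nth.rep_eq nth_default_def)
qed (rule assms(1))

text \<open>
  Both sides are the coefficient of \<open>exp (\<Sum>j<m. d j * L j) = exp (\<Sum>k<r. c k * X\<^sub>k\<^sub>+\<^sub>1)\<close> at the
  monomial \<open>es\<close>.
\<close>

lemma exp_coefficient:
  fixes L :: "nat \<Rightarrow> qpoly"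
  assumes L0: "\<And>j. j < m \<Longrightarrow> Poly_Mapping.lookup (L j) 0 = 0"
    and lin: "(\<Sum>j<m. scalar (d j) * L j) = (\<Sum>k<r. scalar (c k) * polyX (Suc k))"
    and es: "length es = r"
  shows "(\<Sum>as | length as = m \<and> Poly_Mapping.lookup (\<Prod>j<m. L j ^ (as ! j)) (Poly_Mapping.nth es) \<noteq> 0.
      (\<Prod>j<m. d j ^ (as ! j) / fact (as ! j)) *
      Poly_Mapping.lookup (\<Prod>j<m. L j ^ (as ! j)) (Poly_Mapping.nth es)) =
    (\<Prod>k<r. c k ^ (es ! k) / fact (es ! k))"
proof -
  define co where "co as = Poly_Mapping.lookup (\<Prod>j<m. L j ^ (as ! j)) (Poly_Mapping.nth es)" for as
  define S where "S = {as. length as = m \<and> co as \<noteq> 0}"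
  define t where "t as = (\<Prod>j<m. d j ^ (as ! j) / fact (as ! j)) * co as" for as
  have fin: "finite S"
    unfolding S_def co_def by (rule finite_ps_subst_support) (rule L0)
  \<comment> \<open>\<open>multinomial\<close> works in one total degree at a time; \<open>M\<close>
    bounds the degrees that can contribute to either side.\<close>
  define M where "M = Max (insert (sum_list es) (sum_list ` S))"
  have M: "sum_list es \<le> M" "\<And>as. as \<in> S \<Longrightarrow> sum_list as \<le> M"
    unfolding M_def using fin by auto
  have coef: "Poly_Mapping.lookup (\<Sum>as\<in>exponents n N. scalar (\<Prod>j<n. 1 / fact (as ! j)) *
      (\<Prod>j<n. (scalar (u j) * Y j) ^ (as ! j))) k =
    (\<Sum>as\<in>exponents n N. (\<Prod>j<n. u j ^ (as ! j) / fact (as ! j)) * Poly_Mapping.lookup (\<Prod>j<n. Y j ^ (as ! j)) k)"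
    for n N k and u :: "nat \<Rightarrow> rat" and Y
  proof -
    have "scalar (\<Prod>j<n. 1 / fact (as ! j)) * (\<Prod>j<n. (scalar (u j) * Y j) ^ (as ! j)) =
        scalar (\<Prod>j<n. u j ^ (as ! j) / fact (as ! j)) * (\<Prod>j<n. Y j ^ (as ! j))" for as
      by (simp add: scalar_prod scalar_power scalar_mult[symmetric] power_mult_distrib prod.distrib
          mult.assoc[symmetric]) (simp add: scalar_prod[symmetric] scalar_power[symmetric]
          scalar_mult[symmetric] prod.distrib[symmetric])
    thus ?thesis by (simp add: lookup_sum lookup_scalar_mult)
  qed
  have "(\<Sum>as\<in>S. t as) = (\<Sum>N\<le>M. \<Sum>as\<in>{as\<in>S. sum_list as = N}. t as)"
    using fin M by (intro sum.group[symmetric]) auto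
  also have "\<dots> = (\<Sum>N\<le>M. \<Sum>as\<in>exponents m N. t as)"
    by (intro sum.cong refl sum.mono_neutral_left finite_exponents)
       (auto simp: S_def exponents_def t_def)
  \<comment> \<open>\<open>multinomial\<close> is used twice, for the \<open>L j\<close> and for the
    variables: in each degree both sums are a coefficient of the \<open>N\<close>-th power of the
    same linear form, by \<open>lin\<close>.\<close>
  also have "\<dots> = (\<Sum>N\<le>M. \<Sum>as\<in>exponents r N. (\<Prod>k<r. c k ^ (as ! k) / fact (as ! k)) *
      Poly_Mapping.lookup (\<Prod>k<r. polyX (Suc k) ^ (as ! k)) (Poly_Mapping.nth es))"
    unfolding t_def co_def coef[symmetric] multinomial lin ..
  also have "\<dots> = (\<Sum>N\<le>M. \<Sum>as\<in>exponents r N. if as = es then \<Prod>k<r. c k ^ (es ! k) / fact (es ! k) else 0)"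
    by (intro sum.cong refl)
       (use es in \<open>auto simp: exponents_def prod_polyX_power lookup_single when_def dest!: nth_inject_same_length[rotated]\<close>)
  also have "\<dots> = (\<Sum>N\<le>M. if N = sum_list es then \<Prod>k<r. c k ^ (es ! k) / fact (es ! k) else 0)"
    by (intro sum.cong refl) (use es in \<open>auto simp: exponents_def finite_exponents[unfolded exponents_def]\<close>)
  also have "\<dots> = (\<Prod>k<r. c k ^ (es ! k) / fact (es ! k))"
    using M(1) by simp
  finally show ?thesis
    by (simp add: S_def t_def co_def)
qed

section \<open>From the lower entries to the increments of the indices\<close>

text \<open>These are the coefficients produced by summation by parts; the default \<open>0\<close>
  stands for the absent entry after the last one, so the last increment is the smallest index
  itself.\<close>

definition gap :: "nat list \<Rightarrow> nat \<Rightarrow> rat" where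
  "gap xs k = of_nat (xs ! k) - (if Suc k < length xs then of_nat (xs ! Suc k) else 0)"

definition gap_monom :: "nat list \<Rightarrow> nat list \<Rightarrow> rat" where
  "gap_monom es xs = (\<Prod>k<length es. gap xs k ^ (es ! k) / fact (es ! k))"

lemma blocks_Cons: "blocks (i # w) (x # xs) = replicate i x @ blocks w xs"
  by (simp add: blocks_def)

lemma length_blocks: "length xs = length w \<Longrightarrow> length (blocks w xs) = sum_list w"
  by (induction w xs rule: list_induct2') (simp_all add: blocks_def)

lemma sum_lessThan_add:
  fixes f :: "nat \<Rightarrow> 'a :: comm_monoid_add"
  shows "(\<Sum>k<i + j. f k) = (\<Sum>k<i. f k) + (\<Sum>k<j. f (i + k))"
  by (induction j) (simp_all add: add.assoc)

text \<open>Within a block of equal entries the differences of \<open>X\<close> telescope to the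
  difference between the two ends of the block.\<close>

lemma blocks_telescope:
  fixes X :: "nat \<Rightarrow> 'a :: comm_ring_1"
  assumes "length xs = length w"
  shows "(\<Sum>t<length w. of_nat (xs ! t) * (X (sum_list (take (Suc t) w)) - X (sum_list (take t w)))) =
    (\<Sum>k<sum_list w. of_nat (blocks w xs ! k) * (X (Suc k) - X k))"
  using assms
proof (induction w arbitrary: xs X)
  case (Cons i w)
  then obtain x ys where [simp]: "xs = x # ys" "length ys = length w"
    by (cases xs) auto
  have "(\<Sum>k<sum_list (i # w). of_nat (blocks (i # w) xs ! k) * (X (Suc k) - X k)) =
      (\<Sum>k<i. of_nat (blocks (i # w) xs ! k) * (X (Suc k) - X k)) +
      (\<Sum>k<sum_list w. of_nat (blocks (i # w) xs ! (i + k)) * (X (Suc (i + k)) - X (i + k)))"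
    by (simp add: sum_lessThan_add)
  also have "(\<Sum>k<i. of_nat (blocks (i # w) xs ! k) * (X (Suc k) - X k)) = of_nat x * (\<Sum>k<i. X (Suc k) - X k)"
    by (simp add: blocks_Cons nth_append sum_distrib_left)
  also have "(\<Sum>k<i. X (Suc k) - X k) = X i - X 0"
    by (rule sum_lessThan_telescope)
  also have "(\<Sum>k<sum_list w. of_nat (blocks (i # w) xs ! (i + k)) * (X (Suc (i + k)) - X (i + k))) =
      (\<Sum>t<length w. of_nat (ys ! t) * (X (i + sum_list (take (Suc t) w)) - X (i + sum_list (take t w))))"
    using Cons.IH[of ys "\<lambda>k. X (i + k)"] by (simp add: blocks_Cons nth_append)
  finally show ?case
    by (simp add: sum.lessThan_Suc_shift del: sum.lessThan_Suc)
qed simp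

lemma sum_by_parts:
  fixes b X :: "nat \<Rightarrow> 'a :: comm_ring_1"
  shows "(\<Sum>k<r. b k * (X (Suc k) - X k)) = (\<Sum>k<r. (b k - b (Suc k)) * X (Suc k)) + b r * X r - b 0 * X 0"
  by (induction r) (simp_all add: algebra_simps)

text \<open>Read downwards, the lower entries are differences of \<open>polyX\<close> at consecutive
  partial sums of \<open>w\<close>. Spreading them over the blocks and summing by parts collects the
  increments; the boundary terms vanish because of X_0 = 0 and the entry \<open>0\<close> after the
  end.\<close>

lemma lower_entry_gap:
  assumes len: "length xs = length w"
  shows "(\<Sum>j<length w. scalar (of_nat (rev xs ! j)) * lower_entry (sum_list w) (rev w) j) =
    (\<Sum>k<sum_list w. scalar (gap (blocks w xs) k) * polyX (Suc k))"
proof -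
  define r m where "r = sum_list w" and "m = length w"
  have entry: "lower_entry r (rev w) j = polyX (sum_list (take (m - j) w)) - polyX (sum_list (take (m - Suc j) w))"
    if "j < m" for j
  proof -
    have "r - sum_list (take i (rev w)) = sum_list (take (m - i) w)" for i
    proof -
      have "r = sum_list (take (m - i) w) + sum_list (drop (m - i) w)"
        unfolding r_def by (metis append_take_drop_id sum_list_append)
      thus ?thesis by (simp add: take_rev m_def sum_list_rev)
    qed
    thus ?thesis by (simp only: lower_entry_def)
  qed
  have "(\<Sum>j<m. scalar (of_nat (rev xs ! j)) * lower_entry r (rev w) j) =
      (\<Sum>t<m. of_nat (xs ! t) * (polyX (sum_list (take (Suc t) w)) - polyX (sum_list (take t w))))"
    by (rule sum.reindex_bij_witness[of _ "\<lambda>t. m - Suc t" "\<lambda>t. m - Suc t"])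
       (use len in \<open>auto simp: entry scalar_of_nat rev_nth m_def Suc_diff_Suc\<close>)
  also have "\<dots> = (\<Sum>k<r. of_nat (blocks w xs ! k) * (polyX (Suc k) - polyX k))"
    unfolding m_def r_def by (rule blocks_telescope) (rule len)
  \<comment> \<open>The summand is extended by \<open>0\<close> at \<open>k = r\<close>, which
    removes the upper boundary term of \<open>sum_by_parts\<close>.\<close>
  also have "\<dots> = (\<Sum>k<r. of_nat (if k < r then blocks w xs ! k else 0) * (polyX (Suc k) - polyX k))"
    by simp
  also have "\<dots> = (\<Sum>k<r. (of_nat (if k < r then blocks w xs ! k else 0) -
      of_nat (if Suc k < r then blocks w xs ! Suc k else 0)) * polyX (Suc k))"
    by (subst sum_by_parts) (simp add: polyX_def)
  also have "\<dots> = (\<Sum>k<r. scalar (gap (blocks w xs) k) * polyX (Suc k))"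
    by (intro sum.cong refl) (simp add: gap_def length_blocks len r_def scalar_diff scalar_of_nat scalar_0)
  finally show ?thesis by (simp add: r_def m_def)
qed

text \<open>For a fixed chain the coefficients of \<open>H\<close> are those of the exponential of a
  linear form. \<open>lower_entry_gap\<close> rewrites that form in the variables, and
  \<open>exp_coefficient\<close> evaluates the substitution under the sum over chains.\<close>

lemma ps_subst_H_series:
  assumes w: "w \<in> comps r" and es: "length es = r"
  shows "ps_subst (length w) (H_series (rev w)) (lower_entry r (rev w)) es =
    hser w (gap_monom es \<circ> blocks w)"
proof -
  define m L where "m = length w" and "L = lower_entry r (rev w)"
  define co where "co as = Poly_Mapping.lookup (\<Prod>j<m. L j ^ (as ! j)) (Poly_Mapping.nth es)" for as
  define p :: "nat list \<Rightarrow> nat list \<Rightarrow> rat" where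
    "p as xs = (\<Prod>j<m. of_nat (rev xs ! j) ^ (as ! j) / fact (as ! j))" for as xs
  have "1 \<le> n" if "n \<in> set (rev w)" for n
    using w that by (cases n) (auto simp: comps_def)
  hence H: "H_series (rev w) as = hser w (p as)" for as
    using H_series_eq_hser[of "rev w" as] by (simp add: p_def[abs_def] m_def)
  have "ps_subst m (H_series (rev w)) L es = (\<Sum>as | length as = m \<and> co as \<noteq> 0. fps_const (co as) * hser w (p as))"
    by (simp add: ps_subst_def co_def H mult.commute)
  also have "\<dots> = hser w (\<lambda>xs. \<Sum>as | length as = m \<and> co as \<noteq> 0. p as xs * co as)"
    by (simp add: hser_sum hser_cmult[symmetric] mult.commute)
  also have "\<dots> = hser w (gap_monom es \<circ> blocks w)"
  proof (rule hser_cong)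
    fix xs assume "xs \<in> chains (length w)"
    hence len: "length xs = length w" by (simp add: chains_def)
    have r: "sum_list w = r" using w by (simp add: comps_def)
    show "(\<Sum>as | length as = m \<and> co as \<noteq> 0. p as xs * co as) = (gap_monom es \<circ> blocks w) xs"
      using lower_entry_gap[OF len] unfolding r p_def co_def gap_monom_def comp_def es
      by (intro exp_coefficient) (simp_all add: L_def lookup_lower_entry_0 m_def es)
  qed
  finally show ?thesis by (simp add: m_def L_def)
qed

lemma weight_eq: "weight w = 1 / (\<Prod>j<length w. fact (w ! j))"
  by (simp add: weight_def prod.list_conv_set_nth atLeast0LessThan prod_dividef)

lemma gsh_gen_eq_sser:
  assumes "length es = r" "r > 0"
  shows "gsh_gen r es = sser r (gap_monom es)"
proof -
  define F where "F w = fps_const (weight w) * hser w (gap_monom es \<circ> blocks w)" for w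
  have rev_comps: "rev w \<in> comps r \<longleftrightarrow> w \<in> comps r" for w
    by (simp add: comps_def sum_list_rev)
  have weight_rev: "weight (rev w) = weight w" for w
    by (simp add: weight_def rev_map[symmetric] prod_list.rev)
  have eq: "{w. length w = m \<and> sum_list w = r \<and> (\<forall>i\<in>set w. 1 \<le> i)} = {w \<in> comps r. length w = m}" for m
    by (auto simp: comps_def Suc_le_eq intro: gr0I)
  have len: "length w \<in> {1..r}" if "w \<in> comps r" for w
  proof -
    have "length w \<le> sum_list w" if "0 \<notin> set w" for w :: "nat list"
      using that by (induction w) auto
    from this[of w] have "length w \<le> r"
      using that by (simp add: comps_def)
    moreover have "w \<noteq> []"
      using that \<open>r > 0\<close> by (auto simp: comps_def)
    ultimately show ?thesis by (simp add: Suc_le_eq)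
  qed
  have "gsh_gen r es = (\<Sum>m=1..r. \<Sum>w\<in>{w \<in> comps r. length w = m}. F (rev w))"
    unfolding gsh_gen_def eq
  proof (intro sum.cong refl)
    fix m w assume "w \<in> {w \<in> comps r. length w = m}"
    thus "fps_const (1 / (\<Prod>j<m. fact (w ! j))) * ps_subst m (H_series w) (lower_entry r w) es = F (rev w)"
      using ps_subst_H_series[of "rev w" r es] assms weight_eq[of w]
      by (auto simp: F_def rev_comps weight_rev)
  qed
  also have "\<dots> = (\<Sum>w\<in>comps r. F (rev w))"
    using len by (intro sum.group finite_comps) auto
  also have "\<dots> = (\<Sum>w\<in>comps r. F w)"
    by (rule sum.reindex_bij_witness[of _ rev rev]) (auto simp: rev_comps)
  finally show ?thesis by (simp add: F_def sser_def)
qed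

lemma gsh_eq_sser:
  assumes "ks \<noteq> []"
  shows "gsh ks = sser (length ks) (gap_monom (map (\<lambda>k. k - 1) ks))"
  using assms by (simp add: gsh_def gsh_gen_eq_sser)

section \<open>Polynomial functions\<close>

text \<open>The rule \<open>cong\<close> makes the values on lists of length other than \<open>r\<close> irrelevant.\<close>

inductive polyfun :: "nat \<Rightarrow> (nat list \<Rightarrow> rat) \<Rightarrow> bool" for r where
  const: "polyfun r (\<lambda>_. c)"
| coord: "i < r \<Longrightarrow> polyfun r (\<lambda>xs. of_nat (xs ! i))"
| add: "polyfun r p \<Longrightarrow> polyfun r q \<Longrightarrow> polyfun r (\<lambda>xs. p xs + q xs)"
| mult: "polyfun r p \<Longrightarrow> polyfun r q \<Longrightarrow> polyfun r (\<lambda>xs. p xs * q xs)"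
| cong: "polyfun r p \<Longrightarrow> (\<And>xs. length xs = r \<Longrightarrow> p xs = q xs) \<Longrightarrow> polyfun r q"

lemma polyfun_power: "polyfun r p \<Longrightarrow> polyfun r (\<lambda>xs. p xs ^ n)"
  by (induction n) (auto intro: polyfun.intros)

lemma polyfun_diff: "polyfun r p \<Longrightarrow> polyfun r q \<Longrightarrow> polyfun r (\<lambda>xs. p xs - q xs)"
  using polyfun.add[of r p "\<lambda>xs. (- 1) * q xs"] polyfun.mult[of r "\<lambda>_. - 1" q] by (simp add: polyfun.const)

lemma polyfun_sum: "(\<And>i. i \<in> I \<Longrightarrow> polyfun r (p i)) \<Longrightarrow> polyfun r (\<lambda>xs. \<Sum>i\<in>I. p i xs)"
  by (induction I rule: infinite_finite_induct) (auto intro: polyfun.intros)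

lemma polyfun_prod: "(\<And>i. i \<in> I \<Longrightarrow> polyfun r (p i)) \<Longrightarrow> polyfun r (\<lambda>xs. \<Prod>i\<in>I. p i xs)"
  by (induction I rule: infinite_finite_induct) (auto intro: polyfun.intros)

lemma polyfun_poly:
  assumes "polyfun r p"
  shows "polyfun r (\<lambda>xs. poly P (p xs))"
  unfolding poly_altdef by (intro polyfun_sum polyfun.mult polyfun.const polyfun_power assms)

lemma polyfun_subst:
  assumes "polyfun r p" "\<And>i. i < r \<Longrightarrow> polyfun s (\<lambda>xs. of_nat (g xs ! i))"
    and "\<And>xs. length xs = s \<Longrightarrow> length (g xs) = r"
  shows "polyfun s (\<lambda>xs. p (g xs))"
  using assms(1)
proof induction
  case (cong p q)
  show ?case
    by (rule polyfun.cong[OF cong.IH]) (use cong.hyps assms(3) in auto)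
qed (auto intro: polyfun.const polyfun.add polyfun.mult assms)

text \<open>The coordinates \<open>c\<close> are a parameter: the entries themselves are used for
  summing out an index, the increments for the comparison with \<open>gsh\<close>.\<close>

inductive monom_comb :: "(nat list \<Rightarrow> nat \<Rightarrow> rat) \<Rightarrow> nat \<Rightarrow> (nat list \<Rightarrow> rat) \<Rightarrow> bool" for c r where
  zero: "monom_comb c r (\<lambda>_. 0)"
| add_monom: "monom_comb c r p \<Longrightarrow> monom_comb c r (\<lambda>xs. k * (\<Prod>i<r. c xs i ^ e i) + p xs)"
| cong: "monom_comb c r p \<Longrightarrow> (\<And>xs. length xs = r \<Longrightarrow> p xs = q xs) \<Longrightarrow> monom_comb c r q"

lemma monom_comb_monom: "monom_comb c r (\<lambda>xs. k * (\<Prod>i<r. c xs i ^ e i))"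
  using monom_comb.add_monom[OF monom_comb.zero, of c r k e] by simp

lemma monom_comb_add:
  assumes "monom_comb c r p" "monom_comb c r q"
  shows "monom_comb c r (\<lambda>xs. p xs + q xs)"
  using assms(1)
proof induction
  case zero
  thus ?case using assms(2) by simp
next
  case (add_monom p k e)
  thus ?case using monom_comb.add_monom[of c r _ k e] by (simp add: add.assoc)
next
  case (cong p q')
  show ?case by (rule monom_comb.cong[OF cong.IH]) (simp add: cong.hyps)
qed

lemma monom_comb_mult:
  assumes "monom_comb c r p" "monom_comb c r q"
  shows "monom_comb c r (\<lambda>xs. p xs * q xs)"
proof -
  have mono: "monom_comb c r (\<lambda>xs. k * (\<Prod>i<r. c xs i ^ e i) * q xs)" for k e
    using assms(2)
  proof induction
    case zero
    thus ?case by (simp add: monom_comb.zero)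
  next
    case (add_monom q l f)
    have "monom_comb c r (\<lambda>xs. k * l * (\<Prod>i<r. c xs i ^ (e i + f i)) + k * (\<Prod>i<r. c xs i ^ e i) * q xs)"
      by (rule monom_comb.add_monom) (rule add_monom)
    thus ?case by (simp add: power_add prod.distrib algebra_simps)
  next
    case (cong q q')
    show ?case by (rule monom_comb.cong[OF cong.IH]) (simp add: cong.hyps)
  qed
  from assms(1) show ?thesis
  proof induction
    case zero
    thus ?case by (simp add: monom_comb.zero)
  next
    case (add_monom p k e)
    thus ?case using monom_comb_add[OF mono add_monom.IH, of k e] by (simp add: distrib_right)
  next
    case (cong p p')
    show ?case by (rule monom_comb.cong[OF cong.IH]) (simp add: cong.hyps)
  qed
qed

lemma monom_comb_const: "monom_comb c r (\<lambda>_. k)"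
  using monom_comb_monom[of c r k "\<lambda>_. 0"] by simp

lemma monom_comb_coord:
  assumes "i < r"
  shows "monom_comb c r (\<lambda>xs. c xs i)"
proof -
  have "(\<Prod>j<r. c xs j ^ (if j = i then 1 else 0)) = c xs i" for xs
    using assms by (subst prod.remove[of _ i]) auto
  thus ?thesis
    using monom_comb_monom[of c r 1 "\<lambda>j. if j = i then 1 else 0"] by simp
qed

lemma polyfun_monom_comb:
  assumes "polyfun r p" "\<And>i. i < r \<Longrightarrow> monom_comb c r (\<lambda>xs. of_nat (xs ! i))"
  shows "monom_comb c r p"
  using assms(1)
proof induction
  case (cong p q)
  show ?case by (rule monom_comb.cong[OF cong.IH]) (simp add: cong.hyps)
qed (auto intro: assms monom_comb_const monom_comb_add monom_comb_mult)

section \<open>Removing exponents 0 by summation\<close>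

text \<open>Faulhaber: the differences of consecutive powers with exponent \<open>Suc k\<close>
  telescope, and expanding them binomially lets one solve for the \<open>k\<close>-th power
  sum.\<close>

lemma power_sum_poly: "\<exists>P :: rat poly. \<forall>n. (\<Sum>d<n. of_nat d ^ k) = poly P (of_nat n)"
proof (induction k rule: less_induct)
  case (less k)
  obtain P :: "nat \<Rightarrow> rat poly" where P: "\<And>j n. j < k \<Longrightarrow> (\<Sum>d<n. of_nat d ^ j) = poly (P j) (of_nat n)"
    using less.IH by metis
  define Q where "Q = smult (1 / of_nat (Suc k)) (monom 1 (Suc k) - (\<Sum>j<k. smult (of_nat (Suc k choose j)) (P j)))"
  have "(\<Sum>d<n. of_nat d ^ k) = poly Q (of_nat n)" for n
  proof -
    have step: "of_nat (Suc d) ^ Suc k - of_nat d ^ Suc k =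
        (\<Sum>j<k. of_nat (Suc k choose j) * of_nat d ^ j) + of_nat (Suc k) * (of_nat d ^ k :: rat)" for d
    proof -
      have "(of_nat (Suc d) :: rat) ^ Suc k = (of_nat d + 1) ^ Suc k" by (simp add: add.commute)
      also have "\<dots> = (\<Sum>j\<le>Suc k. of_nat (Suc k choose j) * of_nat d ^ j)"
        by (subst binomial_ring) simp
      also have "\<dots> = (\<Sum>j<k. of_nat (Suc k choose j) * of_nat d ^ j) + of_nat (Suc k) * of_nat d ^ k + of_nat d ^ Suc k"
        by (simp add: lessThan_Suc_atMost[symmetric] binomial_symmetric[of k "Suc k"] del: of_nat_Suc binomial_Suc_Suc)
      finally show ?thesis by simp
    qed
    have "of_nat n ^ Suc k = (\<Sum>d<n. of_nat (Suc d) ^ Suc k - of_nat d ^ Suc k :: rat)"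
      by (subst sum_lessThan_telescope) simp
    also have "\<dots> = (\<Sum>j<k. of_nat (Suc k choose j) * (\<Sum>d<n. of_nat d ^ j)) + of_nat (Suc k) * (\<Sum>d<n. of_nat d ^ k)"
      unfolding step sum.distrib sum_distrib_left by (simp only: sum.swap[of _ "{..<k}"])
    also have "(\<Sum>j<k. of_nat (Suc k choose j) * (\<Sum>d<n. of_nat d ^ j)) =
        (\<Sum>j<k. of_nat (Suc k choose j) * poly (P j) (of_nat n :: rat))"
      by (simp add: P)
    finally show ?thesis
      by (simp add: Q_def poly_monom poly_sum field_simps del: of_nat_Suc)
  qed
  thus ?case by blast
qed

definition between :: "nat \<Rightarrow> nat list \<Rightarrow> nat set" where
  "between k xs = {(if k < length xs then xs ! k else 0)<..<xs ! (k - 1)}"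

text \<open>An exponent \<open>0\<close> below the top of a word is removed by summing over the corresponding index.\<close>

definition sum_out :: "nat \<Rightarrow> (nat list \<Rightarrow> rat) \<Rightarrow> nat list \<Rightarrow> rat" where
  "sum_out k p xs = (\<Sum>d\<in>between k xs. p (take k xs @ d # drop k xs))"

lemma hsum_sum: "hsum ns U (\<lambda>ds. \<Sum>i\<in>I. p i ds) = (\<Sum>i\<in>I. hsum ns U (p i))"
proof -
  have "hsum ns U (\<lambda>_. 0) = 0" using hsum_cmult[of ns U 0 "\<lambda>_. 0"] by simp
  thus ?thesis
    by (induction I rule: infinite_finite_induct) (simp_all add: hsum_add)
qed

text \<open>A factor \<open>geo d ^ 0\<close> is 1, so the sum over \<open>d\<close> between its two
  neighbours moves into the weight. With \<open>v\<close> empty there is no upper neighbour, and the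
  weight would depend on \<open>U\<close>.\<close>

lemma hsum_zero_exponent:
  assumes "v \<noteq> []"
  shows "hsum (v @ 0 # w) U p = hsum (v @ w) U (sum_out (length v) p)"
  using assms
proof (induction v arbitrary: U p)
  case (Cons n v)
  show ?case
  proof (cases "v = []")
    case [simp]: True
    have "(\<Sum>d\<in>{0<..<F}. hsum w d (\<lambda>ds. p (F # d # ds))) = hsum w F (\<lambda>ds. sum_out 1 p (F # ds))" for F
    proof (cases w)
      case Nil
      thus ?thesis
        using hsum_sum[of "[]" F "\<lambda>d ds. p (F # d # ds)" "{0<..<F}"]
        by (simp add: sum_out_def between_def)
    next
      case [simp]: (Cons m ms)
      have "(\<Sum>d\<in>{0<..<F}. hsum w d (\<lambda>ds. p (F # d # ds))) =
          (\<Sum>d\<in>{0<..<F}. \<Sum>e\<in>{e\<in>{0<..<F}. e < d}. geo e ^ m * hsum ms e (\<lambda>ds. p (F # d # e # ds)))"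
        by (auto intro!: sum.cong)
      also have "\<dots> = (\<Sum>e\<in>{0<..<F}. \<Sum>d\<in>{d\<in>{0<..<F}. e < d}. geo e ^ m * hsum ms e (\<lambda>ds. p (F # d # e # ds)))"
        by (rule sum.swap_restrict) auto
      also have "\<dots> = (\<Sum>e\<in>{0<..<F}. \<Sum>d\<in>{e<..<F}. geo e ^ m * hsum ms e (\<lambda>ds. p (F # d # e # ds)))"
        by (auto intro!: sum.cong)
      also have "\<dots> = hsum w F (\<lambda>ds. sum_out 1 p (F # ds))"
        by (simp add: sum_out_def between_def hsum_sum sum_distrib_left)
      finally show ?thesis .
    qed
    thus ?thesis by simp
  next
    case False
    have "sum_out (length v) (\<lambda>ds. p (d # ds)) ds = sum_out (length (n # v)) p (d # ds)" for d ds
      using False by (cases v) (simp_all add: sum_out_def between_def)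
    thus ?thesis
      using Cons.IH[OF False] by simp
  qed
qed simp

lemma hser_zero_exponent: "v \<noteq> [] \<Longrightarrow> hser (v @ 0 # w) p = hser (v @ w) (sum_out (length v) p)"
  by (simp add: hser_def hsum_zero_exponent)

text \<open>Sums over open intervals and truncated subtraction agree with polynomials only on
  strictly decreasing lists, hence the restriction to chains.\<close>

definition polyfun_on_chains :: "nat \<Rightarrow> (nat list \<Rightarrow> rat) \<Rightarrow> bool" where
  "polyfun_on_chains r p \<longleftrightarrow> (\<exists>q. polyfun r q \<and> (\<forall>xs\<in>chains r. p xs = q xs))"

text \<open>On monomials in the entries, only the power of the removed entry is summed, which gives
  a difference of two values of a Faulhaber polynomial at the neighbouring entries.\<close>

lemma polyfun_on_chains_sum_out:
  assumes "polyfun_on_chains (Suc r) p" "0 < k" "k \<le> r"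
  shows "polyfun_on_chains r (sum_out k p)"
proof -
  obtain q where q: "polyfun (Suc r) q" "\<And>xs. xs \<in> chains (Suc r) \<Longrightarrow> p xs = q xs"
    using assms(1) by (auto simp: polyfun_on_chains_def)
  have pq: "sum_out k p xs = sum_out k q xs" if xs: "xs \<in> chains r" for xs
    unfolding sum_out_def
  proof (intro sum.cong refl q)
    fix d assume d: "d \<in> between k xs"
    have len: "length xs = r" and sorted: "sorted_wrt (>) xs" and "0 \<notin> set xs"
      using xs by (auto simp: chains_def)
    have up: "d < x" if mem: "x \<in> set (take k xs)" for x
    proof -
      obtain i where i: "i < k" "x = xs ! i" using mem len assms by (auto simp: in_set_conv_nth)
      have "xs ! (k - 1) \<le> xs ! i"
        using sorted_wrt_nth_less[OF sorted, of i "k - 1"] i len assms(2,3)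
        by (cases "i = k - 1") (auto intro: less_imp_le)
      thus ?thesis using d i by (simp add: between_def)
    qed
    have down: "x < d" if mem: "x \<in> set (drop k xs)" for x
    proof -
      obtain i where "i < length (drop k xs)" "x = drop k xs ! i"
        using mem by (metis in_set_conv_nth)
      hence i: "k + i < r" "x = xs ! (k + i)"
        using len by auto
      have "xs ! (k + i) \<le> xs ! k"
        using sorted_wrt_nth_less[OF sorted, of k "k + i"] i len by (cases "i = 0") auto
      thus ?thesis using d i len by (simp add: between_def)
    qed
    have "sorted_wrt (>) (take k xs @ drop k xs)" using sorted by simp
    hence "sorted_wrt (>) (take k xs @ d # drop k xs)"
      using up down unfolding sorted_wrt_append by auto
    moreover have "0 \<notin> set (take k xs @ d # drop k xs)"
      using \<open>0 \<notin> set xs\<close> d by (auto simp: between_def dest: in_set_takeD in_set_dropD)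
    ultimately show "take k xs @ d # drop k xs \<in> chains (Suc r)"
      using len assms by (simp add: chains_def)
  qed
  have "monom_comb (\<lambda>xs i. of_nat (xs ! i)) (Suc r) q"
    by (rule polyfun_monom_comb[OF q(1)]) (rule monom_comb_coord)
  hence "polyfun_on_chains r (sum_out k q)"
  proof induction
    case zero
    show ?case
      unfolding polyfun_on_chains_def sum_out_def
      by (intro exI[of _ "\<lambda>_. 0"]) (auto intro: polyfun.const)
  next
    case (add_monom q c e)
    obtain P :: "rat poly" where P: "\<And>n. (\<Sum>d<n. of_nat d ^ e k) = poly P (of_nat n)"
      using power_sum_poly by blast
    obtain q' where q': "polyfun r q'" "\<And>xs. xs \<in> chains r \<Longrightarrow> sum_out k q xs = q' xs"
      using add_monom.IH by (auto simp: polyfun_on_chains_def)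
    define low where "low xs = (if k < r then of_nat (xs ! k) else 0 :: rat)" for xs :: "nat list"
    define f where "f xs = c * ((\<Prod>i<k. of_nat (xs ! i) ^ e i) * (\<Prod>i\<in>{k..<r}. of_nat (xs ! i) ^ e (Suc i))) *
      (poly P (of_nat (xs ! (k - 1))) - poly P (low xs + 1)) + q' xs" for xs
    have "polyfun r low"
      unfolding low_def by (cases "k < r") (auto intro: polyfun.intros)
    hence "polyfun r f"
      unfolding f_def using assms q'
      by (intro polyfun.add polyfun.mult polyfun.const polyfun_prod polyfun_power polyfun_diff polyfun_poly polyfun.coord)
         auto
    moreover have "sum_out k (\<lambda>xs. c * (\<Prod>i<Suc r. of_nat (xs ! i) ^ e i) + q xs) xs = f xs" if xs: "xs \<in> chains r" for xs
    proof -
      have len: "length xs = r" and sorted: "sorted_wrt (>) xs" and nz: "0 \<notin> set xs"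
        using xs by (auto simp: chains_def)
      define a where "a = (if k < r then xs ! k else 0)"
      have "a < xs ! (k - 1)"
      proof (cases "k < r")
        case True
        thus ?thesis
          using sorted_wrt_nth_less[OF sorted, of "k - 1" k] len assms(2) by (simp add: a_def)
      next
        case False
        have "xs ! (k - 1) \<in> set xs"
          using len assms(2,3) by (intro nth_mem) simp
        thus ?thesis using nz False by (auto simp: a_def intro!: gr0I)
      qed
      have split: "{..<Suc r} = {..<k} \<union> {k} \<union> Suc ` {k..<r}"
        using assms(3) by auto
      have "(\<Prod>i<Suc r. of_nat ((take k xs @ d # drop k xs) ! i) ^ e i) =
          (\<Prod>i<k. of_nat (xs ! i) ^ e i) * (\<Prod>i\<in>{k..<r}. of_nat (xs ! i) ^ e (Suc i)) * (of_nat d ^ e k :: rat)" for d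
      proof -
        have "(\<Prod>i<Suc r. of_nat ((take k xs @ d # drop k xs) ! i) ^ e i) =
            (\<Prod>i<k. of_nat ((take k xs @ d # drop k xs) ! i) ^ e i) *
            (\<Prod>i\<in>{k}. of_nat ((take k xs @ d # drop k xs) ! i) ^ e i) *
            (\<Prod>i\<in>Suc ` {k..<r}. of_nat ((take k xs @ d # drop k xs) ! i) ^ e i :: rat)"
          unfolding split by (subst prod.union_disjoint; force)+
        also have "(\<Prod>i\<in>Suc ` {k..<r}. of_nat ((take k xs @ d # drop k xs) ! i) ^ e i :: rat) =
            (\<Prod>i\<in>{k..<r}. of_nat (xs ! i) ^ e (Suc i))"
          using len assms by (subst prod.reindex) (auto intro!: prod.cong simp: nth_append Suc_diff_le)
        finally show ?thesis
          using len assms by (simp add: nth_append)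
      qed
      \<comment> \<open>The difference formula requires \<open>a + 1\<close> not to exceed the upper
        end; strict decrease of the chain provides this.\<close>
      moreover have "(\<Sum>d\<in>{a<..<xs ! (k - 1)}. of_nat d ^ e k) = poly P (of_nat (xs ! (k - 1))) - poly P (of_nat a + 1)"
      proof -
        have "{..<xs ! (k - 1)} = {..<Suc a} \<union> {a<..<xs ! (k - 1)}"
          using \<open>a < xs ! (k - 1)\<close> by auto
        hence "(\<Sum>d<xs ! (k - 1). of_nat d ^ e k :: rat) = (\<Sum>d\<in>{..<Suc a} \<union> {a<..<xs ! (k - 1)}. of_nat d ^ e k)"
          by (rule arg_cong)
        also have "\<dots> = (\<Sum>d<Suc a. of_nat d ^ e k) + (\<Sum>d\<in>{a<..<xs ! (k - 1)}. of_nat d ^ e k)"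
          by (rule sum.union_disjoint) auto
        finally show ?thesis by (simp add: P add.commute del: sum.lessThan_Suc)
      qed
      moreover have "between k xs = {a<..<xs ! (k - 1)}" "of_nat a = low xs"
        by (simp_all add: between_def a_def low_def len)
      ultimately have "(\<Sum>d\<in>between k xs. c * (\<Prod>i<Suc r. of_nat ((take k xs @ d # drop k xs) ! i) ^ e i)) = f xs - q' xs"
        by (simp add: sum_distrib_left[symmetric] f_def mult.assoc del: prod.lessThan_Suc)
      thus ?thesis
        using q'(2)[OF xs] by (simp add: sum_out_def sum.distrib del: prod.lessThan_Suc)
    qed
    ultimately show ?case
      unfolding polyfun_on_chains_def by blast
  next
    case (cong p q)
    have "sum_out k p xs = sum_out k q xs" if "xs \<in> chains r" for xs
      unfolding sum_out_def using that assms
      by (intro sum.cong refl cong.hyps) (auto simp: chains_def)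
    thus ?case
      using cong.IH unfolding polyfun_on_chains_def by metis
  qed
  thus ?thesis
    using pq by (auto simp: polyfun_on_chains_def)
qed

section \<open>Functional equations\<close>

text \<open>
  The letters stand for the words with exponents \<open>(2,1)\<close>, \<open>(1,2)\<close>, \<open>(3)\<close>, listed from the smallest index
  upwards; the arguments are the coefficients of the increments in the same order. \<open>sh11\<close> results from
  eliminating the word \<open>(1,1,1)\<close>.
\<close>

lemma functional_equations_degree_3:
  fixes al be :: "rat \<Rightarrow> rat \<Rightarrow> rat" and c :: "rat \<Rightarrow> rat"
  assumes st: "\<And>x y. al (x + y) y + be (x + y) x + c (x + y) = 0"
    and sh2: "\<And>x y. al x y + be x y + be y x = 0"
    and sh11: "\<And>y z1 z2. (al y z2 / 2 + be y z1 / 2 + c y / 6) + (al z1 z2 / 2 + be z1 y / 2 + c z1 / 6)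
       + (al z1 y / 2 + be z1 z2 / 2 + c z1 / 6) = 0"
  shows "al x y = 0" "be x y = 0" "c x = 0"
proof -
  \<comment> \<open>Each \<open>al\<close> in \<open>sh11\<close> is replaced through
    \<open>sh2\<close>. Then \<open>z\<close> occurs only in \<open>be w z\<close> and
    \<open>c z\<close>, so \<open>be w z - 2/3 * c z\<close> depends on \<open>w\<close> alone, and
    \<open>w = y = z\<close> determines it.\<close>
  have R: "be w z = - be y w - be w y + c y / 3 + 2/3 * c z" for w y z
    using sh11[where y=y and ?z1.0=z and ?z2.0=w] sh2[of y w] sh2[of z w] sh2[of z y] by linarith
  define g where "g w = be w 0 - 2/3 * c 0" for w
  have be: "be w z = g w + 2/3 * c z" for w z
    using R[of w z 0] R[of w 0 0] by (simp add: g_def)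
  have "g w = - c w / 3" for w
    using R[of w w w] be[of w w] by linarith
  with be have be': "be w z = 2/3 * c z - c w / 3" for w z
    by (simp add: algebra_simps)
  have al: "al w z = - c w / 3 - c z / 3" for w z
    using sh2[of w z] be'[of w z] be'[of z w] by linarith
  have c: "c (x + y) / 3 + 2/3 * c x - c y / 3 = 0" for x y
    using st[of x y] al[of "x+y" y] be'[of "x+y" x] by linarith
  have c0: "c x = 0" for x
    using c[of 0 0] c[of x 0] by simp
  thus "al x y = 0" "be x y = 0" "c x = 0"
    using al be' by simp_all
qed

text \<open>
  Likewise for the words \<open>(2,1,1)\<close>, \<open>(1,2,1)\<close>, \<open>(1,1,2)\<close>, \<open>(3,1)\<close>, \<open>(1,3)\<close>, \<open>(2,2)\<close>, \<open>(4)\<close>. First \<open>et\<close>, then the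
  mixed part \<open>w\<close> of \<open>ep\<close> is seen to separate the variables; from then on every function is a combination
  of \<open>N\<close>-th powers of linear forms, and it remains to compare coefficients.
\<close>

lemma functional_equations_degree_4:
  fixes al be ga :: "rat \<Rightarrow> rat \<Rightarrow> rat \<Rightarrow> rat" and ep ze et :: "rat \<Rightarrow> rat \<Rightarrow> rat" and ka :: "rat \<Rightarrow> rat"
  assumes N: "N \<ge> 3"
    and sh111: "\<And>y z1 z2 z3.
      ((al y z2 z3 + be y z1 z3 + ga y z1 z2) / 2 + (ep y z3 + ze y z1) / 6 + et y z2 / 4 + ka y / 24) +
      ((al z1 z2 z3 + be z1 y z3 + ga z1 y z2) / 2 + (ep z1 z3 + ze z1 y) / 6 + et z1 z2 / 4 + ka z1 / 24) +
      ((al z1 y z3 + be z1 z2 z3 + ga z1 z2 y) / 2 + (ep z1 z3 + ze z1 z2) / 6 + et z1 y / 4 + ka z1 / 24) +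
      ((al z1 z3 y + be z1 z2 y + ga z1 z2 z3) / 2 + (ep z1 y + ze z1 z2) / 6 + et z1 z3 / 4 + ka z1 / 24) = 0"
    and sh12: "\<And>y z1 z2. ga y z1 z2 + ga z1 y z2 + ga z1 z2 y + be z1 z2 y = 0"
    and sh21: "\<And>y z1 z2. be y z1 z2 + al z1 y z2 + be z1 y z2 + al z1 z2 y = 0"
    and sh3: "\<And>y z. ep z y + et z y + ze z y + ze y z = 0"
    and st3: "\<And>y z. ze (y + z) z + ep (y + z) y + ka (y + z) = 0"
    and st21: "\<And>y z1 z2. be (z1 + y) z1 z2 + al (z1 + y) (z2 + y) z2 + al (z1 + y) (z2 + y) y
       + ep (z1 + y) z2 + et (z1 + y) (z2 + y) = 0"
    and ka: "\<And>t x. ka (t * x) = t ^ N * ka x"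
    and et: "\<And>t x y. et (t * x) (t * y) = t ^ N * et x y"
    and ep: "\<And>t x y. ep (t * x) (t * y) = t ^ N * ep x y"
    and al: "\<And>t x y z. al (t * x) (t * y) (t * z) = t ^ N * al x y z"
  shows "al x y z = 0" "be x y z = 0" "ga x y z = 0" "ep x y = 0" "ze x y = 0" "et x y = 0" "ka x = 0"
proof -
  define P :: "rat \<Rightarrow> rat" where "P x = x ^ N" for x
  \<comment> \<open>By homogeneity a function of one free argument is a multiple of
    \<open>P\<close>. These five multiples, up to normalisation, are the unknowns left for the
    comparison of coefficients.\<close>
  define k f g w1 w2 where "k = ka 1" and "f = et 1 0" and "g = et 0 1"
    and "w1 = - ep 1 0 / 3" and "w2 = - ep 0 1 / 3"
  have P0: "P 0 = 0" using N by (simp add: P_def)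
  have P1: "P 1 = 1" by (simp add: P_def)
  have ka': "ka x = k * P x" for x
    using ka[of x 1] by (simp add: k_def P_def)
  have et0: "et x 0 = f * P x" "et 0 x = g * P x" for x
    using et[of x 1 0] et[of x 0 1] by (simp_all add: f_def g_def P_def)
  have ep0: "ep x 0 = - 3 * w1 * P x" "ep 0 x = - 3 * w2 * P x" for x
    using ep[of x 1 0] ep[of x 0 1] by (simp_all add: w1_def w2_def P_def)
  have al0: "al 0 0 0 = 0"
    using al[of 0 0 0 0] N by (simp add: power_0_left)
  \<comment> \<open>Twice \<open>sh111\<close>, simplified by \<open>sh12\<close>,
    \<open>sh21\<close> and \<open>sh3\<close> so that \<open>be\<close>, \<open>ga\<close> and
    \<open>ze\<close> no longer involve \<open>y\<close>. Differences in \<open>y\<close> therefore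
    cancel them.\<close>
  define M where "M y z1 z2 z3 = al y z2 z3 + al z1 z2 z3 + be z1 z2 z3 + ga z1 z2 z3 + ep y z3 / 3
     + 2/3 * ep z1 z3 + 2/3 * ze z1 z2 + et y z2 / 2 + et z1 z2 / 2 + et z1 z3 / 2 + et z1 y / 6
     + ka y / 12 + ka z1 / 4" for y z1 z2 z3
  have M: "M y z1 z2 z3 = 0" for y z1 z2 z3
    unfolding M_def
    using sh111[where y=y and ?z1.0=z1 and ?z2.0=z2 and ?z3.0=z3] sh12[of y z1 z2] sh21[of y z1 z3] sh3[of z1 y]
    by (simp only: add_divide_distrib)
  have et00: "et 0 0 = 0"
    by (simp add: et0 P0)
  \<comment> \<open>In the mixed difference of \<open>M\<close> with respect to \<open>y\<close> and
    \<open>z1\<close>, only the term \<open>et z1 y / 6\<close> survives.\<close>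
  have "et x y = et x 0 + et 0 y" for x y
    using M[of y x 0 0] M[of 0 x 0 0] M[of y 0 0 0] M[of 0 0 0 0] et00
    unfolding M_def by linarith
  hence et': "et x y = f * P x + g * P y" for x y
    by (simp add: et0)
  \<comment> \<open>The mixed part of \<open>ep\<close>. The factor \<open>- 1 / 3\<close> lets it
    enter \<open>al\<close> with coefficient 1, since \<open>M\<close> contains
    \<open>ep y z3 / 3\<close>.\<close>
  define w where "w x y = - ep x y / 3 - w1 * P x - w2 * P y" for x y
  have ep': "ep x y = - 3 * w x y - 3 * w1 * P x - 3 * w2 * P y" for x y
    by (simp add: w_def field_simps)
  have w0: "w x 0 = 0" "w 0 x = 0" for x
    by (simp_all add: w_def ep0 P0)
  define mu where "mu = w1 - f / 2 - g / 6 - k / 12"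
  define a where "a y z = al 0 y z" for y z
  have al': "al x y z = a y z + w x z + mu * P x" for x y z
    using M[of x 0 y z] M[of 0 0 y z]
    unfolding M_def a_def mu_def ep' et' ka' w0 P0 by (simp add: algebra_simps add_divide_distrib diff_divide_distrib w0 P0)
  \<comment> \<open>This is \<open>al x y z + al x z y\<close>. By \<open>sh21\<close> it is
    symmetric in \<open>x\<close> and \<open>y\<close>, which determines the symmetric part of
    \<open>a\<close>.\<close>
  define S where "S x y z = w x z + w x y + 2 * mu * P x + a y z + a z y" for x y z
  have S_be: "S x y z = - be x y z - be y x z" for x y z
    using sh21[of y x z] unfolding al' S_def by linarith
  have S_sym: "S x y z = S y x z" for x y z
    using S_be[of x y z] S_be[of y x z] by linarith
  have a00: "a 0 0 = 0" by (simp add: a_def al0)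
  have ax0: "a x 0 + a 0 x = 2 * mu * P x" for x
    using S_sym[of x 0 0] by (simp add: S_def w0 P0 a00)
  have as: "a y z + a z y = w y z + 2 * mu * (P y + P z)" for y z
    using S_sym[of 0 y z] ax0[of z] by (simp add: S_def w0 P0 algebra_simps)
  \<comment> \<open>At \<open>y = 0\<close> the relation \<open>st21\<close> contains
    \<open>w x z\<close> with total coefficient \<open>- 3\<close> (from \<open>be\<close>,
    \<open>al\<close>, \<open>ep\<close>: -1, +1, -3), and its other terms depend on
    \<open>x\<close> or on \<open>z\<close> only. As \<open>w\<close> vanishes on both axes, it is
    then zero.\<close>
  obtain F G where FG: "\<And>x z. w x z = F x + G z"
  proof -
    have *: "6 * w x z = (2 * f * P x - w x x - 6 * w1 * P x) +
      (2 * a z z + 2 * a z 0 + 2 * g * P z - 2 * mu * P z - 6 * w2 * P z)" for x z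
      using st21[of x 0 z] S_be[of x x z] as[of x z]
      unfolding al' ep' et' S_def by (simp add: algebra_simps w0)
    show ?thesis
      by (rule that[of "\<lambda>x. (2 * f * P x - w x x - 6 * w1 * P x) / 6"
           "\<lambda>z. (2 * a z z + 2 * a z 0 + 2 * g * P z - 2 * mu * P z - 6 * w2 * P z) / 6"])
         (subst add_divide_distrib[symmetric], subst *[symmetric], simp)
  qed
  have w: "w x z = 0" for x z
    using FG[of x z] FG[of x 0] FG[of 0 z] FG[of 0 0] w0[of 0] w0[of x] w0[of z] by linarith
  have ze: "ze s z = (3 * w1 - k) * P s + 3 * w2 * P (s - z)" for s z
    using st3[of "s - z" z] by (simp add: ep' ka' w algebra_simps)
  define e where "e = 1 + P (-1)"
  have sh3': "(3 * w1 - k) * (P z + P y) + 3 * w2 * (P (z - y) + P (y - z))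
      = (3 * w1 - f) * P z + (3 * w2 - g) * P y" for z y
    using sh3[of z y] by (simp add: ep' et' ze w algebra_simps)
  have r1: "3 * w1 - k + 3 * (w2 * e) = 3 * w1 - f"
    using sh3'[of 1 0] by (simp add: P0 P1 e_def)
  have r2: "3 * w1 - k + 3 * (w2 * e) = 3 * w2 - g"
    using sh3'[of 0 1] by (simp add: P0 P1 e_def add.commute)
  have r3: "6 * w1 - 2 * k = 3 * w1 - f + 3 * w2 - g"
    using sh3'[of 1 1] by (simp add: P0 P1 e_def)
  define we where "we = w2 * e"
  have "we = 0" and fk: "f = k" and gk: "3 * w1 - k = 3 * w2 - g"
    using r1 r2 r3 unfolding we_def[symmetric] by - linarith+
  hence w2e: "w2 * e = 0" by (simp add: we_def)
  have Pm: "w2 * (P (x - y) + P (y - x)) = 0" for x y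
  proof -
    have "P (x - y) + P (y - x) = P (x - y) * e"
      unfolding e_def P_def by (simp add: algebra_simps flip: power_mult_distrib)
    with w2e show ?thesis by auto
  qed
  define c1 where "c1 = - mu - 3/4 * k"
  have bg: "be x y z + ga x y z = - 2 * a y z + c1 * P x - g * P y + (3 * w2 - g / 2) * P z
     - 2 * w2 * P (x - y)" for x y z
    using M[of 0 x y z] unfolding M_def al' ep' et' ka' ze w P0 c1_def fk a_def[symmetric]
    by (simp add: algebra_simps add_divide_distrib diff_divide_distrib)
  \<comment> \<open>The two \<open>be\<close> from \<open>S_be\<close> complete \<open>sh12\<close>
    to three sums \<open>be + ga\<close>, to which \<open>bg\<close> applies without
    \<open>be\<close> being known separately.\<close>
  have sum: "(be y x z + ga y x z) + (be x y z + ga x y z) + (be x z y + ga x z y) = - S x y z" for x y z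
    using sh12[of y x z] S_be[of x y z] by linarith
  \<comment> \<open>The variable \<open>y\<close> now occurs only in \<open>P y\<close>. Its
    coefficient must vanish, which gives \<open>c1\<close>, and what remains determines
    \<open>a\<close>.\<close>
  have sum0: "(2 * mu + c1 - 3/2 * g + 3 * w2 - 4 * mu) * P y + P x * (2 * mu + 2 * c1 - g) 
      + P z * (- 2 * mu - 2 * g + 6 * w2) - 2 * w2 * P (x - z) - 2 * a x z = 0" for x y z
    using sum[of y x z] as[of y z] Pm[of x y]
    unfolding bg S_def w by (simp add: algebra_simps) 
  have E1: "c1 = 2 * mu + 3/2 * g - 3 * w2"
    using sum0[of 1 0 0] sum0[of 0 0 0] P0 P1 by (simp add: algebra_simps)
  have a2: "2 * a x z = P x * (2 * mu + 2 * c1 - g) + P z * (- 2 * mu - 2 * g + 6 * w2) - 2 * w2 * P (x - z)" for x z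
    using sum0[of 0 x z] P0 by (simp add: algebra_simps)
  define B C D E where "B = 3 * w1 - k" and "C = mu + c1" and "D = 2 * mu + g + w2" and "E = mu + g - 2 * w2"
  \<comment> \<open>With \<open>al\<close>, \<open>ep\<close> and \<open>et\<close> known,
    \<open>st21\<close> at \<open>z1 = q\<close>, \<open>y = p - q\<close>, \<open>z2 = r\<close>
    yields \<open>be\<close>. Inserted into \<open>S_be\<close> this is a relation between powers,
    which is then tested at arguments 0 and 1.\<close>
  have be': "be p q r = (B - 2 * mu) * P p - 2 * C * P (r + (p - q)) + (mu + g + w2) * P r + E * P (p - q)" for p q r
    using st21[of q "p - q" r] a2[of "r + (p - q)" r] a2[of "r + (p - q)" "p - q"]
    unfolding al' ep' et' w fk B_def C_def E_def by (simp add: algebra_simps)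
  have be2: "B * (P p + P q) - 2 * C * (P (r + (p - q)) + P (r + (q - p))) + 2 * D * P r
      + E * (P (p - q) + P (q - p)) = 0" for p q r
    using S_be[of p q r] as[of q r] unfolding S_def be' w D_def by (simp add: algebra_simps)
  have "B = 0"
    using be2[of 1 1 0] P0 P1 by simp
  have "D = 2 * C"
    using be2[of 0 0 1] P0 P1 by simp
  have "E * e - 2 * C * e = 0"
    using be2[of 1 0 0] P0 P1 \<open>B = 0\<close> by (simp add: e_def algebra_simps)
  moreover have "- 2 * C * 2 ^ N + 4 * C + E * e = 0"
    using be2[of 1 0 1] P0 P1 \<open>B = 0\<close> \<open>D = 2 * C\<close> by (simp add: e_def algebra_simps P_def)
  moreover have "2 * (C * (2 ^ N - 2 - e)) = (E * e - 2 * C * e) - (- 2 * C * 2 ^ N + 4 * C + E * e)"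
    by (simp add: algebra_simps)
  ultimately have "2 * (C * (2 ^ N - 2 - e)) = 0"
    by (simp only: diff_0_right)
  hence "C * (2 ^ N - 2 - e) = 0"
    by simp
  \<comment> \<open>This is the number \<open>2 ^ N - 3 - (-1) ^ N\<close>, which is zero for
    \<open>N = 1\<close> and \<open>N = 2\<close>. For \<open>N \<ge> 3\<close> the power is at
    least 8, whereas \<open>e\<close> is at most 2.\<close>
  moreover have "2 ^ N - 2 - e \<noteq> 0"
  proof -
    have "(2::rat) ^ 3 \<le> 2 ^ N" using N by (intro power_increasing) auto
    moreover have "e \<le> 2" by (cases "even N") (simp_all add: e_def P_def)
    ultimately show ?thesis by simp
  qed
  ultimately have "C = 0" by (simp del: diff_eq_eq)
  have k0: "k = 0"
    using \<open>C = 0\<close> by (simp add: C_def c1_def)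
  have w10: "w1 = 0"
    using \<open>B = 0\<close> k0 by (simp add: B_def)
  have g3: "g = 3 * w2"
    using gk k0 w10 by simp
  have mu4: "2 * mu = - 4 * w2"
    using \<open>D = 2 * C\<close> \<open>C = 0\<close> g3 by (simp add: D_def)
  have "w2 = 0"
    using E1 mu4 by (simp add: c1_def k0 g3)
  moreover have "mu = 0"
    using mu4 \<open>w2 = 0\<close> by simp
  ultimately have zero: "k = 0" "f = 0" "g = 0" "mu = 0" "w2 = 0" "w1 = 0" "c1 = 0" "B = 0" "C = 0" "E = 0"
    using k0 fk w10 g3 \<open>B = 0\<close> \<open>C = 0\<close> by (simp_all add: c1_def E_def)
  have a: "a y z = 0" for y z
    using a2[of y z] by (simp add: zero)
  show "al x y z = 0" "be x y z = 0" "ep x y = 0" "ze x y = 0" "et x y = 0" "ka x = 0"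
    by (simp_all add: al' be' ep' ze et' ka' w a zero)
  thus "ga x y z = 0"
    using bg[of x y z] by (simp add: a zero)
qed

section \<open>Words in the span of gsh\<close>

lemma polyfun_gap: "k < r \<Longrightarrow> polyfun r (\<lambda>xs. gap xs k)"
proof -
  assume "k < r"
  hence "polyfun r (\<lambda>xs. of_nat (xs ! k) - (if Suc k < r then of_nat (xs ! Suc k) else 0))"
    by (cases "Suc k < r") (auto intro!: polyfun_diff polyfun.coord polyfun.const)
  thus ?thesis
    by (rule polyfun.cong) (simp add: gap_def)
qed

lemma polyfun_gap_monom: "polyfun (length es) (gap_monom es)"
  unfolding gap_monom_def[abs_def] divide_inverse
  by (intro polyfun_prod polyfun.mult polyfun.const polyfun_power polyfun_gap) simp

lemma sum_gaps: "i < length xs \<Longrightarrow> (\<Sum>k\<in>{i..<length xs}. gap xs k) = of_nat (xs ! i)"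
proof (induction "length xs - i" arbitrary: i)
  case (Suc m)
  show ?case
  proof (cases "Suc i < length xs")
    case True
    have "(\<Sum>k\<in>{i..<length xs}. gap xs k) = gap xs i + (\<Sum>k\<in>{Suc i..<length xs}. gap xs k)"
      using Suc.prems by (rule sum.atLeast_Suc_lessThan)
    also have "(\<Sum>k\<in>{Suc i..<length xs}. gap xs k) = of_nat (xs ! Suc i)"
      using Suc True by (intro Suc.hyps) auto
    finally show ?thesis using True by (simp add: gap_def)
  next
    case False
    hence "{i..<length xs} = {i}" using Suc.prems by auto
    thus ?thesis using False by (simp add: gap_def)
  qed
qed simp

lemma monom_comb_sum: "(\<And>i. i \<in> I \<Longrightarrow> monom_comb c r (p i)) \<Longrightarrow> monom_comb c r (\<lambda>xs. \<Sum>i\<in>I. p i xs)"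
  by (induction I rule: infinite_finite_induct) (auto intro: monom_comb.zero monom_comb_add)

lemma polyfun_gap_comb:
  assumes "polyfun r p"
  shows "monom_comb gap r p"
proof (rule polyfun_monom_comb[OF assms])
  fix i assume "i < r"
  have "monom_comb gap r (\<lambda>xs. \<Sum>k\<in>{i..<r}. gap xs k)"
    by (intro monom_comb_sum monom_comb_coord) simp
  thus "monom_comb gap r (\<lambda>xs. of_nat (xs ! i))"
    by (rule monom_comb.cong) (use sum_gaps \<open>i < r\<close> in auto)
qed

section \<open>The span filtered by the number of indices, and its products\<close>

definition gspan :: "nat \<Rightarrow> rat fps set" where
  "gspan n = rat_fps.span {gsh ls | ls. (\<forall>l\<in>set ls. 1 \<le> l) \<and> length ls \<le> n}"

lemma gspan_mono: "m \<le> n \<Longrightarrow> gspan m \<subseteq> gspan n"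
  unfolding gspan_def by (rule rat_fps.span_mono) auto

lemmas gspan_add = rat_fps.span_add[of _ "{gsh ls | ls. (\<forall>l\<in>set ls. 1 \<le> l) \<and> length ls \<le> n}" for n, folded gspan_def]
lemmas gspan_scale = rat_fps.span_scale[of _ "{gsh ls | ls. (\<forall>l\<in>set ls. 1 \<le> l) \<and> length ls \<le> n}" for n, folded gspan_def]
lemmas gspan_zero = rat_fps.span_zero[of "{gsh ls | ls. (\<forall>l\<in>set ls. 1 \<le> l) \<and> length ls \<le> n}" for n, folded gspan_def]
lemmas gspan_sum = rat_fps.span_sum[of _ _ "{gsh ls | ls. (\<forall>l\<in>set ls. 1 \<le> l) \<and> length ls \<le> n}" for n, folded gspan_def]
lemmas gspan_diff = rat_fps.span_diff[of _ "{gsh ls | ls. (\<forall>l\<in>set ls. 1 \<le> l) \<and> length ls \<le> n}" for n, folded gspan_def]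

lemma gspan_sum_list: "(\<And>x. x \<in> set xs \<Longrightarrow> f x \<in> gspan n) \<Longrightarrow> (\<Sum>x\<leftarrow>xs. f x) \<in> gspan n"
  by (induction xs) (auto intro: gspan_zero gspan_add)

lemma gspan_base: "\<forall>l\<in>set ls. 1 \<le> l \<Longrightarrow> length ls \<le> n \<Longrightarrow> gsh ls \<in> gspan n"
  unfolding gspan_def by (rule rat_fps.span_base) auto

lemma sser_cong: "(\<And>xs. length xs = r \<Longrightarrow> p xs = q xs) \<Longrightarrow> sser r p = sser r q"
  unfolding sser_def
  by (intro sum.cong refl arg_cong2[where f = "(*)"] hser_cong) (auto simp: chains_def comps_def length_blocks)

lemma sser_add: "sser r (\<lambda>xs. p xs + q xs) = sser r p + sser r q"
  by (simp add: sser_def comp_def hser_add distrib_left sum.distrib)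

lemma sser_cmult: "sser r (\<lambda>xs. c * p xs) = fps_const c * sser r p"
  by (simp add: sser_def comp_def hser_cmult sum_distrib_left mult_ac)

lemma sser_gap_monom_in_gspan:
  assumes "r > 0" "length es = r"
  shows "sser r (gap_monom es) \<in> gspan r"
proof -
  have "gsh (map Suc es) = sser r (gap_monom es)"
    using assms by (subst gsh_eq_sser) (auto simp: comp_def)
  thus ?thesis
    using gspan_base[of "map Suc es" r] assms by simp
qed

text \<open>The entries are sums of increments, so a polynomial in the entries is a combination of
  monomials in the increments, and those give \<open>gsh\<close> up to factorials.\<close>

lemma sser_polyfun_in_gspan:
  assumes "polyfun r p" "r > 0"
  shows "sser r p \<in> gspan r"
  using polyfun_gap_comb[OF assms(1)]
proof induction
  case zero
  thus ?case using sser_cmult[of r 0 "\<lambda>_. 0"] by (simp add: gspan_zero)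
next
  case (add_monom p k e)
  define es where "es = map e [0..<r]"
  have "(\<Prod>i<r. gap xs i ^ e i) = (\<Prod>i<r. fact (e i)) * gap_monom es xs" for xs
    by (simp add: gap_monom_def es_def prod_dividef)
  hence "sser r (\<lambda>xs. k * (\<Prod>i<r. gap xs i ^ e i) + p xs) =
      fps_const (k * (\<Prod>i<r. fact (e i))) * sser r (gap_monom es) + sser r p"
    by (simp add: sser_add mult.assoc[symmetric] sser_cmult)
  thus ?case
    using add_monom.IH assms(2) by (auto intro!: gspan_add gspan_scale sser_gap_monom_in_gspan simp: es_def)
next
  case (cong p q)
  thus ?case using sser_cong[of r p q] by simp
qed

lemma hser_1_eq_sser: "hser [1] p = sser 1 p"
proof -
  have "comps 1 = {[1]}"
    by (subst comps_rec) (auto simp: comps_0)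
  moreover have "hser [1] p = hser [1] (p \<circ> blocks [1])"
    by (rule hser_cong) (auto simp: chains_def blocks_def length_Suc_conv)
  ultimately show ?thesis
    by (simp add: sser_def weight_def)
qed

text \<open>On generators this is \<open>sser_shuffle\<close>, since deleting an entry keeps a
  weight polynomial; the empty index list is the unit. Powers of \<open>u * of_nat (hd xs)\<close>
  are the factors that a binomial expansion of \<open>(u * a + l) ^ N\<close> produces.\<close>

lemma gspan_mult:
  assumes "F \<in> gspan n"
  shows "hser [1] (\<lambda>xs. (u * of_nat (hd xs)) ^ i) * F \<in> gspan (Suc n)"
  using assms unfolding gspan_def[of n]
proof (induction rule: rat_fps.span_induct_alt)
  case base
  show ?case by (simp add: gspan_zero)
next
  case (step c x y)
  then obtain ls where ls: "x = gsh ls" "length ls \<le> n" by auto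
  define r where "r = length ls"
  have "hser [1] (\<lambda>xs. (u * of_nat (hd xs)) ^ i) * x \<in> gspan (Suc r)"
  proof (cases "ls = []")
    case True
    have "hser [1] (\<lambda>xs. (u * of_nat (hd xs)) ^ i) = sser 1 (\<lambda>xs. (u * of_nat (xs ! 0)) ^ i)"
      unfolding hser_1_eq_sser by (rule sser_cong) (auto simp: length_Suc_conv)
    moreover have "\<dots> \<in> gspan 1"
      by (intro sser_polyfun_in_gspan polyfun_power polyfun.mult polyfun.const polyfun.coord) auto
    ultimately show ?thesis
      using True ls by (simp add: gsh_def r_def)
  next
    case False
    define es where "es = map (\<lambda>k. k - 1) ls"
    have x: "x = sser r (gap_monom es)" and es: "length es = r"
      using False by (simp_all add: ls gsh_eq_sser r_def es_def)
    have "sser (Suc r) (insert_at j (\<lambda>a xs. (u * of_nat a) ^ i * gap_monom es xs)) \<in> gspan (Suc r)" if "j \<le> r" for j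
    proof (intro sser_polyfun_in_gspan)
      have "polyfun (Suc r) (\<lambda>xs. gap_monom es (take j xs @ drop (Suc j) xs))"
      proof (rule polyfun_subst[where r = r])
        show "polyfun r (gap_monom es)" using polyfun_gap_monom[of es] es by simp
        fix k assume "k < r"
        have "polyfun (Suc r) (\<lambda>xs. of_nat (xs ! (if k < j then k else Suc k)))"
          using \<open>k < r\<close> by (intro polyfun.coord) auto
        thus "polyfun (Suc r) (\<lambda>xs. of_nat ((take j xs @ drop (Suc j) xs) ! k))"
          by (rule polyfun.cong) (use that in \<open>auto simp: nth_append\<close>)
      qed (use that in auto)
      thus "polyfun (Suc r) (insert_at j (\<lambda>a xs. (u * of_nat a) ^ i * gap_monom es xs))"
        unfolding insert_at_def using that
        by (intro polyfun.mult polyfun_power polyfun.const polyfun.coord) auto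
    qed simp
    thus ?thesis
      unfolding x using sser_shuffle[of "\<lambda>a. (u * of_nat a) ^ i" r "gap_monom es"]
      by (auto intro!: gspan_sum)
  qed
  hence "hser [1] (\<lambda>xs. (u * of_nat (hd xs)) ^ i) * x \<in> gspan (Suc n)"
    using gspan_mono[of "Suc r" "Suc n"] ls by (auto simp: r_def)
  moreover have "hser [1] (\<lambda>xs. (u * of_nat (hd xs)) ^ i) * (fps_const c * x + y) =
      fps_const c * (hser [1] (\<lambda>xs. (u * of_nat (hd xs)) ^ i) * x) + hser [1] (\<lambda>xs. (u * of_nat (hd xs)) ^ i) * y"
    by (simp add: algebra_simps)
  ultimately show ?case
    using step.IH by (auto intro: gspan_add gspan_scale)
qed

section \<open>Expansions of products modulo lower degree\<close>

definition words_spanned :: "nat \<Rightarrow> bool" where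
  "words_spanned n \<longleftrightarrow> (\<forall>w p. w \<noteq> [] \<and> (\<forall>i\<in>set w. 1 \<le> i) \<and> sum_list w \<le> n \<and> polyfun (length w) p \<longrightarrow> hser w p \<in> gspan n)"

text \<open>Zeros are summed out one at a time: each step shortens the word, keeps its degree, and
  keeps the weight polynomial on chains.\<close>

lemma words_spanned_with_zeros:
  assumes "words_spanned n" "w \<noteq> []" "1 \<le> hd w" "sum_list w \<le> n" "polyfun_on_chains (length w) p"
  shows "hser w p \<in> gspan n"
  using assms(2-)
proof (induction "length w" arbitrary: w p)
  case (Suc r)
  show ?case
  proof (cases "0 \<in> set w")
    case False
    obtain q where q: "polyfun (length w) q" "\<And>xs. xs \<in> chains (length w) \<Longrightarrow> p xs = q xs"
      using Suc.prems by (auto simp: polyfun_on_chains_def)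
    have "\<forall>i\<in>set w. 1 \<le> i"
      using False by (metis less_one linorder_not_le)
    hence "hser w q \<in> gspan n"
      using assms(1) Suc.prems q by (auto simp: words_spanned_def)
    thus ?thesis using hser_cong[of w p q] q by simp
  next
    case True
    then obtain v v' where w: "w = v @ 0 # v'" by (metis split_list)
    with Suc.prems have "v \<noteq> []" by auto
    have "hser (v @ v') (sum_out (length v) p) \<in> gspan n"
    proof (rule Suc.hyps(1))
      show "polyfun_on_chains (length (v @ v')) (sum_out (length v) p)"
        using Suc.prems \<open>v \<noteq> []\<close> by (intro polyfun_on_chains_sum_out) (auto simp: w)
    qed (use Suc w \<open>v \<noteq> []\<close> in auto)
    thus ?thesis
      by (simp add: w hser_zero_exponent \<open>v \<noteq> []\<close>)
  qed
qed simp

lemma polyfun_on_chainsI: "polyfun r p \<Longrightarrow> polyfun_on_chains r p"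
  by (auto simp: polyfun_on_chains_def)

lemma polyfun_on_chains_cong:
  "polyfun_on_chains r p \<Longrightarrow> (\<And>xs. xs \<in> chains r \<Longrightarrow> p xs = q xs) \<Longrightarrow> polyfun_on_chains r q"
  by (auto simp: polyfun_on_chains_def)

lemma polyfun_on_chains_add:
  "polyfun_on_chains r p \<Longrightarrow> polyfun_on_chains r q \<Longrightarrow> polyfun_on_chains r (\<lambda>xs. p xs + q xs)"
  unfolding polyfun_on_chains_def by (metis (no_types, lifting) polyfun.add)

lemma polyfun_on_chains_mult:
  "polyfun_on_chains r p \<Longrightarrow> polyfun_on_chains r q \<Longrightarrow> polyfun_on_chains r (\<lambda>xs. p xs * q xs)"
  unfolding polyfun_on_chains_def by (metis (no_types, lifting) polyfun.mult)

lemma polyfun_on_chains_const: "polyfun_on_chains r (\<lambda>_. c)"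
  by (intro polyfun_on_chainsI polyfun.const)

lemma polyfun_on_chains_power: "polyfun_on_chains r p \<Longrightarrow> polyfun_on_chains r (\<lambda>xs. p xs ^ n)"
  by (induction n) (auto intro: polyfun_on_chains_const polyfun_on_chains_mult)

lemma polyfun_on_chains_diff:
  "polyfun_on_chains r p \<Longrightarrow> polyfun_on_chains r q \<Longrightarrow> polyfun_on_chains r (\<lambda>xs. p xs - q xs)"
  unfolding polyfun_on_chains_def by (metis (no_types, lifting) polyfun_diff)

lemma polyfun_on_chains_tl:
  assumes "polyfun_on_chains r p"
  shows "polyfun_on_chains (Suc r) (\<lambda>xs. p (tl xs))"
proof -
  obtain q where q: "polyfun r q" "\<And>xs. xs \<in> chains r \<Longrightarrow> p xs = q xs"
    using assms by (auto simp: polyfun_on_chains_def)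
  have "polyfun (Suc r) (\<lambda>xs. q (tl xs))"
  proof (rule polyfun_subst[OF q(1)])
    fix i assume "i < r"
    have "polyfun (Suc r) (\<lambda>xs. of_nat (xs ! Suc i))"
      using \<open>i < r\<close> by (intro polyfun.coord) simp
    thus "polyfun (Suc r) (\<lambda>xs. of_nat (tl xs ! i))"
      by (rule polyfun.cong) (use \<open>i < r\<close> in \<open>simp add: nth_tl\<close>)
  qed simp
  moreover have "tl xs \<in> chains r" if "xs \<in> chains (Suc r)" for xs
    using that by (cases xs) (auto simp: chains_def)
  ultimately show ?thesis
    using q(2) by (auto simp: polyfun_on_chains_def)
qed

text \<open>The conditions make weights pulled back along \<open>g\<close> polynomial on chains. The
  bound by \<open>hd xs\<close> makes the subtraction \<open>hd xs - a\<close> in the recursion of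
  \<open>pf_lower\<close> a genuine one.\<close>

definition good_splitting :: "nat \<Rightarrow> nat list \<times> (nat list \<Rightarrow> nat \<times> nat list) \<Rightarrow> bool" where
  "good_splitting r = (\<lambda>(w, g). w \<noteq> [] \<and> 1 \<le> hd w \<and> polyfun_on_chains (length w) (\<lambda>xs. of_nat (fst (g xs))) \<and>
     (\<forall>i<r. polyfun_on_chains (length w) (\<lambda>xs. of_nat (snd (g xs) ! i))) \<and>
     (\<forall>xs\<in>chains (length w). length (snd (g xs)) = r \<and> fst (g xs) \<le> hd xs))"

lemma good_pf_lower:
  assumes "\<forall>n\<in>set ns. 1 \<le> n" "(w, g) \<in> set (pf_lower ns)"
  shows "good_splitting (length ns) (w, g) \<and> sum_list w = sum_list ns"
  using assms
proof (induction ns arbitrary: w g)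
  case (Cons n ns)
  from Cons.prems(2) consider
      (top) i where "i < n" "w = Suc i # (n - i - 1) # ns" "g = (\<lambda>xs. (xs ! 0 - xs ! 1, tl xs))"
    | (rest) w' g' where "(w', g') \<in> set (pf_lower ns)" "w = n # w'"
        "g = (\<lambda>xs. case g' (tl xs) of (a, ds) \<Rightarrow> (a, (hd xs - a) # ds))"
    by auto
  thus ?case
  proof cases
    case top
    have "polyfun_on_chains (Suc (Suc (length ns))) (\<lambda>xs. of_nat (xs ! 0) - of_nat (xs ! 1))"
      by (intro polyfun_on_chainsI polyfun_diff polyfun.coord) auto
    hence "polyfun_on_chains (Suc (Suc (length ns))) (\<lambda>xs. of_nat (xs ! 0 - xs ! 1))"
    proof (rule polyfun_on_chains_cong)
      fix xs assume "xs \<in> chains (Suc (Suc (length ns)))"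
      then obtain x y ys where "xs = x # y # ys" "y < x"
        by (auto simp: chains_def length_Suc_conv)
      thus "of_nat (xs ! 0) - of_nat (xs ! 1) = (of_nat (xs ! 0 - xs ! 1) :: rat)"
        by (simp add: of_nat_diff)
    qed
    moreover have "polyfun_on_chains (Suc (Suc (length ns))) (\<lambda>xs. of_nat (tl xs ! i))" if "i < Suc (length ns)" for i
      using that by (intro polyfun_on_chains_tl polyfun_on_chainsI polyfun.coord) auto
    moreover have "xs ! 0 - xs ! 1 \<le> hd xs" if "xs \<in> chains (Suc (Suc (length ns)))" for xs
      using that by (cases xs) (auto simp: chains_def)
    ultimately show ?thesis
      using top by (auto simp: good_splitting_def chains_def)
  next
    case rest
    have IH: "good_splitting (length ns) (w', g')" "sum_list w' = sum_list ns"
      using Cons.IH[OF _ rest(1)] Cons.prems by auto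
    define s where "s = length w'"
    have "s > 0" using IH by (simp add: good_splitting_def s_def)
    have le: "fst (g' (tl xs)) \<le> hd xs" and len: "length (snd (g' (tl xs))) = length ns" if "xs \<in> chains (Suc s)" for xs
    proof -
      from that \<open>s > 0\<close> obtain x y ys where xs: "xs = x # y # ys" "y < x" "y # ys \<in> chains s"
        by (cases xs; cases "tl xs") (auto simp: chains_def)
      thus "fst (g' (tl xs)) \<le> hd xs" "length (snd (g' (tl xs))) = length ns"
        using IH(1) by (auto simp: good_splitting_def s_def)
    qed
    have fst: "polyfun_on_chains (Suc s) (\<lambda>xs. of_nat (fst (g' (tl xs))))"
      using IH(1) by (intro polyfun_on_chains_tl) (simp add: good_splitting_def s_def)
    have snd: "polyfun_on_chains (Suc s) (\<lambda>xs. of_nat (snd (g' (tl xs)) ! i))" if "i < length ns" for i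
      using IH(1) that polyfun_on_chains_tl[of s "\<lambda>xs. of_nat (snd (g' xs) ! i)"] by (simp add: good_splitting_def s_def)
    have "polyfun_on_chains (Suc s) (\<lambda>xs. of_nat (xs ! 0) - of_nat (fst (g' (tl xs))))"
      by (intro polyfun_on_chains_diff fst polyfun_on_chainsI polyfun.coord) simp
    hence hd: "polyfun_on_chains (Suc s) (\<lambda>xs. of_nat (hd xs - fst (g' (tl xs))))"
    proof (rule polyfun_on_chains_cong)
      fix xs assume xs: "xs \<in> chains (Suc s)"
      hence "xs ! 0 = hd xs" by (cases xs) (auto simp: chains_def)
      thus "of_nat (xs ! 0) - of_nat (fst (g' (tl xs))) = (of_nat (hd xs - fst (g' (tl xs))) :: rat)"
        using le[OF xs] by (simp add: of_nat_diff)
    qed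
    have "polyfun_on_chains (Suc s) (\<lambda>xs. of_nat (((hd xs - fst (g' (tl xs))) # snd (g' (tl xs))) ! i))"
      if "i < Suc (length ns)" for i
      using that hd snd by (cases i) auto
    thus ?thesis
      using rest fst le len IH(2) Cons.prems(1) by (auto simp: good_splitting_def s_def case_prod_unfold)
  qed
qed simp

lemma polyfun_good_splitting:
  assumes "good_splitting r (w, g)" "polyfun r l"
  shows "polyfun_on_chains (length w) (\<lambda>xs. l (snd (g xs)))"
  using assms(2)
proof induction
  case (cong p q)
  show ?case
    by (rule polyfun_on_chains_cong[OF cong.IH]) (use assms(1) cong.hyps in \<open>auto simp: good_splitting_def\<close>)
qed (use assms(1) in \<open>auto simp: good_splitting_def intro: polyfun_on_chains_const polyfun_on_chains_add polyfun_on_chains_mult\<close>)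

lemma tser_append: "tser (S @ T) P = tser S P + tser T P"
  by (simp add: tser_def)

lemma tser_sum_scaled:
  "tser T (\<lambda>x. \<Sum>i\<in>I. c i * P i x) = (\<Sum>i\<in>I. fps_const (c i) * tser T (P i))"
  unfolding tser_def
proof (induction T)
  case (Cons wg T)
  thus ?case
    by (cases wg) (simp add: comp_def hser_sum hser_cmult sum.distrib distrib_left)
qed simp

text \<open>The power is not of the product form \<open>q a * p ds\<close>, but its binomial
  expansion is a combination of such weights.\<close>

lemma tser_power:
  assumes "\<And>q p. hser [1] (\<lambda>xs. q (hd xs)) * hser ns p = tser T (\<lambda>(a, ds). q a * p ds)"
  shows "tser T (\<lambda>(a, ds). (u * of_nat a + l ds) ^ N) = (\<Sum>i\<le>N. fps_const (of_nat (N choose i)) *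
      (hser [1] (\<lambda>xs. (u * of_nat (hd xs)) ^ i) * hser ns (\<lambda>ds. l ds ^ (N - i))))"
proof -
  have "tser T (\<lambda>(a, ds). (u * of_nat a + l ds) ^ N) =
      tser T (\<lambda>x. \<Sum>i\<le>N. of_nat (N choose i) * (case x of (a, ds) \<Rightarrow> (u * of_nat a) ^ i * l ds ^ (N - i)))"
    by (simp add: binomial_ring mult.assoc case_prod_unfold)
  also have "\<dots> = (\<Sum>i\<le>N. fps_const (of_nat (N choose i)) *
      (hser [1] (\<lambda>xs. (u * of_nat (hd xs)) ^ i) * hser ns (\<lambda>ds. l ds ^ (N - i))))"
    unfolding tser_sum_scaled
    by (intro sum.cong refl arg_cong[where f = "(*) _"]
        assms[of "\<lambda>a. (u * of_nat a) ^ i" "\<lambda>ds. l ds ^ (N - i)" for i, symmetric])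
  finally show ?thesis .
qed

context
  fixes n :: nat and ns :: "nat list" and l :: "nat list \<Rightarrow> rat"
  assumes spanned: "words_spanned n" and ns: "ns \<noteq> []" "\<forall>i\<in>set ns. 1 \<le> i" "sum_list ns \<le> n"
    and l: "polyfun (length ns) l"
begin

lemma product_in_gspan:
  assumes "\<And>q p. hser [1] (\<lambda>xs. q (hd xs)) * hser ns p = tser T (\<lambda>(a, ds). q a * p ds)"
  shows "tser T (\<lambda>(a, ds). (u * of_nat a + l ds) ^ N) \<in> gspan (Suc n)"
  unfolding tser_power[OF assms]
  using spanned ns l by (intro gspan_sum gspan_scale gspan_mult) (auto simp: words_spanned_def intro: polyfun_power)

lemma stuffle_in_gspan: "tser (stuffle ns) (\<lambda>(a, ds). (u * of_nat a + l ds) ^ N) \<in> gspan (Suc n)"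
  by (rule product_in_gspan, rule hser_stuffle) (use ns in \<open>auto simp: neq_Nil_conv\<close>)

text \<open>The words in \<open>pf_lower\<close> have the degree of \<open>ns\<close>, one less than
  the product. Their sums already lie in \<open>gspan n\<close> and can be subtracted.\<close>

lemma pf_main_in_gspan: "tser (pf_main ns) (\<lambda>(a, ds). (u * of_nat a + l ds) ^ N) \<in> gspan (Suc n)"
proof -
  have "tser (pf_main ns @ pf_lower ns) (\<lambda>(a, ds). (u * of_nat a + l ds) ^ N) \<in> gspan (Suc n)"
    by (rule product_in_gspan, rule hser_partial_fractions) (rule ns(2))
  moreover have "tser (pf_lower ns) (\<lambda>(a, ds). (u * of_nat a + l ds) ^ N) \<in> gspan (Suc n)"
    unfolding tser_def
  proof (intro gspan_sum_list)
    fix x assume x: "x \<in> set (pf_lower ns)"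
    obtain w g where [simp]: "x = (w, g)" by (cases x)
    have good: "good_splitting (length ns) (w, g)" "sum_list w = sum_list ns"
      using good_pf_lower[of ns w g] ns x by auto
    have "hser w (\<lambda>xs. (u * of_nat (fst (g xs)) + l (snd (g xs))) ^ N) \<in> gspan n"
      using good ns
      by (intro words_spanned_with_zeros spanned polyfun_on_chains_power polyfun_on_chains_add
          polyfun_on_chains_mult polyfun_on_chains_const polyfun_good_splitting[OF good(1) l])
        (auto simp: good_splitting_def)
    moreover have "gspan n \<subseteq> gspan (Suc n)" by (rule gspan_mono) simp
    ultimately show "(case x of (w, g) \<Rightarrow> hser w ((\<lambda>(a, ds). (u * of_nat a + l ds) ^ N) \<circ> g)) \<in> gspan (Suc n)"
      by (auto simp: comp_def case_prod_unfold)
  qed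
  ultimately show ?thesis
    unfolding tser_append using gspan_diff by fastforce
qed

end

section \<open>Linear functionals and powers of linear forms\<close>

definition rat_functional :: "(rat fps \<Rightarrow> rat) \<Rightarrow> bool" where
  "rat_functional f \<longleftrightarrow> (\<forall>x y. f (x + y) = f x + f y) \<and> (\<forall>c x. f (fps_const c * x) = c * f x)"

text \<open>A basis of the span stays independent when \<open>x\<close> is added; prescribe 1 at
  \<open>x\<close> and 0 on the basis, and extend linearly.\<close>

lemma separating_functional:
  assumes "x \<notin> rat_fps.span S"
  obtains f where "rat_functional f" "\<And>y. y \<in> rat_fps.span S \<Longrightarrow> f y = 0" "f x \<noteq> 0"
proof -
  interpret rat_pair: vector_space_pair "\<lambda>c (y :: rat fps). fps_const c * y" "(*) :: rat \<Rightarrow> rat \<Rightarrow> rat"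
    by unfold_locales (simp_all add: algebra_simps)
  obtain B where B: "B \<subseteq> S" "rat_fps.independent B" "S \<subseteq> rat_fps.span B"
    using rat_fps.maximal_independent_subset[of S] by blast
  have "rat_fps.span S = rat_fps.span B"
    using B by (metis rat_fps.span_eq rat_fps.span_superset subset_trans)
  hence "x \<notin> rat_fps.span B" using assms by simp
  hence "rat_fps.independent (insert x B)"
    using B rat_fps.independent_insertI by blast
  then obtain f where f: "Vector_Spaces.linear (\<lambda>c (y :: rat fps). fps_const c * y) (*) f" "\<forall>y\<in>insert x B. f y = (if y = x then 1 else 0)"
    using rat_pair.linear_independent_extend[of "insert x B" "\<lambda>y. if y = x then 1 else 0"] by blast
  have "f y = 0" if "y \<in> rat_fps.span B" for y
  proof (rule rat_pair.linear_eq_0_on_span[OF f(1) _ that])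
    fix b assume "b \<in> B"
    moreover have "b \<noteq> x" using \<open>x \<notin> rat_fps.span B\<close> \<open>b \<in> B\<close> rat_fps.span_base by blast
    ultimately show "f b = 0" using f(2) by simp
  qed
  moreover have "f (a + b) = f a + f b" "f (fps_const c * a) = c * f a" for a b c
    using rat_pair.linear_add[OF f(1)] rat_pair.linear_scale[OF f(1)] by blast+
  ultimately show ?thesis
    using f(2) \<open>rat_fps.span S = rat_fps.span B\<close> by (intro that[of f]) (auto simp: rat_functional_def)
qed

lemma coefficients_zero:
  fixes c :: "nat \<Rightarrow> rat"
  assumes "\<And>t. (\<Sum>i\<le>N. c i * t ^ i) = 0" "i \<le> N"
  shows "c i = 0"
proof -
  have "poly (\<Sum>i\<le>N. monom (c i) i) t = 0" for t
    using assms(1)[of t] by (simp add: poly_sum poly_monom)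
  hence "(\<Sum>i\<le>N. monom (c i) i) = 0"
    using poly_all_0_iff_0 by blast
  hence "coeff (\<Sum>i\<le>N. monom (c i) i) i = 0"
    by simp
  thus ?thesis
    using assms(2) by (simp add: coeff_sum)
qed

text \<open>With the last coefficient replaced by a variable \<open>t\<close>, the hypothesis is a
  polynomial identity in \<open>t\<close>. Its coefficient at \<open>t ^ e r\<close> splits off
  \<open>g x r ^ e r\<close>, which is absorbed into \<open>q\<close>, and the induction goes on
  with one form less.\<close>

lemma polarization:
  fixes \<Phi> :: "('x \<Rightarrow> rat) \<Rightarrow> rat" and g :: "'x \<Rightarrow> nat \<Rightarrow> rat"
  assumes add: "\<And>p q. \<Phi> (\<lambda>x. p x + q x) = \<Phi> p + \<Phi> q"
    and cmult: "\<And>c p. \<Phi> (\<lambda>x. c * p x) = c * \<Phi> p"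
    and zero: "\<And>z. \<Phi> (\<lambda>x. q x * (\<Sum>k<r. z k * g x k) ^ N) = 0"
    and e: "(\<Sum>k<r. e k) = N"
  shows "\<Phi> (\<lambda>x. q x * (\<Prod>k<r. g x k ^ e k)) = 0"
  using zero e
proof (induction r arbitrary: N q)
  case (Suc r)
  have sum: "\<Phi> (\<lambda>x. \<Sum>i\<in>I. p i x) = (\<Sum>i\<in>I. \<Phi> (p i))" if "finite I" for I :: "nat set" and p
    using that cmult[of 0 "\<lambda>_. 0"] by (induction I) (simp_all add: add)
  have "\<Phi> (\<lambda>x. (q x * g x r ^ e r) * (\<Sum>k<r. z k * g x k) ^ (N - e r)) = 0" for z
  proof -
    define c where "c i = of_nat (N choose i) * \<Phi> (\<lambda>x. (q x * g x r ^ i) * (\<Sum>k<r. z k * g x k) ^ (N - i))" for i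
    have "(\<Sum>i\<le>N. c i * t ^ i) = 0" for t
    proof -
      have "(\<Sum>i\<le>N. c i * t ^ i) =
          \<Phi> (\<lambda>x. \<Sum>i\<le>N. (of_nat (N choose i) * t ^ i) * ((q x * g x r ^ i) * (\<Sum>k<r. z k * g x k) ^ (N - i)))"
        by (simp only: sum[OF finite_atMost] cmult c_def) (simp add: mult_ac)
      also have "\<dots> = \<Phi> (\<lambda>x. q x * (t * g x r + (\<Sum>k<r. z k * g x k)) ^ N)"
        by (simp add: binomial_ring power_mult_distrib sum_distrib_left mult_ac)
      also have "\<dots> = \<Phi> (\<lambda>x. q x * (\<Sum>k<Suc r. (z(r := t)) k * g x k) ^ N)"
        by (simp add: add.commute)
      also have "\<dots> = 0"
        by (rule Suc.prems)
      finally show ?thesis .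
    qed
    moreover have "e r \<le> N" using Suc.prems by simp
    ultimately have "c (e r) = 0"
      by (rule coefficients_zero)
    thus ?thesis using \<open>e r \<le> N\<close> by (simp add: c_def)
  qed
  moreover have "(\<Sum>k<r. e k) = N - e r"
    using Suc.prems by simp
  ultimately have "\<Phi> (\<lambda>x. (q x * g x r ^ e r) * (\<Prod>k<r. g x k ^ e k)) = 0"
    by (rule Suc.IH)
  thus ?case by (simp add: mult_ac)
qed simp

text \<open>In contrast to the functional equations, \<open>zs\<close> begins with the coefficient of the top increment.\<close>

definition zform :: "rat list \<Rightarrow> nat list \<Rightarrow> rat" where
  "zform zs xs = (\<Sum>k<length zs. zs ! k * gap xs k)"

lemma polyfun_zform: "polyfun (length zs) (zform zs)"
  unfolding zform_def[abs_def] by (intro polyfun_sum polyfun.mult polyfun.const polyfun_gap) simp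

lemma sum_comps_2: "(\<Sum>w\<in>comps 2. F w) = F [1, 1] + F [2]"
  by (simp add: sum_comps_rec comps_0 numeral_eq_Suc)

lemma sum_comps_3: "(\<Sum>w\<in>comps 3. F w) = F [1, 1, 1] + F [1, 2] + F [2, 1] + F [3]"
  by (simp add: sum_comps_rec comps_0 numeral_eq_Suc add_ac)

lemma sum_comps_4: "(\<Sum>w\<in>comps 4. F w) = F [1, 1, 1, 1] + F [1, 1, 2] + F [1, 2, 1] + F [1, 3] +
    F [2, 1, 1] + F [2, 2] + F [3, 1] + F [4]"
  by (simp add: sum_comps_rec comps_0 numeral_eq_Suc add_ac)

definition fval :: "(rat fps \<Rightarrow> rat) \<Rightarrow> nat \<Rightarrow> nat list \<Rightarrow> rat list \<Rightarrow> rat" where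
  "fval f N w zs = f (hser w (\<lambda>xs. zform zs xs ^ N))"

lemma rat_functional_sum:
  assumes "rat_functional f"
  shows "f 0 = 0" "f (\<Sum>i\<in>I. x i) = (\<Sum>i\<in>I. f (x i))" "f (\<Sum>i\<leftarrow>js. y i) = (\<Sum>i\<leftarrow>js. f (y i))"
proof -
  have add: "f (a + b) = f a + f b" for a b
    using assms by (simp add: rat_functional_def)
  from add[of 0 0] show 0: "f 0 = 0" by simp
  show "f (\<Sum>i\<in>I. x i) = (\<Sum>i\<in>I. f (x i))"
    by (induction I rule: infinite_finite_induct) (simp_all add: 0 add)
  show "f (\<Sum>i\<leftarrow>js. y i) = (\<Sum>i\<leftarrow>js. f (y i))"
    by (induction js) (simp_all add: 0 add)
qed

text \<open>In the increments, the linear form pulled back along each decoding map is again a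
  \<open>zform\<close>; \<open>W\<close> lists its coefficients. This turns every relation below
  into a finite check.\<close>

definition expands :: "rat \<Rightarrow> (nat list \<Rightarrow> rat) \<Rightarrow> splitting list \<Rightarrow> (nat list \<times> rat list) list \<Rightarrow> bool" where
  "expands u l = list_all2 (\<lambda>(w, g) (w', zs). w = w' \<and>
      (\<forall>xs\<in>chains (length w). u * of_nat (fst (g xs)) + l (snd (g xs)) = zform zs xs))"

lemma fval_tser:
  assumes "rat_functional f" and "expands u l T W"
  shows "f (tser T (\<lambda>(a, ds). (u * of_nat a + l ds) ^ N)) = (\<Sum>(w, zs)\<leftarrow>W. fval f N w zs)"
  using assms(2) unfolding expands_def
proof (induction T W rule: list_all2_induct)
  case Nil
  thus ?case by (simp add: tser_def rat_functional_sum[OF assms(1)])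
next
  case (Cons x T y W)
  obtain w g zs where [simp]: "x = (w, g)" "y = (w, zs)"
    using Cons.hyps(1) by (cases x; cases y) auto
  have "hser w ((\<lambda>(a, ds). (u * of_nat a + l ds) ^ N) \<circ> g) = hser w (\<lambda>xs. zform zs xs ^ N)"
    by (rule hser_cong) (use Cons.hyps(1) in \<open>auto simp: case_prod_unfold\<close>)
  thus ?case
    using Cons.IH assms(1) by (simp add: tser_def fval_def rat_functional_def)
qed

lemma fval_sser:
  assumes f: "rat_functional f"
    and W: "(\<Sum>w\<in>comps r. fps_const (weight w) * hser w ((\<lambda>xs. zform zs xs ^ N) \<circ> blocks w)) =
      (\<Sum>(c, w, ys)\<leftarrow>W. fps_const c * hser w ((\<lambda>xs. zform zs xs ^ N) \<circ> blocks w))"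
    and eq: "list_all (\<lambda>(c, w, ys). \<forall>xs\<in>chains (length w). zform zs (blocks w xs) = zform ys xs) W"
  shows "f (sser r (\<lambda>xs. zform zs xs ^ N)) = (\<Sum>(c, w, ys)\<leftarrow>W. c * fval f N w ys)"
proof -
  have "f (sser r (\<lambda>xs. zform zs xs ^ N)) =
      (\<Sum>(c, w, ys)\<leftarrow>W. f (fps_const c * hser w ((\<lambda>xs. zform zs xs ^ N) \<circ> blocks w)))"
    unfolding sser_def W rat_functional_sum(3)[OF f] by (simp add: case_prod_unfold)
  also have "\<dots> = (\<Sum>(c, w, ys)\<leftarrow>W. c * fval f N w ys)"
  proof (intro arg_cong[where f = sum_list] map_cong refl)
    fix x assume x: "x \<in> set W"
    obtain c w ys where [simp]: "x = (c, w, ys)" by (cases x)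
    have "hser w ((\<lambda>xs. zform zs xs ^ N) \<circ> blocks w) = hser w (\<lambda>xs. zform ys xs ^ N)"
      using eq x by (intro hser_cong) (auto simp: list_all_iff)
    thus "(case x of (c, w, ys) \<Rightarrow> f (fps_const c * hser w ((\<lambda>xs. zform zs xs ^ N) \<circ> blocks w))) =
        (case x of (c, w, ys) \<Rightarrow> c * fval f N w ys)"
      using f by (simp add: fval_def rat_functional_def)
  qed
  finally show ?thesis .
qed

lemma word_in_comps:
  fixes w :: "nat list"
  assumes "\<forall>i\<in>set w. 1 \<le> i"
  shows "w \<in> comps (sum_list w)"
  using assms by (auto simp: comps_def)

text \<open>A monomial outside the span would be detected by a functional vanishing on the span; as
  this functional kills all powers of linear forms, polarization makes it kill the monomial
  too.\<close>

lemma spanned_from_powers: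
  assumes zero: "\<And>f zs. rat_functional f \<Longrightarrow> (\<And>x. x \<in> gspan n \<Longrightarrow> f x = 0) \<Longrightarrow> length zs = length w \<Longrightarrow>
      fval f (\<Sum>k<length w. e k) w zs = 0"
  shows "hser w (\<lambda>xs. \<Prod>k<length w. gap xs k ^ e k) \<in> gspan n"
proof (rule ccontr)
  assume "hser w (\<lambda>xs. \<Prod>k<length w. gap xs k ^ e k) \<notin> gspan n"
  then obtain f where f: "rat_functional f" "\<And>x. x \<in> gspan n \<Longrightarrow> f x = 0"
      "f (hser w (\<lambda>xs. \<Prod>k<length w. gap xs k ^ e k)) \<noteq> 0"
    unfolding gspan_def by (elim separating_functional) blast
  have "f (hser w (\<lambda>xs. 1 * (\<Sum>k<length w. z k * gap xs k) ^ (\<Sum>k<length w. e k))) = 0" for z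
    using zero[OF f(1,2), of "map z [0..<length w]"] by (simp add: fval_def zform_def)
  hence "f (hser w (\<lambda>xs. 1 * (\<Prod>k<length w. gap xs k ^ e k))) = 0"
    using f(1) by (intro polarization[where \<Phi> = "\<lambda>p. f (hser w p)"])
      (auto simp: hser_add hser_cmult rat_functional_def)
  with f(3) show False by simp
qed

lemma words_spanned_SucI:
  assumes "words_spanned n"
    and zero: "\<And>f N w zs. rat_functional f \<Longrightarrow> (\<And>x. x \<in> gspan (Suc n) \<Longrightarrow> f x = 0) \<Longrightarrow>
      w \<in> comps (Suc n) \<Longrightarrow> length zs = length w \<Longrightarrow> fval f N w zs = 0"
  shows "words_spanned (Suc n)"
  unfolding words_spanned_def
proof safe
  fix w p
  assume w: "w \<noteq> []" "\<forall>i\<in>set w. 1 \<le> i" "sum_list w \<le> Suc n" and p: "polyfun (length w) p"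
  show "hser w p \<in> gspan (Suc n)"
  proof (cases "sum_list w \<le> n")
    case True
    hence "hser w p \<in> gspan n"
      using assms(1) w p by (auto simp: words_spanned_def)
    thus ?thesis using gspan_mono[of n "Suc n"] by auto
  next
    case False
    hence "sum_list w = Suc n" using w by simp
    hence "w \<in> comps (Suc n)" using word_in_comps[of w] w by simp
    from polyfun_gap_comb[OF p] show ?thesis
    proof induction
      case zero
      show ?case by (simp add: hser_zero gspan_zero)
    next
      case (add_monom p k e)
      have "hser w (\<lambda>xs. \<Prod>i<length w. gap xs i ^ e i) \<in> gspan (Suc n)"
        by (rule spanned_from_powers) (rule zero, assumption+, rule \<open>w \<in> comps (Suc n)\<close>)
      thus ?case
        using add_monom.IH by (auto simp: hser_add hser_cmult intro!: gspan_add gspan_scale)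
    next
      case (cong p q)
      have "hser w p = hser w q"
        by (rule hser_cong) (use cong.hyps in \<open>simp add: chains_def\<close>)
      thus ?case using cong.IH by simp
    qed
  qed
qed

lemma words_spanned_1: "words_spanned 1"
  unfolding words_spanned_def
proof safe
  fix w :: "nat list" and p
  assume w: "w \<noteq> []" "\<forall>i\<in>set w. 1 \<le> i" "sum_list w \<le> 1" and p: "polyfun (length w) p"
  then obtain i v where "w = i # v" "i \<ge> 1" by (cases w) auto
  with w have "w = [1]" by (cases v) auto
  thus "hser w p \<in> gspan 1"
    using p sser_polyfun_in_gspan[of 1 p] hser_1_eq_sser[of p] by simp
qed

context
  fixes f :: "rat fps \<Rightarrow> rat" and n N :: nat
  assumes f: "rat_functional f" and f0: "\<And>x. x \<in> gspan (Suc n) \<Longrightarrow> f x = 0"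
    and spanned: "words_spanned n"
begin

lemma stuffle_relation:
  assumes "ns \<noteq> []" "\<forall>i\<in>set ns. 1 \<le> i" "sum_list ns \<le> n" "length zs = length ns"
    and "expands u (zform zs) (stuffle ns) W"
  shows "(\<Sum>(w, ys)\<leftarrow>W. fval f N w ys) = 0"
  using fval_tser[OF f assms(5), of N] f0[OF stuffle_in_gspan[OF spanned assms(1-3), of "zform zs"]]
    polyfun_zform[of zs] assms(4) by simp

lemma pf_relation:
  assumes "ns \<noteq> []" "\<forall>i\<in>set ns. 1 \<le> i" "sum_list ns \<le> n" "length zs = length ns"
    and "expands u (zform zs) (pf_main ns) W"
  shows "(\<Sum>(w, ys)\<leftarrow>W. fval f N w ys) = 0"
  using fval_tser[OF f assms(5), of N] f0[OF pf_main_in_gspan[OF spanned assms(1-3), of "zform zs"]]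
    polyfun_zform[of zs] assms(4) by simp

lemma sser_relation:
  assumes "r = Suc n" "length zs = r"
    and "(\<Sum>w\<in>comps r. fps_const (weight w) * hser w ((\<lambda>xs. zform zs xs ^ N) \<circ> blocks w)) =
      (\<Sum>(c, w, ys)\<leftarrow>W. fps_const c * hser w ((\<lambda>xs. zform zs xs ^ N) \<circ> blocks w))"
    and "list_all (\<lambda>(c, w, ys). \<forall>xs\<in>chains (length w). zform zs (blocks w xs) = zform ys xs) W"
  shows "(\<Sum>(c, w, ys)\<leftarrow>W. c * fval f N w ys) = 0"
proof -
  have "sser r (\<lambda>xs. zform zs xs ^ N) \<in> gspan r"
    using assms(1,2) polyfun_zform[of zs] by (intro sser_polyfun_in_gspan polyfun_power) auto
  thus ?thesis
    using fval_sser[OF f assms(3,4)] f0 assms(1) by simp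
qed

end

section \<open>Degrees 2, 3 and 4\<close>

lemmas relation_simps = expands_def chains_def length_Suc_conv zform_def gap_def of_nat_diff algebra_simps
  weight_def blocks_def

lemma comps_2: "comps 2 = {[1, 1], [2]}"
  by (auto simp: comps_rec comps_0 numeral_eq_Suc atLeastAtMostSuc_conv)

lemma comps_3: "comps 3 = {[1, 1, 1], [1, 2], [2, 1], [3]}"
  by (auto simp: comps_rec comps_0 numeral_eq_Suc atLeastAtMostSuc_conv)

lemma comps_4: "comps 4 = {[1, 1, 1, 1], [1, 1, 2], [1, 2, 1], [1, 3], [2, 1, 1], [2, 2], [3, 1], [4]}"
  by (auto simp: comps_rec comps_0 numeral_eq_Suc atLeastAtMostSuc_conv)

lemma words_spanned_2: "words_spanned 2"
proof -
  have "words_spanned (Suc 1)"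
  proof (rule words_spanned_SucI[OF words_spanned_1])
    fix f N w and zs :: "rat list"
    assume f: "rat_functional f" "\<And>x. x \<in> gspan (Suc 1) \<Longrightarrow> f x = 0"
      and w: "w \<in> comps (Suc 1)" "length zs = length w"
    note rel = f words_spanned_1
    define A where "A = fval f N"
    have "(\<Sum>(w, ys)\<leftarrow>[([1, 1], [y, z]), ([1, 1], [z, y])]. A w ys) = 0" for y z
      unfolding A_def by (rule pf_relation[OF rel, of "[1]" "[z]" y]) (auto simp: relation_simps)
    hence pf: "A [1, 1] [y, z] + A [1, 1] [z, y] = 0" for y z
      by simp
    have "(\<Sum>(c, w, ys)\<leftarrow>[(1, [1, 1], [z2, z1]), (1 / 2, [2], [z1])]. c * A w ys) = 0" for z1 z2
      unfolding A_def
      by (rule sser_relation[OF rel, where r = 2 and zs = "[z2, z1]"]) (auto simp: sum_comps_2 relation_simps)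
    hence s: "A [1, 1] [z2, z1] + 1 / 2 * A [2] [z1] = 0" for z1 z2
      by simp
    \<comment> \<open>At equal arguments \<open>pf\<close> gives \<open>A [1, 1] [z, z] = 0\<close>,
      and \<open>s\<close> then leaves the word \<open>[2]\<close> alone.\<close>
    have 2: "A [2] [z] = 0" for z
      using s[of z z] pf[of z z] by simp
    moreover have "A [1, 1] [z2, z1] = 0" for z1 z2
      using s[of z2 z1] 2[of z1] by simp
    ultimately show "fval f N w zs = 0"
      using w comps_2 by (auto simp: A_def length_Suc_conv numeral_2_eq_2)
  qed
  thus ?thesis by (simp add: numeral_2_eq_2)
qed

lemma words_spanned_3: "words_spanned 3"
proof -
  have "words_spanned (Suc 2)"
  proof (rule words_spanned_SucI[OF words_spanned_2])
    fix f N w and zs :: "rat list"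
    assume f: "rat_functional f" "\<And>x. x \<in> gspan (Suc 2) \<Longrightarrow> f x = 0"
      and w: "w \<in> comps (Suc 2)" "length zs = length w"
    note rel = f words_spanned_2
    define A where "A = fval f N"
    define al be c where "al x y = A [1, 2] [y, x]" and "be x y = A [2, 1] [y, x]" and "c x = A [3] [x]" for x y
    \<comment> \<open>In a stuffle the coefficient \<open>y\<close> of the new index is added to the
      old coefficients at and below its position, because an index is the sum of the increments from
      there on. Partial fractions make the new index itself an increment, so \<open>sh2\<close> and
      \<open>sh11\<close> only insert \<open>y\<close>.\<close>
    have st: "al (x + y) y + be (x + y) x + c (x + y) = 0" for x y
    proof -
      have "(\<Sum>(w, ys)\<leftarrow>[([1, 2], [y, x + y]), ([3], [x + y]), ([2, 1], [x, x + y])]. A w ys) = 0"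
        unfolding A_def by (rule stuffle_relation[OF rel, of "[2]" "[x]" y]) (auto simp: relation_simps)
      thus ?thesis
        by (simp add: al_def be_def c_def add_ac)
    qed
    have sh2: "al x y + be x y + be y x = 0" for x y
    proof -
      have "(\<Sum>(w, ys)\<leftarrow>[([1, 2], [y, x]), ([2, 1], [y, x]), ([2, 1], [x, y])]. A w ys) = 0"
        unfolding A_def
        by (rule pf_relation[OF rel, of "[2]" "[x]" y]) (auto simp: relation_simps upt_rec)
      thus ?thesis
        by (simp add: al_def be_def add_ac)
    qed
    have sh11: "A [1, 1, 1] [y, z2, z1] + A [1, 1, 1] [z2, y, z1] + A [1, 1, 1] [z2, z1, y] = 0" for y z1 z2
    proof -
      have "(\<Sum>(w, ys)\<leftarrow>[([1, 1, 1], [y, z2, z1]), ([1, 1, 1], [z2, y, z1]), ([1, 1, 1], [z2, z1, y])]. A w ys) = 0"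
        unfolding A_def by (rule pf_relation[OF rel, of "[1, 1]" "[z2, z1]" y]) (auto simp: relation_simps)
      thus ?thesis
        by (simp add: add_ac)
    qed
    \<comment> \<open>Inside a block of equal entries the increments are 0, so only the coefficient
      at the end of each block remains; the word \<open>[1, 2]\<close>, for instance, keeps
      \<open>z3\<close> and \<open>z1\<close>.\<close>
    have s: "A [1, 1, 1] [z3, z2, z1] = - (al z1 z3 / 2 + be z1 z2 / 2 + c z1 / 6)" for z1 z2 z3
    proof -
      have "(\<Sum>(c, w, ys)\<leftarrow>[(1, [1, 1, 1], [z3, z2, z1]), (1 / 2, [1, 2], [z3, z1]), (1 / 2, [2, 1], [z2, z1]),
        (1 / 6, [3], [z1])]. c * A w ys) = 0"
        unfolding A_def
        by (rule sser_relation[OF rel, where r = 3 and zs = "[z3, z2, z1]"])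
           (simp_all add: sum_comps_3 weight_def fact_numeral, auto simp: relation_simps numeral_eq_Suc)
      thus ?thesis
        by (simp add: al_def be_def c_def eq_neg_iff_add_eq_0 add_ac)
    qed
    have "(al y z2 / 2 + be y z1 / 2 + c y / 6) + (al z1 z2 / 2 + be z1 y / 2 + c z1 / 6)
       + (al z1 y / 2 + be z1 z2 / 2 + c z1 / 6) = 0" for y z1 z2
      using sh11[of y z2 z1] unfolding s by linarith
    note zero = functional_equations_degree_3[of al be c, OF st sh2 this]
    have "A [1, 1, 1] [z3, z2, z1] = 0" for z1 z2 z3
      unfolding s by (simp add: zero)
    moreover have "A [1, 2] [x, y] = 0" "A [2, 1] [x, y] = 0" "A [3] [x] = 0" for x y
      by (rule zero[unfolded al_def be_def c_def])+
    moreover have "w \<in> {[1, 1, 1], [1, 2], [2, 1], [3]}"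
      using w(1) unfolding comps_3[symmetric] by (simp add: numeral_3_eq_3 numeral_2_eq_2)
    ultimately show "fval f N w zs = 0"
      using w(2) unfolding A_def by (auto simp: length_Suc_conv)
  qed
  thus ?thesis by (simp add: numeral_3_eq_3 numeral_2_eq_2)
qed

lemma fval_scale:
  assumes "rat_functional f"
  shows "fval f N w (map ((*) t) zs) = t ^ N * fval f N w zs"
proof -
  have "zform (map ((*) t) zs) xs = t * zform zs xs" for xs
    by (simp add: zform_def sum_distrib_left mult.assoc)
  thus ?thesis
    using assms by (simp add: fval_def power_mult_distrib hser_cmult rat_functional_def)
qed

lemma degree_4_vanish:
  assumes f: "rat_functional f" "\<And>x. x \<in> gspan 4 \<Longrightarrow> f x = 0"
    and w: "w \<in> comps 4" "length zs = length w" and N: "N \<ge> 3"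
  shows "fval f N w zs = 0"
proof -
  have "f x = 0" if "x \<in> gspan (Suc 3)" for x
    using f(2) that by simp
  note rel = f(1) this words_spanned_3
  define A where "A = fval f N"
  define al be ga where "al x y z = A [1, 1, 2] [z, y, x]" and "be x y z = A [1, 2, 1] [z, y, x]"
    and "ga x y z = A [2, 1, 1] [z, y, x]" for x y z
  define ep ze et ka where "ep x y = A [1, 3] [y, x]" and "ze x y = A [3, 1] [y, x]"
    and "et x y = A [2, 2] [y, x]" and "ka x = A [4] [x]" for x y
  note defs = al_def be_def ga_def ep_def ze_def et_def ka_def
  define h where "h z1 z2 z3 z4 = (al z1 z3 z4 + be z1 z2 z4 + ga z1 z2 z3) / 2 +
      (ep z1 z4 + ze z1 z2) / 6 + et z1 z3 / 4 + ka z1 / 24" for z1 z2 z3 z4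
  have s: "A [1, 1, 1, 1] [z4, z3, z2, z1] = - h z1 z2 z3 z4" for z1 z2 z3 z4
  proof -
    have "(\<Sum>(c, w, ys)\<leftarrow>[(1, [1, 1, 1, 1], [z4, z3, z2, z1]), (1 / 2, [1, 1, 2], [z4, z3, z1]),
      (1 / 2, [1, 2, 1], [z4, z2, z1]), (1 / 6, [1, 3], [z4, z1]), (1 / 2, [2, 1, 1], [z3, z2, z1]),
      (1 / 4, [2, 2], [z3, z1]), (1 / 6, [3, 1], [z2, z1]), (1 / 24, [4], [z1])]. c * A w ys) = 0"
      unfolding A_def
      by (rule sser_relation[OF rel, where r = 4 and zs = "[z4, z3, z2, z1]"])
         (simp_all add: sum_comps_4 weight_def fact_numeral, auto simp: relation_simps numeral_eq_Suc)
    thus ?thesis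
      by (simp add: h_def defs eq_neg_iff_add_eq_0 add_divide_distrib add_ac)
  qed
  have ins: "A [1, 1, 1, 1] [z3, z2, z1, y] + A [1, 1, 1, 1] [z3, z2, y, z1] +
      A [1, 1, 1, 1] [z3, y, z2, z1] + A [1, 1, 1, 1] [y, z3, z2, z1] = 0" for y z1 z2 z3
  proof -
    have "(\<Sum>(w, ys)\<leftarrow>[([1, 1, 1, 1], [y, z3, z2, z1]), ([1, 1, 1, 1], [z3, y, z2, z1]),
      ([1, 1, 1, 1], [z3, z2, y, z1]), ([1, 1, 1, 1], [z3, z2, z1, y])]. A w ys) = 0"
      unfolding A_def by (rule pf_relation[OF rel, of "[1, 1, 1]" "[z3, z2, z1]" y]) (auto simp: relation_simps)
    thus ?thesis
      by (simp add: add_ac)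
  qed
  have "h y z1 z2 z3 + h z1 y z2 z3 + h z1 z2 y z3 + h z1 z2 z3 y = 0" for y z1 z2 z3
    using ins[where y = y and ?z1.0 = z1 and ?z2.0 = z2 and ?z3.0 = z3] unfolding s by linarith
  note sh111 = this[unfolded h_def]
  have sh12: "ga y z1 z2 + ga z1 y z2 + ga z1 z2 y + be z1 z2 y = 0" for y z1 z2
  proof -
    have "(\<Sum>(w, ys)\<leftarrow>[([1, 2, 1], [y, z2, z1]), ([2, 1, 1], [y, z2, z1]), ([2, 1, 1], [z2, y, z1]),
      ([2, 1, 1], [z2, z1, y])]. A w ys) = 0"
      unfolding A_def by (rule pf_relation[OF rel, of "[2, 1]" "[z2, z1]" y]) (auto simp: relation_simps upt_rec)
    thus ?thesis
      by (simp add: defs add_ac)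
  qed
  have sh21: "be y z1 z2 + al z1 y z2 + be z1 y z2 + al z1 z2 y = 0" for y z1 z2
  proof -
    have "(\<Sum>(w, ys)\<leftarrow>[([1, 1, 2], [y, z2, z1]), ([1, 1, 2], [z2, y, z1]), ([1, 2, 1], [z2, y, z1]),
      ([1, 2, 1], [z2, z1, y])]. A w ys) = 0"
      unfolding A_def by (rule pf_relation[OF rel, of "[1, 2]" "[z2, z1]" y]) (auto simp: relation_simps upt_rec)
    thus ?thesis
      by (simp add: defs add_ac)
  qed
  have sh3: "ep z y + et z y + ze z y + ze y z = 0" for y z
  proof -
    have "(\<Sum>(w, ys)\<leftarrow>[([1, 3], [y, z]), ([2, 2], [y, z]), ([3, 1], [y, z]), ([3, 1], [z, y])]. A w ys) = 0"
      unfolding A_def by (rule pf_relation[OF rel, of "[3]" "[z]" y]) (auto simp: relation_simps upt_rec)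
    thus ?thesis
      by (simp add: defs add_ac)
  qed
  have st3: "ze (y + z) z + ep (y + z) y + ka (y + z) = 0" for y z
  proof -
    have "(\<Sum>(w, ys)\<leftarrow>[([1, 3], [y, z + y]), ([4], [z + y]), ([3, 1], [z, z + y])]. A w ys) = 0"
      unfolding A_def by (rule stuffle_relation[OF rel, of "[3]" "[z]" y]) (auto simp: relation_simps)
    thus ?thesis
      by (simp add: defs add_ac)
  qed
  have st21: "be (z1 + y) z1 z2 + al (z1 + y) (z2 + y) z2 + al (z1 + y) (z2 + y) y
       + ep (z1 + y) z2 + et (z1 + y) (z2 + y) = 0" for y z1 z2
  proof -
    have "(\<Sum>(w, ys)\<leftarrow>[([1, 1, 2], [y, z2 + y, z1 + y]), ([2, 2], [z2 + y, z1 + y]), ([1, 1, 2], [z2, z2 + y, z1 + y]),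
      ([1, 3], [z2, z1 + y]), ([1, 2, 1], [z2, z1, z1 + y])]. A w ys) = 0"
      unfolding A_def by (rule stuffle_relation[OF rel, of "[1, 2]" "[z2, z1]" y]) (auto simp: relation_simps)
    thus ?thesis
      by (simp add: defs add_ac)
  qed
  have scale: "A w (map ((*) t) zs) = t ^ N * A w zs" for t w zs
    unfolding A_def by (rule fval_scale) (rule f(1))
  have "ka (t * x) = t ^ N * ka x" "et (t * x) (t * y) = t ^ N * et x y"
    "ep (t * x) (t * y) = t ^ N * ep x y" "al (t * x) (t * y) (t * z) = t ^ N * al x y z" for t x y z
    using scale[of _ t "[x]"] scale[of _ t "[y, x]"] scale[of _ t "[z, y, x]"] by (simp_all add: defs)
  note zero = functional_equations_degree_4[of N al be ga ep ze et ka, OF N sh111 sh12 sh21 sh3 st3 st21 this]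
  have "A [1, 1, 1, 1] [z4, z3, z2, z1] = 0" for z1 z2 z3 z4
    unfolding s by (simp add: h_def zero)
  moreover have "A [1, 1, 2] [x, y, z] = 0" "A [1, 2, 1] [x, y, z] = 0" "A [2, 1, 1] [x, y, z] = 0"
    "A [1, 3] [x, y] = 0" "A [3, 1] [x, y] = 0" "A [2, 2] [x, y] = 0" "A [4] [x] = 0" for x y z
    by (rule zero[unfolded defs])+
  ultimately show ?thesis
    using w unfolding A_def comps_4 by (auto simp: length_Suc_conv)
qed

lemma degree_4_in_gspan:
  assumes "w \<in> comps 4" "(\<Sum>k<length w. e k) \<ge> 3"
  shows "hser w (\<lambda>xs. \<Prod>k<length w. gap xs k ^ e k) \<in> gspan 4"
  by (rule spanned_from_powers) (rule degree_4_vanish, use assms in auto)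

section \<open>Derivatives\<close>

text \<open>Leibniz rule: one factor \<open>geo d\<close> at a time becomes \<open>d\<close> times
  \<open>geo d + geo d ^ 2\<close>.\<close>

lemma fps_XD_hsum_ones:
  "fps_XD (hsum (replicate r 1) U p) =
    (\<Sum>j<r. hsum (replicate r 1) U (\<lambda>xs. of_nat (xs ! j) * p xs) +
      hsum ((replicate r 1)[j := 2]) U (\<lambda>xs. of_nat (xs ! j) * p xs))"
proof (induction r arbitrary: U p)
  case 0
  have "fps_XD (fps_const c) = 0" for c :: rat
    by (simp add: fps_XD_def)
  thus ?case by simp
next
  case (Suc r)
  define D where "D d = (\<Sum>j<r. hsum (replicate r 1) d (\<lambda>ds. of_nat (ds ! j) * p (d # ds)) +
      hsum ((replicate r 1)[j := 2]) d (\<lambda>ds. of_nat (ds ! j) * p (d # ds)))" for d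
  have "fps_XD (hsum (replicate (Suc r) 1) U p) =
      (\<Sum>d\<in>{0<..<U}. fps_XD (geo d * hsum (replicate r 1) d (\<lambda>ds. p (d # ds))))"
    by (simp add: fps_XD_sum)
  also have "\<dots> = (\<Sum>d\<in>{0<..<U}. (geo d + geo d ^ 2) * hsum (replicate r 1) d (\<lambda>ds. of_nat d * p (d # ds)) + geo d * D d)"
    by (intro sum.cong refl) (simp add: fps_XD_mult fps_XD_geo Suc.IH D_def hsum_cmult mult_ac del: One_nat_def)
  also have "\<dots> = (\<Sum>d\<in>{0<..<U}. geo d * hsum (replicate r 1) d (\<lambda>ds. of_nat d * p (d # ds))) +
      (\<Sum>d\<in>{0<..<U}. geo d ^ 2 * hsum (replicate r 1) d (\<lambda>ds. of_nat d * p (d # ds))) + (\<Sum>d\<in>{0<..<U}. geo d * D d)"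
    by (simp add: distrib_right sum.distrib)
  also have "(\<Sum>d\<in>{0<..<U}. geo d * D d) = (\<Sum>j<r. hsum (1 # replicate r 1) U (\<lambda>xs. of_nat (xs ! Suc j) * p xs) +
      hsum (1 # (replicate r 1)[j := 2]) U (\<lambda>xs. of_nat (xs ! Suc j) * p xs))"
    unfolding D_def sum_distrib_left distrib_left
    by (subst sum.swap) (simp add: sum.distrib)
  finally show ?case
    by (simp add: sum.lessThan_Suc_shift numeral_2_eq_2 del: sum.lessThan_Suc)
qed

lemma fps_XD_hser_ones:
  "fps_XD (hser (replicate r 1) p) =
    (\<Sum>j<r. hser (replicate r 1) (\<lambda>xs. of_nat (xs ! j) * p xs) +
      hser ((replicate r 1)[j := 2]) (\<lambda>xs. of_nat (xs ! j) * p xs))"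
proof (rule has_limit_unique)
  show "has_limit (\<lambda>U. fps_XD (hsum (replicate r 1) U p)) (fps_XD (hser (replicate r 1) p))"
    by (intro has_limit_XD has_limit_hser) (cases r; simp)
  have hd: "(replicate r (1 :: nat))[j := 2] = [] \<or> 1 \<le> hd ((replicate r (1 :: nat))[j := 2])" for j
    by (cases r; cases j) simp_all
  show "has_limit (\<lambda>U. fps_XD (hsum (replicate r 1) U p))
      (\<Sum>j<r. hser (replicate r 1) (\<lambda>xs. of_nat (xs ! j) * p xs) +
        hser ((replicate r 1)[j := 2]) (\<lambda>xs. of_nat (xs ! j) * p xs))"
    unfolding fps_XD_hsum_ones
    by (intro has_limit_sum has_limit_add has_limit_hser hd) (cases r; simp)
qed

section \<open>Series with large entries as single word sums\<close>

text \<open>A repeated entry makes an increment zero, and an entry of \<open>gsh\<close> that is at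
  least 2 raises this increment to a positive power. In this way all terms with repeated indices
  disappear.\<close>

lemma gap_monom_blocks_zero:
  assumes "\<And>xs. xs \<in> chains (length w) \<Longrightarrow> gap (blocks w xs) k = 0" "k < length es" "es ! k > 0"
  shows "hser w (gap_monom es \<circ> blocks w) = 0"
proof -
  have "gap_monom es (blocks w xs) = 0" if "xs \<in> chains (length w)" for xs
    using assms that by (auto simp: gap_monom_def intro!: bexI[of _ k])
  hence "hser w (gap_monom es \<circ> blocks w) = hser w (\<lambda>_. 0)"
    by (intro hser_cong) simp
  thus ?thesis by (simp add: hser_zero)
qed

lemmas blocks_simps = chains_def length_Suc_conv gap_def blocks_def numeral_eq_Suc

lemma hser_blocks_ones: "hser (replicate r 1) (p \<circ> blocks (replicate r 1)) = hser (replicate r 1) p"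
proof (rule hser_cong)
  fix xs assume "xs \<in> chains (length (replicate r (1 :: nat)))"
  hence "length xs = r" by (simp add: chains_def)
  hence "blocks (replicate r 1) xs = xs"
    by (induction r arbitrary: xs) (auto simp: blocks_def length_Suc_conv)
  thus "(p \<circ> blocks (replicate r 1)) xs = p xs" by simp
qed

lemma gsh_2_eq_hser:
  assumes "k1 \<ge> 2"
  shows "gsh [k1, k2] = hser [1, 1] (gap_monom [k1 - 1, k2 - 1])"
proof -
  let ?p = "gap_monom [k1 - 1, k2 - 1]"
  have "hser [2] (?p \<circ> blocks [2]) = 0"
    by (rule gap_monom_blocks_zero[where k = 0]) (use assms in \<open>auto simp: blocks_simps\<close>)
  moreover have "hser [1, 1] (?p \<circ> blocks [1, 1]) = hser [1, 1] ?p"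
    using hser_blocks_ones[of 2 ?p] by (simp add: numeral_2_eq_2)
  moreover have "gsh [k1, k2] = sser 2 ?p"
    by (simp add: gsh_eq_sser numeral_2_eq_2)
  ultimately show ?thesis
    by (simp add: sser_def sum_comps_2 weight_def)
qed

lemma gsh_3_eq_hser:
  assumes "k1 \<ge> 2" "k2 \<ge> 2"
  shows "gsh [k1, k2, k3] = hser [1, 1, 1] (gap_monom [k1 - 1, k2 - 1, k3 - 1])"
proof -
  let ?p = "gap_monom [k1 - 1, k2 - 1, k3 - 1]"
  \<comment> \<open>Joining the first two positions annihilates increment 0, joining the last two
    annihilates increment 1; every composition of 3 other than \<open>[1, 1, 1]\<close> does one of
    these.\<close>
  have "hser [3] (?p \<circ> blocks [3]) = 0" "hser [2, 1] (?p \<circ> blocks [2, 1]) = 0"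
    by (rule gap_monom_blocks_zero[where k = 0]; use assms in \<open>auto simp: blocks_simps\<close>)+
  moreover have "hser [1, 2] (?p \<circ> blocks [1, 2]) = 0"
    by (rule gap_monom_blocks_zero[where k = 1]) (use assms in \<open>auto simp: blocks_simps\<close>)
  moreover have "hser [1, 1, 1] (?p \<circ> blocks [1, 1, 1]) = hser [1, 1, 1] ?p"
    using hser_blocks_ones[of 3 ?p] by (simp add: numeral_3_eq_3)
  moreover have "gsh [k1, k2, k3] = sser 3 ?p"
    by (simp add: gsh_eq_sser numeral_3_eq_3)
  ultimately show ?thesis
    by (simp add: sser_def sum_comps_3 weight_def)
qed

lemma words_spannedD:
  assumes "words_spanned n" "w \<noteq> []" "\<forall>i\<in>set w. 1 \<le> i" "sum_list w \<le> n" "polyfun (length w) p"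
  shows "hser w p \<in> gspan n"
  using assms by (simp add: words_spanned_def)

lemma gspan_subset: "gspan n \<subseteq> rat_fps.span {gsh ls | ls. \<forall>l\<in>set ls. 1 \<le> l}"
  unfolding gspan_def by (rule rat_fps.span_mono) auto

lemma XD_gsh_2_in_gspan:
  assumes "k1 \<ge> 2"
  shows "fps_XD (gsh [k1, k2]) \<in> gspan 3"
proof -
  let ?p = "gap_monom [k1 - 1, k2 - 1]"
  have p: "polyfun 2 (\<lambda>xs. of_nat (xs ! j) * ?p xs)" if "j < 2" for j
    using polyfun_gap_monom[of "[k1 - 1, k2 - 1]"] that
    by (intro polyfun.mult polyfun.coord) (simp_all add: numeral_2_eq_2)
  have "fps_XD (gsh [k1, k2]) = fps_XD (hser (replicate 2 1) ?p)"
    using gsh_2_eq_hser[OF assms, of k2] by (simp add: numeral_2_eq_2)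
  also have "\<dots> \<in> gspan 3"
    unfolding fps_XD_hser_ones
  proof (intro gspan_sum gspan_add)
    fix j :: nat assume j: "j \<in> {..<2}"
    have "hser w (\<lambda>xs. of_nat (xs ! j) * ?p xs) \<in> gspan 3" if "w \<in> {[1, 1], [2, 1], [1, 2]}" for w
      by (rule words_spannedD[OF words_spanned_3]) (use p[of j] j that in \<open>auto simp: numeral_2_eq_2\<close>)
    thus "hser (replicate 2 1) (\<lambda>xs. of_nat (xs ! j) * ?p xs) \<in> gspan 3"
      "hser ((replicate 2 1)[j := 2]) (\<lambda>xs. of_nat (xs ! j) * ?p xs) \<in> gspan 3"
      using j by (auto simp: numeral_2_eq_2 less_Suc_eq)
  qed
  finally show ?thesis .
qed

lemma XD_gsh_3_in_gspan:
  assumes "k1 \<ge> 2" "k2 \<ge> 2"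
  shows "fps_XD (gsh [k1, k2, k3]) \<in> gspan 4"
proof -
  define es where "es = [k1 - 1, k2 - 1, k3 - 1]"
  have len: "length es = 3" by (simp add: es_def)
  have word: "hser w (\<lambda>xs. of_nat (xs ! j) * gap_monom es xs) \<in> gspan 4"
    if w: "w \<in> comps 4" "length w = 3" and j: "j < 3" for w j
  proof -
    define C :: rat where "C = (\<Prod>k<3. 1 / fact (es ! k))"
    define e where "e i k = es ! k + (if k = i then 1 else 0)" for i k
    have eq: "of_nat (xs ! j) * gap_monom es xs = (\<Sum>i\<in>{j..<3}. C * (\<Prod>k<3. gap xs k ^ e i k))"
      if "xs \<in> chains (length w)" for xs
    proof -
      have "length xs = 3" using that w by (simp add: chains_def)
      hence "of_nat (xs ! j) * gap_monom es xs = (\<Sum>i\<in>{j..<3}. gap xs i * gap_monom es xs)"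
        using sum_gaps[of j xs] j by (simp add: sum_distrib_right[symmetric])
      also have "\<dots> = (\<Sum>i\<in>{j..<3}. C * (\<Prod>k<3. gap xs k ^ e i k))"
      proof (intro sum.cong refl)
        fix i assume "i \<in> {j..<3}"
        hence "i < 3" by simp
        have "(\<Prod>k<3. gap xs k ^ e i k) = (\<Prod>k<3. gap xs k ^ (es ! k)) * (\<Prod>k<3. if k = i then gap xs k else 1)"
          unfolding e_def prod.distrib[symmetric] by (intro prod.cong) auto
        also have "(\<Prod>k<3. if k = i then gap xs k else 1) = gap xs i"
          using \<open>i < 3\<close> by simp
        finally show "gap xs i * gap_monom es xs = C * (\<Prod>k<3. gap xs k ^ e i k)"
          by (simp add: gap_monom_def len C_def prod_dividef)
      qed
      finally show ?thesis .
    qed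
    have "hser w (\<lambda>xs. of_nat (xs ! j) * gap_monom es xs) =
        (\<Sum>i\<in>{j..<3}. fps_const C * hser w (\<lambda>xs. \<Prod>k<length w. gap xs k ^ e i k))"
      using hser_cong[of w, OF eq] w by (simp add: hser_sum hser_cmult)
    also have "\<dots> \<in> gspan 4"
    proof (intro gspan_sum gspan_scale degree_4_in_gspan w(1))
      fix i assume "i \<in> {j..<3}"
      \<comment> \<open>\<open>k1 - 1\<close> and \<open>k2 - 1\<close> contribute at least 2, and
        the factor \<open>xs ! j\<close> from the derivative, a sum of increments, contributes 1
        more. This reaches the bound 3 of \<open>degree_4_in_gspan\<close>.\<close>
      have "(\<Sum>k<3. e i k) \<ge> (\<Sum>k<3. es ! k) + (\<Sum>k<3. if k = i then 1 else 0)"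
        unfolding e_def sum.distrib ..
      also have "(\<Sum>k<3. if k = i then 1 else 0) = (1 :: nat)"
        using \<open>i \<in> {j..<3}\<close> by simp
      finally show "3 \<le> (\<Sum>k<length w. e i k)"
        using assms w by (simp add: es_def numeral_3_eq_3)
    qed
    finally show ?thesis .
  qed
  have "fps_XD (gsh [k1, k2, k3]) = fps_XD (hser (replicate 3 1) (gap_monom es))"
    using gsh_3_eq_hser[OF assms, of k3] by (simp add: numeral_3_eq_3 es_def)
  also have "\<dots> \<in> gspan 4"
    unfolding fps_XD_hser_ones
  proof (intro gspan_sum gspan_add)
    fix j :: nat assume j: "j \<in> {..<3}"
    have "polyfun 3 (\<lambda>xs. of_nat (xs ! j) * gap_monom es xs)"
      using polyfun_gap_monom[of es] j len by (intro polyfun.mult polyfun.coord) simp_all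
    hence "hser (replicate 3 1) (\<lambda>xs. of_nat (xs ! j) * gap_monom es xs) \<in> gspan 3"
      by (intro words_spannedD[OF words_spanned_3]) (auto simp: sum_list_replicate)
    thus "hser (replicate 3 1) (\<lambda>xs. of_nat (xs ! j) * gap_monom es xs) \<in> gspan 4"
      using gspan_mono[of 3 4] by auto
    show "hser ((replicate 3 1)[j := 2]) (\<lambda>xs. of_nat (xs ! j) * gap_monom es xs) \<in> gspan 4"
      using j by (intro word) (auto simp: comps_4 numeral_3_eq_3 less_Suc_eq)
  qed
  finally show ?thesis .
qed

section \<open>The derivative of a series with one index\<close>

lemma sser_2: "sser 2 p = hser [1, 1] p + fps_const (1 / 2) * hser [2] (\<lambda>xs. p [hd xs, hd xs])"
proof -
  have "hser [2] (p \<circ> blocks [2]) = hser [2] (\<lambda>xs. p [hd xs, hd xs])"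
    by (rule hser_cong) (auto simp: blocks_simps)
  moreover have "hser [1, 1] (p \<circ> blocks [1, 1]) = hser [1, 1] p"
    using hser_blocks_ones[of 2 p] by (simp add: numeral_2_eq_2)
  ultimately show ?thesis
    by (simp add: sser_def sum_comps_2 weight_def)
qed

text \<open>The product of two degree 1 sums is expanded in both ways with weight
  \<open>(a + d) ^ k\<close>. Comparing indices gives \<open>2 * h11' + h2\<close>, which is exactly
  twice an \<open>sser\<close>; partial fractions give \<open>2 * h11\<close>, which falls short of
  twice an \<open>sser\<close> by the left side, plus terms of degree 1.\<close>

lemma hser_2_power:
  "hser [2] (\<lambda>xs. of_nat (hd xs) ^ k) = 2 * (sser 2 (\<lambda>xs. of_nat (xs ! 0) ^ k) - sser 2 (\<lambda>xs. of_nat (xs ! 0 + xs ! 1) ^ k))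
    + hser [1] (\<lambda>xs. of_nat (hd xs) ^ Suc k) - hser [1] (\<lambda>xs. of_nat (hd xs) ^ k)"
proof -
  define P :: "nat \<times> nat list \<Rightarrow> rat" where "P = (\<lambda>(a, ds). (1 * of_nat a + of_nat (hd ds)) ^ k)"
  define h11 h11' h2 where "h11 = hser [1, 1] (\<lambda>xs. of_nat (xs ! 0) ^ k)"
    and "h11' = hser [1, 1] (\<lambda>xs. of_nat (xs ! 0 + xs ! 1) ^ k)" and "h2 = hser [2] (\<lambda>xs. of_nat (2 * hd xs) ^ k)"
  have "tser (stuffle [1]) P = tser (pf_main [1] @ pf_lower [1]) P"
  proof (rule trans)
    show "tser (stuffle [1]) P = (\<Sum>i\<le>k. fps_const (of_nat (k choose i)) *
        (hser [1] (\<lambda>xs. (1 * of_nat (hd xs)) ^ i) * hser [1] (\<lambda>ds. of_nat (hd ds) ^ (k - i))))"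
      unfolding P_def by (rule tser_power, rule hser_stuffle) simp
    show "\<dots> = tser (pf_main [1] @ pf_lower [1]) P"
      unfolding P_def by (rule tser_power[symmetric], rule hser_partial_fractions) simp
  qed
  moreover have "tser (stuffle [1]) P = h11' + h2 + h11'"
  proof -
    have "hser [1, 1] (P \<circ> (\<lambda>xs. (hd xs, tl xs))) = h11'" "hser [2] (P \<circ> (\<lambda>xs. (hd xs, xs))) = h2"
      "hser [1, 1] (P \<circ> (\<lambda>xs. apsnd ((#) (hd xs)) (hd (tl xs), []))) = h11'"
      unfolding h11'_def h2_def by (rule hser_cong; auto simp: P_def chains_def length_Suc_conv add_ac)+
    thus ?thesis by (simp add: tser_def numeral_2_eq_2)
  qed
  moreover have "tser (pf_main [1] @ pf_lower [1]) P = h11 + h11 +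
      (hser [1] (\<lambda>xs. of_nat (hd xs) ^ Suc k) - hser [1] (\<lambda>xs. of_nat (hd xs) ^ k))"
  proof -
    let ?g = "\<lambda>xs :: nat list. (xs ! 0 - xs ! 1, tl xs)"
    have 1: "hser [1, 1] (P \<circ> ?g) = h11"
      "hser [1, 1] (P \<circ> (\<lambda>xs. case (hd (tl xs), []) of (a, ds) \<Rightarrow> (a, (hd xs - a) # ds))) = h11"
      unfolding h11_def by (rule hser_cong; auto simp: P_def chains_def length_Suc_conv of_nat_diff)+
    have "hser [1, 0] (P \<circ> ?g) = hser [1] (sum_out 1 (P \<circ> ?g))"
      using hser_zero_exponent[of "[1]" "[]"] by simp
    also have "\<dots> = hser [1] (\<lambda>xs. of_nat (hd xs) ^ Suc k + (- 1) * of_nat (hd xs) ^ k)"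
    proof (rule hser_cong)
      fix xs assume "xs \<in> chains (length [1])"
      then obtain x where x: "xs = [x]" "x > 0"
        by (auto simp: chains_def length_Suc_conv)
      \<comment> \<open>The decoded pair always adds up to the top index \<open>x\<close>, so the
        weight is constant over the \<open>x - 1\<close> values of the removed index.\<close>
      have "sum_out 1 (P \<circ> ?g) xs = (\<Sum>d\<in>{0<..<x}. of_nat x ^ k)"
        unfolding sum_out_def by (intro sum.cong) (auto simp: x between_def P_def of_nat_diff)
      also have "\<dots> = (of_nat x - 1) * of_nat x ^ k"
        using x by (simp add: of_nat_diff)
      finally show "sum_out 1 (P \<circ> ?g) xs = of_nat (hd xs) ^ Suc k + (- 1) * of_nat (hd xs) ^ k"
        by (simp add: x algebra_simps)
    qed
    also have "\<dots> = hser [1] (\<lambda>xs. of_nat (hd xs) ^ Suc k) - hser [1] (\<lambda>xs. of_nat (hd xs) ^ k)"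
      unfolding hser_add hser_cmult by (simp flip: fps_const_neg)
    finally show ?thesis
      using 1 by (simp add: tser_def)
  qed
  ultimately have eq: "h11' + h2 + h11' = h11 + h11 +
      (hser [1] (\<lambda>xs. of_nat (hd xs) ^ Suc k) - hser [1] (\<lambda>xs. of_nat (hd xs) ^ k))"
    by simp
  have half: "2 * (fps_const (1 / 2) * F) = F" for F :: "rat fps"
    by (simp add: numeral_fps_const mult.assoc[symmetric])
  have "2 * sser 2 (\<lambda>xs. of_nat (xs ! 0) ^ k) = 2 * h11 + hser [2] (\<lambda>xs. of_nat (hd xs) ^ k)"
    "2 * sser 2 (\<lambda>xs. of_nat (xs ! 0 + xs ! 1) ^ k) = 2 * h11' + h2"
    unfolding sser_2 distrib_left half by (simp_all add: h11_def h11'_def h2_def)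
  thus ?thesis
    using eq by (simp add: algebra_simps)
qed

lemma hser_1_power: "hser [1] (\<lambda>xs. of_nat (hd xs) ^ k) = fps_const (fact k) * gsh [Suc k]"
proof -
  have "fps_const (fact k) * gsh [Suc k] = hser [1] (\<lambda>xs. fact k * gap_monom [k] xs)"
    by (simp add: gsh_eq_sser hser_1_eq_sser[unfolded One_nat_def] hser_cmult)
  also have "\<dots> = hser [1] (\<lambda>xs. of_nat (hd xs) ^ k)"
    by (rule hser_cong) (auto simp: chains_def length_Suc_conv gap_monom_def gap_def)
  finally show ?thesis ..
qed

lemma XD_gsh_1:
  assumes "k \<ge> 1"
  shows "fps_const (1 / of_nat k) * fps_XD (gsh [k]) =
    of_nat (k + 1) * gsh [k + 2] - (\<Sum>n=2..k+1. (2 ^ n - 2) * gsh [k + 2 - n, n])"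
proof -
  define c :: "nat \<Rightarrow> rat fps" where "c x = fps_const (of_nat x)" for x
  obtain m where m: "k = Suc m" using assms by (cases k) auto
  have "fps_const (fact m) * fps_XD (gsh [k]) = fps_XD (hser (replicate 1 1) (\<lambda>xs. of_nat (hd xs) ^ m))"
    using hser_1_power[of m] by (simp add: m)
  also have "\<dots> = hser [1] (\<lambda>xs. of_nat (xs ! 0) * of_nat (hd xs) ^ m) + hser [2] (\<lambda>xs. of_nat (xs ! 0) * of_nat (hd xs) ^ m)"
    unfolding fps_XD_hser_ones by simp
  also have "\<dots> = hser [1] (\<lambda>xs. of_nat (hd xs) ^ k) + hser [2] (\<lambda>xs. of_nat (hd xs) ^ k)"
    by (intro arg_cong2[where f = "(+)"] hser_cong) (auto simp: m chains_def length_Suc_conv)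
  also have "\<dots> = hser [1] (\<lambda>xs. of_nat (hd xs) ^ Suc k) +
      2 * (sser 2 (\<lambda>xs. of_nat (xs ! 0) ^ k) - sser 2 (\<lambda>xs. of_nat (xs ! 0 + xs ! 1) ^ k))"
    unfolding hser_2_power by simp
  also have "hser [1] (\<lambda>xs. of_nat (hd xs) ^ Suc k) = fps_const (fact (Suc k)) * gsh [k + 2]"
    unfolding hser_1_power by simp
  also have "sser 2 (\<lambda>xs. of_nat (xs ! 0) ^ k) - sser 2 (\<lambda>xs. of_nat (xs ! 0 + xs ! 1) ^ k) =
      (\<Sum>e\<le>k. fps_const (fact k * (1 - 2 ^ e)) * gsh [k + 1 - e, e + 1])"
  proof -
    \<comment> \<open>The larger index is \<open>gap xs 0 + gap xs 1\<close>, and the sum of both is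
      \<open>gap xs 0 + 2 * gap xs 1\<close>. The cases \<open>t = 1\<close> and
      \<open>t = 2\<close> thus give the factors \<open>1 - 2 ^ e\<close>.\<close>
    have expand: "sser 2 (\<lambda>xs. (gap xs 0 + t * gap xs 1) ^ k) = (\<Sum>e\<le>k. fps_const (fact k * t ^ e) * gsh [k + 1 - e, e + 1])" for t
    proof -
      have "(gap xs 0 + t * gap xs 1) ^ k = (\<Sum>e\<le>k. fact k * t ^ e * gap_monom [k - e, e] xs)" for xs
      proof -
        have "(t * gap xs 1 + gap xs 0) ^ k = (\<Sum>e\<le>k. of_nat (k choose e) * (t * gap xs 1) ^ e * gap xs 0 ^ (k - e))"
          by (rule binomial_ring)
        also have "\<dots> = (\<Sum>e\<le>k. fact k * t ^ e * gap_monom [k - e, e] xs)"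
          by (intro sum.cong refl)
             (simp add: gap_monom_def binomial_fact lessThan_Suc power_mult_distrib numeral_2_eq_2 field_simps)
        finally show ?thesis by (simp add: add.commute)
      qed
      hence "sser 2 (\<lambda>xs. (gap xs 0 + t * gap xs 1) ^ k) = sser 2 (\<lambda>xs. \<Sum>e\<le>k. fact k * t ^ e * gap_monom [k - e, e] xs)"
        by simp
      also have "\<dots> = (\<Sum>e\<le>k. fps_const (fact k * t ^ e) * sser 2 (gap_monom [k - e, e]))"
      proof -
        have "sser 2 (\<lambda>xs. \<Sum>e\<in>I. p e xs) = (\<Sum>e\<in>I. sser 2 (p e))" if "finite I" for I :: "nat set" and p
          using that sser_cmult[of 2 0 "\<lambda>_. 0"] by (induction I) (simp_all add: sser_add)
        thus ?thesis by (simp add: sser_cmult)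
      qed
      also have "\<dots> = (\<Sum>e\<le>k. fps_const (fact k * t ^ e) * gsh [k + 1 - e, e + 1])"
        by (intro sum.cong refl) (simp add: gsh_eq_sser numeral_2_eq_2 Suc_diff_le)
      finally show ?thesis .
    qed
    have "sser 2 (\<lambda>xs. of_nat (xs ! 0) ^ k) = sser 2 (\<lambda>xs. (gap xs 0 + 1 * gap xs 1) ^ k)"
      "sser 2 (\<lambda>xs. of_nat (xs ! 0 + xs ! 1) ^ k) = sser 2 (\<lambda>xs. (gap xs 0 + 2 * gap xs 1) ^ k)"
      by (rule sser_cong; simp add: gap_def add.commute)+
    thus ?thesis
      unfolding expand by (simp add: sum_subtractf[symmetric] algebra_simps flip: fps_const_sub)
  qed
  finally have XD: "fps_const (fact m) * fps_XD (gsh [k]) = fps_const (fact (Suc k)) * gsh [k + 2] +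
      2 * (\<Sum>e\<le>k. fps_const (fact k * (1 - 2 ^ e)) * gsh [k + 1 - e, e + 1])" .
  have "fps_const (1 / of_nat k) * fps_XD (gsh [k]) = fps_const (1 / fact k) * (fps_const (fact m) * fps_XD (gsh [k]))"
    by (simp add: m mult.assoc[symmetric])
  also have "\<dots> = of_nat (k + 1) * gsh [k + 2] +
      (\<Sum>e\<le>k. fps_const (1 / fact k) * (2 * (fps_const (fact k * (1 - 2 ^ e)) * gsh [k + 1 - e, e + 1])))"
  proof -
    have "fps_const (1 / fact k) * (fps_const (fact (Suc k)) * gsh [k + 2]) = of_nat (k + 1) * gsh [k + 2]"
      by (simp add: mult.assoc[symmetric] fps_of_nat[symmetric] add.commute)
    thus ?thesis
      unfolding XD by (simp only: distrib_left sum_distrib_left)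
  qed
  also have "(\<Sum>e\<le>k. fps_const (1 / fact k) * (2 * (fps_const (fact k * (1 - 2 ^ e)) * gsh [k + 1 - e, e + 1]))) =
      (\<Sum>e\<le>k. - ((2 ^ Suc e - 2) * gsh [k + 1 - e, e + 1]))"
  proof (intro sum.cong refl)
    fix e
    have "fps_const (1 / fact k) * (2 * fps_const (fact k * (1 - 2 ^ e))) = fps_const (- (2 ^ Suc e - 2) :: rat)"
      by (simp add: numeral_fps_const)
    also have "\<dots> = - (2 ^ Suc e - 2)"
      by (simp only: numeral_fps_const fps_const_power fps_const_sub fps_const_neg)
    finally show "fps_const (1 / fact k) * (2 * (fps_const (fact k * (1 - 2 ^ e)) * gsh [k + 1 - e, e + 1])) =
        - ((2 ^ Suc e - 2) * gsh [k + 1 - e, e + 1])"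
      by (simp only: mult.assoc[symmetric] mult_minus_left)
  qed
  \<comment> \<open>The term \<open>e = 0\<close> has the coefficient \<open>2 ^ 1 - 2 = 0\<close>;
    the shift \<open>n = e + 1\<close> then yields the range from 2.\<close>
  also have "\<dots> = (\<Sum>e=1..k. - ((2 ^ Suc e - 2) * gsh [k + 1 - e, e + 1]))"
    by (rule sum.mono_neutral_right) (auto simp: Suc_le_eq)
  also have "\<dots> = - (\<Sum>n=2..k+1. (2 ^ n - 2) * gsh [k + 2 - n, n])"
    unfolding sum_negf[symmetric]
    by (rule sum.reindex_bij_witness[of _ "\<lambda>n. n - 1" Suc]) auto
  finally show ?thesis by simp
qed

theorem theorem1p1:
  shows "(\<forall>k\<ge>1. fps_const (1 / of_nat k) * fps_XD (gsh [k]) =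
            of_nat (k + 1) * gsh [k + 2] - (\<Sum>n=2..k+1. (2 ^ n - 2) * gsh [k + 2 - n, n])) \<and>
         (\<forall>k1\<ge>2. \<forall>k2\<ge>2. \<forall>k3\<ge>2.
            fps_XD (gsh [k1, k2]) \<in> rat_fps.span {gsh ls | ls. \<forall>l\<in>set ls. 1 \<le> l} \<and>
            fps_XD (gsh [k1, k2, k3]) \<in> rat_fps.span {gsh ls | ls. \<forall>l\<in>set ls. 1 \<le> l})"
  by (intro conjI allI impI XD_gsh_1 subsetD[OF gspan_subset[of 3] XD_gsh_2_in_gspan]
      subsetD[OF gspan_subset[of 4] XD_gsh_3_in_gspan])

end
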